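(* Let $m_{01},m_{12},m_{02},n_1,n_2\ge 1$ be integers, $\mathbf m=(m_{01},m_{12},m_{02})$, $\mathbf n=(n_0,n_1,n_2)$ with $n_0=2$, and assume $2\le m_{01}m_{02}$, $n_1\le m_{01}m_{12}$, $n_2\le m_{02}m_{12}$. Put $k_1=m_{01}m_{12}-n_1$ and $k_2=m_{02}m_{12}-n_2$ and suppose $k_2\le k_1$. Let $\mathcal{TNS}^{\Delta}_{\mathbf m,\mathbf n}\subseteq V_0\otimes V_1\otimes V_2=\mathbb C^2\otimes\mathbb C^{n_1}\otimes\mathbb C^{n_2}$ be the tensor network variety of the triangle $\Delta$. Let $(\ast)$ be the condition $$m_{01}=m_{02}\quad\text{and}\quad k_2\le k_1<m_{12}.$$ Suppose $(\ast)$ holds and set $m=m_{01}=m_{02}$. Then: (1) (Dimension.) The affine dimension is $$\dim\mathcal{TNS}^{\Delta}_{\mathbf m,\mathbf n}=2m^2m_{12}^2-m\,m_{12}^2-m\,m_{12}k_1-m\,m_{12}k_2-m\,k_1k_2+2k_1k_2+m.$$ The defect $\delta^\Delta_{\mathbf m,\mathbf n}$, i.e. the expected dimension minus this dimension, equals $(m-2)k_1k_2+(m-1)(m_{12}^2-1)$, unless $\mathcal{TNS}^\Delta_{\mathbf m,\mathbf n}$ is expected to fill the ambient space (that is, its expected dimension is $2n_1n_2$), in which case it equals $m\left(m_{12}^2-m_{12}(k_1+k_2)+k_1k_2-1\right)$. (2) (Normal form.) Up to the action of $GL(V_1)\times GL(V_2)$, the generic element $T\in\mathcal{TNS}^\Delta_{\mathbf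 m,\mathbf n}$, regarded as an $n_1\times n_2$ matrix of linear forms in the basis $v_0,v_1$ of $V_0$, has the form $$T=\begin{pmatrix}T_1&0\\0&T_2\end{pmatrix},$$ where $T_1$ is the square block diagonal matrix of size $m(m_{12}-k_1)$ with the $m$ diagonal blocks $(v_0+\xi_iv_1)\cdot\mathrm{id}_{m_{12}-k_1}$, $i=1,\dots,m$, with $\xi_1,\dots,\xi_m$ generic complex numbers, and $T_2$ is a generic matrix of linear forms in $v_0,v_1$ of size $[(m-1)k_1]\times[(m-1)k_1+(k_1-k_2)]$. (3) (Equations.) For every integer $\kappa$ with $k_1\le\kappa\le m_{12}-2$, put $n'=m\,m_{12}-\kappa$ and let $\lambda(\kappa)=((m_{12}-\kappa)^m,1^{(m-1)\kappa})$, a partition of $n'$. The equations of the coincident root locus $\mathcal C_{\lambda(\kappa)}\subseteq S^{n'}V_0$ pull back to equations for $\mathcal{TNS}^\Delta_{\mathbf m,\mathbf n}$ along the polynomial maps $$\phi_{X_1,X_2}:V_0\otimes V_1\otimes V_2\to S^{n'}V_0,\qquad \phi_{X_1,X_2}(T)=\det\big((X_1\otimes X_2)T\big),$$ where $X_1:V_1\to\mathbb C^{n'}$, $X_2:V_2\to\mathbb C^{n'}$ are linear maps; that is, $\phi_{X_1,X_2}(T)\in\mathcal C_{\lambda(\kappa)}$ for all $T\in\mathcal{TNS}^\Delta_{\mathbf m,\mathbf n}$ and all $X_1,X_2$, whereas for $X_1,X_2$ surjective and $T$ generic in $V_0\otimes V_1\otimes V_2$ one has $\phi_{X_1,X_2}(T)\notin\mathcal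 C_{\lambda(\kappa)}$. If instead $(\ast)$ does not hold, then $\mathcal{TNS}^\Delta_{\mathbf m,\mathbf n}=\mathbb C^2\otimes\mathbb C^{n_1}\otimes\mathbb C^{n_2}$ and $\dim\mathcal{TNS}^\Delta_{\mathbf m,\mathbf n}=2n_1n_2$.
   Context: Everything is over $\mathbb C$. Triangle tensor network variety. Given bond dimensions $\mathbf m=(m_{01},m_{12},m_{02})$, let $(e_a)_{a\le m_{01}}$, $(f_b)_{b\le m_{12}}$, $(g_c)_{c\le m_{02}}$ be the standard bases of $\mathbb C^{m_{01}},\mathbb C^{m_{12}},\mathbb C^{m_{02}}$, and let $W_0=\mathbb C^{m_{01}}\otimes\mathbb C^{m_{02}}$, $W_1=\mathbb C^{m_{01}}\otimes\mathbb C^{m_{12}}$, $W_2=\mathbb C^{m_{12}}\otimes\mathbb C^{m_{02}}$. The graph tensor is $$T(\Delta,\mathbf m)=\sum_{a,b,c}(e_a\otimes g_c)\otimes(e_a\otimes f_b)\otimes(f_b\otimes g_c)\in W_0\otimes W_1\otimes W_2.$$ For physical dimensions $\mathbf n=(n_0,n_1,n_2)$ and $V_i=\mathbb C^{n_i}$, $\mathcal{TNS}^\Delta_{\mathbf m,\mathbf n}\subseteq V_0\otimes V_1\otimes V_2$ is the (Zariski, equivalently Euclidean) closure of the set of all $(X_0\otimes X_1\otimes X_2)(T(\Delta,\mathbf m))$ with $X_i\in\mathrm{Hom}(W_i,V_i)$. It is an irreducible affine variety. Expected dimension: $$\min\Big\{(n_0m_{01}m_{02}-1)+(n_1m_{01}m_{12}-1)+(n_2m_{02}m_{12}-1)-(m_{01}^2-1)-(m_{12}^2-1)-(m_{02}^2-1)+1,\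 n_0n_1n_2\Big\}.$$ The defect $\delta^\Delta_{\mathbf m,\mathbf n}$ is the expected dimension minus $\dim\mathcal{TNS}^\Delta_{\mathbf m,\mathbf n}$. Pencils. With a fixed basis $v_0,v_1$ of $V_0=\mathbb C^2$, a tensor $T=v_0\otimes A_0+v_1\otimes A_1\in V_0\otimes V_1\otimes V_2$ is identified with the $n_1\times n_2$ matrix $v_0A_0+v_1A_1$ whose entries are linear forms in $v_0,v_1$. For linear maps $X_1,X_2$, $(X_1\otimes X_2)T=v_0\otimes X_1A_0X_2^{t}+v_1\otimes X_1A_1X_2^{t}$. Generic. A property holds for a generic element of an irreducible variety if it holds on a nonempty Zariski-open subset. The statement that the generic $T$ has the normal form with generic parameters $(\xi,T_2)$ means: for every nonempty Zariski-open subset $U$ of the space of parameters $(\xi_1,\dots,\xi_m,T_2)$ there is a nonempty Zariski-open subset of $\mathcal{TNS}^\Delta_{\mathbf m,\mathbf n}$ each of whose elements is in the $GL(V_1)\times GL(V_2)$-orbit of a matrix of the given form with $(\xi,T_2)\in U$. Coincident root loci. $S^dV_0$ is the space of homogeneous polynomials of degree $d$ in $v_0,v_1$. For a partition $\lambda=(\lambda_1,\dots,\lambda_s)$ of $d$, $\mathcal C_\lambda=\{\ell_1^{\lambda_1}\cdots\ell_s^{\lambda_s}:\ell_j\in V_0\}\subseteq S^dV_0$. The notation $(a^m,1^q)$ denotes the partition with $m$ parts equal to $a$ and $q$ parts equal to $1$. *)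

theory Defs
  imports
    "HOL-Analysis.Abstract_Topology"
    "HOL-Computational_Algebra.Polynomial"
    "Jordan_Normal_Form.Determinant"
begin

section \<open>Affine varieties over the complex numbers\<close>

text \<open>Coordinates are indexed by a set \<open>I\<close>; a point of affine space is a function that is
  zero off \<open>I\<close>.\<close>

definition affine_space :: "'i set \<Rightarrow> ('i \<Rightarrow> complex) set" where
  "affine_space I = {x. \<forall>i. i \<notin> I \<longrightarrow> x i = 0}"

inductive_set poly_functions :: "(('i \<Rightarrow> complex) \<Rightarrow> complex) set" where
  const: "(\<lambda>x. c) \<in> poly_functions"
| coord: "(\<lambda>x. x i) \<in> poly_functions"
| add: "p \<in> poly_functions \<Longrightarrow> q \<in> poly_functions \<Longrightarrow> (\<lambda>x. p x + q x) \<in> poly_functions"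
| mult: "p \<in> poly_functions \<Longrightarrow> q \<in> poly_functions \<Longrightarrow> (\<lambda>x. p x * q x) \<in> poly_functions"

definition zero_locus :: "'i set \<Rightarrow> (('i \<Rightarrow> complex) \<Rightarrow> complex) set \<Rightarrow> ('i \<Rightarrow> complex) set" where
  "zero_locus I P = {x \<in> affine_space I. \<forall>p\<in>P. p x = 0}"

definition zariski_open :: "'i set \<Rightarrow> ('i \<Rightarrow> complex) set \<Rightarrow> bool" where
  "zariski_open I U \<longleftrightarrow> (\<exists>P\<subseteq>poly_functions. U = affine_space I - zero_locus I P)"

definition zariski :: "'i set \<Rightarrow> ('i \<Rightarrow> complex) topology" where
  "zariski I = topology (zariski_open I)"

lemma istopology_zariski_open: "istopology (zariski_open I)"
  unfolding istopology_def
proof (intro conjI allI impI)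
  fix S T :: "('a \<Rightarrow> complex) set"
  assume "zariski_open I S" "zariski_open I T"
  then obtain P Q where P: "P \<subseteq> poly_functions" "S = affine_space I - zero_locus I P"
    and Q: "Q \<subseteq> poly_functions" "T = affine_space I - zero_locus I Q"
    unfolding zariski_open_def by blast
  let ?R = "(\<lambda>(p, q) x. p x * q x) ` (P \<times> Q)"
  have "?R \<subseteq> poly_functions"
    using P(1) Q(1) by (auto intro: poly_functions.mult)
  moreover have "S \<inter> T = affine_space I - zero_locus I ?R"
  proof (rule set_eq_iff[THEN iffD2], rule allI)
    fix x
    have mem: "x \<in> affine_space I - zero_locus I A \<longleftrightarrow> x \<in> affine_space I \<and> (\<exists>r\<in>A. r x \<noteq> 0)" for A
      unfolding zero_locus_def by auto
    have "(\<exists>r\<in>?R. r x \<noteq> 0) \<longleftrightarrow> (\<exists>p\<in>P. p x \<noteq> 0) \<and> (\<exists>q\<in>Q. q x \<noteq> 0)"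
      by (simp add: image_iff split_beta)
    then show "x \<in> S \<inter> T \<longleftrightarrow> x \<in> affine_space I - zero_locus I ?R"
      unfolding Int_iff P(2) Q(2) mem by argo
  qed
  ultimately show "zariski_open I (S \<inter> T)"
    unfolding zariski_open_def by (intro exI conjI)
next
  fix K :: "('a \<Rightarrow> complex) set set"
  assume K: "Ball K (zariski_open I)"
  let ?P = "\<lambda>S. SOME P. P \<subseteq> poly_functions \<and> S = affine_space I - zero_locus I P"
  have P: "?P S \<subseteq> poly_functions \<and> S = affine_space I - zero_locus I (?P S)" if "S \<in> K" for S
    using bspec[OF K that] unfolding zariski_open_def by (rule someI_ex)
  define P where "P = ?P"
  have sub: "P S \<subseteq> poly_functions" if "S \<in> K" for S
    using P[OF that] unfolding P_def by (rule conjunct1)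
  have eq: "S = affine_space I - zero_locus I (P S)" if "S \<in> K" for S
    using P[OF that] unfolding P_def by (rule conjunct2)
  have "(\<lambda>S. affine_space I - zero_locus I (P S)) ` K = (\<lambda>S. S) ` K"
    by (rule image_cong[OF refl]) (rule eq[symmetric])
  then have "\<Union>K = (\<Union>S\<in>K. affine_space I - zero_locus I (P S))"
    by simp
  also have "\<dots> = affine_space I - zero_locus I (\<Union>S\<in>K. P S)"
    unfolding zero_locus_def by auto
  finally have "\<Union>K = affine_space I - zero_locus I (\<Union>S\<in>K. P S)" .
  moreover have "(\<Union>S\<in>K. P S) \<subseteq> poly_functions"
    using sub by (rule UN_least)
  ultimately show "zariski_open I (\<Union>K)"
    unfolding zariski_open_def by (intro exI conjI)
qed

lemma openin_zariski: "openin (zariski I) U \<longleftrightarrow> zariski_open I U"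
  by (simp add: zariski_def istopology_zariski_open)

lemma topspace_zariski: "topspace (zariski I) = affine_space I"
proof
  show "topspace (zariski I) \<subseteq> affine_space I"
    unfolding topspace_def by (auto simp: openin_zariski zariski_open_def)
  have "zariski_open I (affine_space I)"
    unfolding zariski_open_def zero_locus_def
    using poly_functions.const[of 1] by (intro exI[of _ "{\<lambda>x. 1}"]) simp
  then show "affine_space I \<subseteq> topspace (zariski I)"
    unfolding topspace_def by (auto simp: openin_zariski)
qed

text \<open>The functions \<open>f 0, \<dots>, f (d - 1)\<close> satisfy no nontrivial polynomial relation on \<open>X\<close>. As the
  ground field is infinite, a polynomial in \<open>d\<close> variables is zero iff it vanishes on
  \<open>affine_space {..<d}\<close>.\<close>

definition alg_independent_on ::
  "('i \<Rightarrow> complex) set \<Rightarrow> nat \<Rightarrow> (nat \<Rightarrow> ('i \<Rightarrow> complex) \<Rightarrow> complex) \<Rightarrow> bool" where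
  "alg_independent_on X d f \<longleftrightarrow>
    (\<forall>Q\<in>poly_functions. (\<forall>x\<in>X. Q (\<lambda>j. if j < d then f j x else 0) = 0) \<longrightarrow>
       (\<forall>y\<in>affine_space {..<d}. Q y = 0))"

text \<open>The dimension of an affine variety \<open>X\<close> is the transcendence degree over the complex numbers
  of its coordinate ring, i.e. of its function field if \<open>X\<close> is irreducible. The supremum is over a
  bounded set whenever \<open>X\<close> lies in a finite-dimensional affine space.\<close>

definition variety_dim :: "('i \<Rightarrow> complex) set \<Rightarrow> nat" where
  "variety_dim X = Sup {d. \<exists>f. (\<forall>j<d. f j \<in> poly_functions) \<and> alg_independent_on X d f}"

text \<open>Nonempty and open in the (relative) Zariski topology of \<open>X\<close>, for \<open>X\<close> a subset of
  \<open>affine_space I\<close>.\<close>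

definition nonempty_open_in :: "'i set \<Rightarrow> ('i \<Rightarrow> complex) set \<Rightarrow> ('i \<Rightarrow> complex) set \<Rightarrow> bool" where
  "nonempty_open_in I X U \<longleftrightarrow> U \<noteq> {} \<and> openin (subtopology (zariski I) X) U"

section \<open>The triangle tensor network variety\<close>

abbreviation tensor_index :: "nat \<Rightarrow> nat \<Rightarrow> nat \<Rightarrow> (nat \<times> nat \<times> nat) set" where
  "tensor_index n0 n1 n2 \<equiv> {..<n0} \<times> {..<n1} \<times> {..<n2}"

abbreviation tensor_space :: "nat \<Rightarrow> nat \<Rightarrow> nat \<Rightarrow> (nat \<times> nat \<times> nat \<Rightarrow> complex) set" where
  "tensor_space n0 n1 n2 \<equiv> affine_space (tensor_index n0 n1 n2)"

text \<open>The basis vectors of \<open>W\<^sub>0\<close>, \<open>W\<^sub>1\<close>, \<open>W\<^sub>2\<close> are indexed by pairs \<open>(a, c)\<close>, \<open>(a, b)\<close>, \<open>(b, c)\<close>.\<close>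

definition triangle_tensor ::
  "nat \<Rightarrow> nat \<Rightarrow> nat \<Rightarrow> (nat \<times> nat) \<times> (nat \<times> nat) \<times> (nat \<times> nat) \<Rightarrow> complex" where
  "triangle_tensor m01 m12 m02 =
    (\<lambda>w. \<Sum>a<m01. \<Sum>b<m12. \<Sum>c<m02. of_bool (w = ((a, c), (a, b), (b, c))))"

text \<open>\<open>X0 \<otimes> X1 \<otimes> X2\<close> applied to \<open>T\<close>, where \<open>Xi\<close> is the linear map from \<open>\<complex>\<close>-vectors indexed by
  \<open>Ji\<close> to \<open>\<complex>\<close>-vectors of length \<open>ni\<close> with matrix entries \<open>Xi row column\<close>.\<close>

definition apply_tensor_maps ::
  "nat \<Rightarrow> nat \<Rightarrow> nat \<Rightarrow> 'a set \<Rightarrow> 'b set \<Rightarrow> 'c set \<Rightarrow>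
   (nat \<Rightarrow> 'a \<Rightarrow> complex) \<Rightarrow> (nat \<Rightarrow> 'b \<Rightarrow> complex) \<Rightarrow> (nat \<Rightarrow> 'c \<Rightarrow> complex) \<Rightarrow>
   ('a \<times> 'b \<times> 'c \<Rightarrow> complex) \<Rightarrow> nat \<times> nat \<times> nat \<Rightarrow> complex" where
  "apply_tensor_maps n0 n1 n2 J0 J1 J2 X0 X1 X2 T = (\<lambda>(i, j, k).
     if i < n0 \<and> j < n1 \<and> k < n2
     then \<Sum>p\<in>J0. \<Sum>q\<in>J1. \<Sum>r\<in>J2. X0 i p * X1 j q * X2 k r * T (p, q, r)
     else 0)"

definition TNS_triangle ::
  "nat \<Rightarrow> nat \<Rightarrow> nat \<Rightarrow> nat \<Rightarrow> nat \<Rightarrow> nat \<Rightarrow> (nat \<times> nat \<times> nat \<Rightarrow> complex) set" where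
  "TNS_triangle m01 m12 m02 n0 n1 n2 =
     zariski (tensor_index n0 n1 n2) closure_of
       {T. \<exists>X0 X1 X2. T = apply_tensor_maps n0 n1 n2
          ({..<m01} \<times> {..<m02}) ({..<m01} \<times> {..<m12}) ({..<m12} \<times> {..<m02})
          X0 X1 X2 (triangle_tensor m01 m12 m02)}"

definition expected_dim :: "nat \<Rightarrow> nat \<Rightarrow> nat \<Rightarrow> nat \<Rightarrow> nat \<Rightarrow> nat \<Rightarrow> int" where
  "expected_dim m01 m12 m02 n0 n1 n2 =
     min ((int n0 * int m01 * int m02 - 1) + (int n1 * int m01 * int m12 - 1)
            + (int n2 * int m02 * int m12 - 1)
            - ((int m01)^2 - 1) - ((int m12)^2 - 1) - ((int m02)^2 - 1) + 1)
         (int n0 * int n1 * int n2)"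

definition TNS_defect :: "nat \<Rightarrow> nat \<Rightarrow> nat \<Rightarrow> nat \<Rightarrow> nat \<Rightarrow> nat \<Rightarrow> int" where
  "TNS_defect m01 m12 m02 n0 n1 n2 =
     expected_dim m01 m12 m02 n0 n1 n2 - int (variety_dim (TNS_triangle m01 m12 m02 n0 n1 n2))"

section \<open>Pencils and coincident root loci\<close>

text \<open>The polynomial ring in \<open>v\<^sub>0\<close>, \<open>v\<^sub>1\<close> is rendered as \<open>complex poly poly\<close>, with \<open>v\<^sub>0\<close> the inner and
  \<open>v\<^sub>1\<close> the outer variable.\<close>

definition scalar :: "complex \<Rightarrow> complex poly poly" where
  "scalar c = [:[:c:]:]"

definition lin_form :: "complex \<Rightarrow> complex \<Rightarrow> complex poly poly" where
  "lin_form c0 c1 = (let v0 = [:[:0, 1:]:]; v1 = [:0, 1:] in scalar c0 * v0 + scalar c1 * v1)"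

definition pencil_mat :: "nat \<Rightarrow> nat \<Rightarrow> (nat \<times> nat \<times> nat \<Rightarrow> complex) \<Rightarrow> complex poly poly mat" where
  "pencil_mat n1 n2 T = mat n1 n2 (\<lambda>(j, k). lin_form (T (0, j, k)) (T (1, j, k)))"

text \<open>\<open>X1 \<otimes> X2\<close> acting on a matrix of linear forms: \<open>X1 M X2\<^sup>t\<close>.\<close>

definition pencil_act ::
  "complex mat \<Rightarrow> complex mat \<Rightarrow> complex poly poly mat \<Rightarrow> complex poly poly mat" where
  "pencil_act X1 X2 M = map_mat scalar X1 * M * transpose_mat (map_mat scalar X2)"

definition surjective_mat :: "complex mat \<Rightarrow> bool" where
  "surjective_mat A \<longleftrightarrow> (\<lambda>v. A *\<^sub>v v) ` carrier_vec (dim_col A) = carrier_vec (dim_row A)"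

definition general_linear :: "nat \<Rightarrow> complex mat set" where
  "general_linear n = {g \<in> carrier_mat n n. invertible_mat g}"

text \<open>The block matrix with diagonal blocks \<open>T\<^sub>1\<close>, built from \<open>m\<close> blocks \<open>(v\<^sub>0 + \<xi>\<^sub>i v\<^sub>1) id\<^sub>s\<close>,
  and \<open>T\<^sub>2\<close> of size \<open>p \<times> q\<close>.\<close>

definition normal_form ::
  "nat \<Rightarrow> nat \<Rightarrow> nat \<Rightarrow> nat \<Rightarrow> (nat \<Rightarrow> complex) \<Rightarrow> (nat \<times> nat \<times> nat \<Rightarrow> complex) \<Rightarrow>
   complex poly poly mat" where
  "normal_form m s p q \<xi> T2 =
     four_block_mat
       (diag_block_mat (map (\<lambda>i. lin_form 1 (\<xi> i) \<cdot>\<^sub>m 1\<^sub>m s) [0..<m])) (0\<^sub>m (m * s) q)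
       (0\<^sub>m p (m * s)) (pencil_mat p q T2)"

text \<open>Indices of the parameters \<open>(\<xi>\<^sub>1, \<dots>, \<xi>\<^sub>m, T\<^sub>2)\<close>; a parameter point is \<open>case_sum \<xi> T2\<close>.\<close>

definition param_index :: "nat \<Rightarrow> nat \<Rightarrow> nat \<Rightarrow> (nat + nat \<times> nat \<times> nat) set" where
  "param_index m p q = {..<m} <+> tensor_index 2 p q"

definition coincident_root_locus :: "nat list \<Rightarrow> complex poly poly set" where
  "coincident_root_locus parts =
     {f. \<exists>c0 c1. f = (\<Prod>j<length parts. lin_form (c0 j) (c1 j) ^ (parts ! j))}"

end

theory Submission
  imports
    Defs
    "HOL-Computational_Algebra.Fundamental_Theorem_Algebra"
    "HOL-Computational_Algebra.Field_as_Ring"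
begin

text \<open>
  A network with \<open>n\<^sub>0 = 2\<close> is a pencil \<open>X\<^sub>1 (B \<otimes> id) X\<^sub>2\<^sup>t\<close> with \<open>B\<close> an \<open>m\<^sub>0\<^sub>1 \<times> m\<^sub>0\<^sub>2\<close> matrix of linear
  forms. If \<open>m\<^sub>0\<^sub>1 \<noteq> m\<^sub>0\<^sub>2\<close>, the orbit of a suitable \<open>B\<close> is open, hence so is the orbit of \<open>B \<otimes> id\<close>, and
  the networks are dense. If \<open>m\<^sub>0\<^sub>1 = m\<^sub>0\<^sub>2 = m\<close>, then \<open>B\<close> may be taken diagonal with entries
  \<open>v\<^sub>0 + \<xi>\<^sub>i v\<^sub>1\<close>. For \<open>k\<^sub>1 \<ge> m\<^sub>1\<^sub>2\<close> the pencil can be obtained from the \<open>(m - 1) \<times> m\<close> case, which is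
  dense. Otherwise the row space of \<open>X\<^sub>1\<close> meets each of the \<open>m\<close> blocks of \<open>m\<^sub>1\<^sub>2\<close> coordinates in
  dimension at least \<open>m\<^sub>1\<^sub>2 - k\<^sub>1\<close>, so up to a change of rows each form \<open>v\<^sub>0 + \<xi>\<^sub>i v\<^sub>1\<close> divides
  \<open>m\<^sub>1\<^sub>2 - k\<^sub>1\<close> rows. Such pencils are generically equivalent to the normal form, and the normal form is
  in the closure of the networks because \<open>T\<^sub>2\<close> is a dense \<open>(m - 1) \<times> m\<close> case again.

  All density statements are infinitesimal: a set is Zariski dense in an affine space if curves in it
  through one point realize every tangent vector. The same criterion gives the lower bound for the
  dimension; the upper bound is a polynomial parametrization by as many parameters.

  A determinant of a network is divisible by the \<open>(m\<^sub>1\<^sub>2 - \<kappa>)\<close>-th powers of the \<open>m\<close> forms. This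
  passes to the closure because the roots are integral over the coefficients of the determinant.
\<close>

text \<open>The rows are normalized rather than the columns because \<open>k2 \<le> k1\<close>, that
  is \<open>n1 \<le> n2\<close>. The count is exact: with \<open>s = m12 - k1\<close> one has
  \<open>n1 = m * s + (m - 1) * k1\<close>, so beside the \<open>m * s\<close> divisible rows there
  remain \<open>(m - 1) * k1\<close> unconstrained ones, the rows of \<open>T2\<close>. The same
  count explains the equations: cut down to size \<open>m * m12 - \<kappa>\<close> by
  \<open>X1\<close> and \<open>X2\<close>, a network is again a network with the same bonds and
  \<kappa> in place of both \<open>k1\<close> and \<open>k2\<close>, so (3) concerns square networks
  only.

  Each normalization needs something invertible or distinct and thus holds only generically; so
  inclusions between closures are chained along polynomial maps. Closures alone do not suffice
  twice. In (2) a generic element itself has to lie in an orbit, which takes an open subset of the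
  closure inside the image: preimages are built coordinate by coordinate off the zeros of a
  polynomial. In (3) every element counts, so no such zeros may be discarded; there \<tau> is
  adapted to the element so that the determinant does not vanish at (1, \<tau>).\<close>

section \<open>Polynomial functions\<close>

text \<open>Elimination and dimension counts need to know which coordinates a polynomial involves;
  \<open>poly_functions\<close> does not record this.\<close>

inductive_set poly_on :: "'i set \<Rightarrow> (('i \<Rightarrow> complex) \<Rightarrow> complex) set" for J where
  const: "(\<lambda>x. c) \<in> poly_on J"
| coord: "i \<in> J \<Longrightarrow> (\<lambda>x. x i) \<in> poly_on J"
| add: "p \<in> poly_on J \<Longrightarrow> q \<in> poly_on J \<Longrightarrow> (\<lambda>x. p x + q x) \<in> poly_on J"
| mult: "p \<in> poly_on J \<Longrightarrow> q \<in> poly_on J \<Longrightarrow> (\<lambda>x. p x * q x) \<in> poly_on J"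

lemma poly_functions_eq: "poly_functions = poly_on UNIV"
proof
  show "poly_functions \<subseteq> (poly_on UNIV :: (('i \<Rightarrow> complex) \<Rightarrow> complex) set)"
  proof
    fix p :: "('i \<Rightarrow> complex) \<Rightarrow> complex" assume "p \<in> poly_functions"
    then show "p \<in> poly_on UNIV"
      by induction (auto intro: poly_on.intros)
  qed
  show "(poly_on UNIV :: (('i \<Rightarrow> complex) \<Rightarrow> complex) set) \<subseteq> poly_functions"
  proof
    fix p :: "('i \<Rightarrow> complex) \<Rightarrow> complex" assume "p \<in> poly_on UNIV"
    then show "p \<in> poly_functions"
      by induction (auto intro: poly_functions.intros)
  qed
qed

lemma poly_on_mono: "p \<in> poly_on J \<Longrightarrow> J \<subseteq> L \<Longrightarrow> p \<in> poly_on L"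
  by (induction rule: poly_on.induct) (auto intro: poly_on.intros)

lemma poly_on_poly_functions: "p \<in> poly_on J \<Longrightarrow> p \<in> poly_functions"
  using poly_on_mono[of p J UNIV] by (simp add: poly_functions_eq)

lemma poly_on_cong: "p \<in> poly_on J \<Longrightarrow> (\<And>i. i \<in> J \<Longrightarrow> x i = y i) \<Longrightarrow> p x = p y"
  by (induction rule: poly_on.induct) auto

lemma poly_on_uminus: "p \<in> poly_on J \<Longrightarrow> (\<lambda>x. - p x) \<in> poly_on J"
  using poly_on.mult[OF poly_on.const[of "-1"], of p J] by simp

lemma poly_on_diff: "p \<in> poly_on J \<Longrightarrow> q \<in> poly_on J \<Longrightarrow> (\<lambda>x. p x - q x) \<in> poly_on J"
  using poly_on.add[OF _ poly_on_uminus, of p J q] by simp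

lemma poly_on_sum: "(\<And>a. a \<in> A \<Longrightarrow> f a \<in> poly_on J) \<Longrightarrow> (\<lambda>x. \<Sum>a\<in>A. f a x) \<in> poly_on J"
  by (induction A rule: infinite_finite_induct) (auto intro: poly_on.intros)

lemma poly_on_prod: "(\<And>a. a \<in> A \<Longrightarrow> f a \<in> poly_on J) \<Longrightarrow> (\<lambda>x. \<Prod>a\<in>A. f a x) \<in> poly_on J"
  by (induction A rule: infinite_finite_induct) (auto intro: poly_on.intros)

lemma poly_on_power: "p \<in> poly_on J \<Longrightarrow> (\<lambda>x. p x ^ n) \<in> poly_on J"
  by (induction n) (auto intro: poly_on.intros)

lemma poly_on_if: "p \<in> poly_on J \<Longrightarrow> q \<in> poly_on J \<Longrightarrow> (\<lambda>x. if b then p x else q x) \<in> poly_on J"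
  by (cases b) auto

lemmas poly_on_intros = poly_on.const poly_on.add poly_on.mult poly_on_uminus poly_on_diff
  poly_on_sum poly_on_prod poly_on_power poly_on_if

lemma poly_on_det:
  assumes "\<And>i j. i < n \<Longrightarrow> j < n \<Longrightarrow> (\<lambda>x. f x i j) \<in> poly_on J"
  shows "(\<lambda>x. det (mat n n (\<lambda>(i, j). f x i j))) \<in> poly_on J"
proof -
  have eq: "det (mat n n (\<lambda>(i, j). f x i j)) =
    (\<Sum>p \<in> {p. p permutes {0..<n}}. signof p * (\<Prod>i=0..<n. f x i (p i)))" for x
    unfolding det_def
    by (auto intro!: sum.cong arg_cong2[of _ _ _ _ "(*)"] prod.cong simp: permutes_in_image)
  have "(\<lambda>x. f x i (p i)) \<in> poly_on J" if "p permutes {0..<n}" "i \<in> {0..<n}" for p i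
    using permutes_in_image[OF that(1), of i] that(2) by (intro assms) auto
  then show ?thesis
    unfolding eq by (intro poly_on.mult poly_on.const poly_on_sum poly_on_prod) blast
qed

lemma poly_on_subst:
  "P \<in> poly_on J \<Longrightarrow> (\<And>i. i \<in> J \<Longrightarrow> (\<lambda>x. F x i) \<in> poly_on L) \<Longrightarrow> (\<lambda>x. P (F x)) \<in> poly_on L"
  by (induction rule: poly_on.induct) (auto intro: poly_on.intros)

lemma poly_functions_subst:
  "P \<in> poly_functions \<Longrightarrow> (\<And>i. (\<lambda>x. F x i) \<in> poly_on L) \<Longrightarrow> (\<lambda>x. P (F x)) \<in> poly_on L"
  using poly_on_subst[of P UNIV F L] by (simp add: poly_functions_eq)

definition restrict_to :: "'i set \<Rightarrow> ('i \<Rightarrow> complex) \<Rightarrow> 'i \<Rightarrow> complex" where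
  "restrict_to K x = (\<lambda>i. if i \<in> K then x i else 0)"

lemma restrict_to_mem [simp]: "restrict_to K x \<in> affine_space K"
  by (auto simp: restrict_to_def affine_space_def)

lemma restrict_to_id [simp]: "x \<in> affine_space K \<Longrightarrow> restrict_to K x = x"
  by (auto simp: restrict_to_def affine_space_def)

lemma poly_on_restrict: "P \<in> poly_functions \<Longrightarrow> (\<lambda>x. P (restrict_to K x)) \<in> poly_on K"
proof (rule poly_functions_subst[of P "restrict_to K"])
  show "(\<lambda>x. restrict_to K x i) \<in> poly_on K" for i
    by (cases "i \<in> K") (simp_all add: restrict_to_def poly_on.coord poly_on.const)
qed

lemma poly_functions_along_line:
  "P \<in> poly_functions \<Longrightarrow> \<exists>p :: complex poly. \<forall>t. P (\<lambda>i. x i + t * z i) = poly p t"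
proof (induction rule: poly_functions.induct)
  case (const c)
  then show ?case by (intro exI[of _ "[:c:]"]) simp
next
  case (coord i)
  then show ?case by (intro exI[of _ "[:x i, z i:]"]) simp
next
  case (add p q)
  then obtain a b :: "complex poly" where "\<forall>t. p (\<lambda>i. x i + t * z i) = poly a t"
    "\<forall>t. q (\<lambda>i. x i + t * z i) = poly b t" by blast
  then show ?case by (intro exI[of _ "a + b"]) simp
next
  case (mult p q)
  then obtain a b :: "complex poly" where "\<forall>t. p (\<lambda>i. x i + t * z i) = poly a t"
    "\<forall>t. q (\<lambda>i. x i + t * z i) = poly b t" by blast
  then show ?case by (intro exI[of _ "a * b"]) simp
qed

text \<open>Affine space is irreducible: on the line through \<open>x\<close> and \<open>y\<close>
  both factors become nonzero univariate polynomials, so their product has a non-root.\<close>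

lemma poly_functions_mult_nonzero:
  assumes P: "P \<in> poly_functions" "P x \<noteq> 0" and Q: "Q \<in> poly_functions" "Q y \<noteq> 0"
  shows "\<exists>t. P (\<lambda>i. x i + t * (y i - x i)) * Q (\<lambda>i. x i + t * (y i - x i)) \<noteq> 0"
proof (rule ccontr)
  obtain p :: "complex poly" where p: "\<And>t. P (\<lambda>i. x i + t * (y i - x i)) = poly p t"
    using poly_functions_along_line[OF P(1), of x "\<lambda>i. y i - x i"] by blast
  obtain q :: "complex poly" where q: "\<And>t. Q (\<lambda>i. x i + t * (y i - x i)) = poly q t"
    using poly_functions_along_line[OF Q(1), of x "\<lambda>i. y i - x i"] by blast
  assume "\<not> ?thesis"
  then have "poly (p * q) t = 0" for t
    by (simp add: p q)
  then have "p * q = 0"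
    by (intro poly_all_0_iff_0[THEN iffD1] allI)
  moreover have "poly p 0 \<noteq> 0" "poly q 1 \<noteq> 0"
    using p[of 0, symmetric] q[of 1, symmetric] P(2) Q(2) by simp_all
  ultimately show False by auto
qed

lemma poly_functions_zero_if_generic:
  assumes "P \<in> poly_functions" "h \<in> poly_functions" "h x0 \<noteq> 0"
    and "\<And>x. h x \<noteq> 0 \<Longrightarrow> P x = 0"
  shows "P x = 0"
proof (rule ccontr)
  assume "P x \<noteq> 0"
  then obtain t where "P (\<lambda>i. x i + t * (x0 i - x i)) * h (\<lambda>i. x i + t * (x0 i - x i)) \<noteq> 0"
    using poly_functions_mult_nonzero[of P x h x0] assms by blast
  then show False
    using assms(4)[of "\<lambda>i. x i + t * (x0 i - x i)"] by (metis mult_eq_0_iff)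
qed

text \<open>Unlike in \<open>poly_functions_along_line\<close>, the coefficients are polynomial
  functions of the direction and the bound \<open>n\<close> is uniform in it, so that the direction
  may itself vary with \<open>t\<close>.\<close>

lemma poly_functions_homogeneous_expansion:
  "P \<in> poly_functions \<Longrightarrow> \<exists>n c. (\<forall>k. c k \<in> poly_functions) \<and>
     (\<forall>t z. P (\<lambda>i. x i + t * z i) = (\<Sum>k\<le>n. c k z * t ^ k))"
proof (induction rule: poly_functions.induct)
  case (const a)
  then show ?case
    by (intro exI[of _ 0] exI[of _ "\<lambda>k z. a"]) (auto intro: poly_functions.intros)
next
  case (coord i)
  let ?c = "\<lambda>(k :: nat) z. if k = 0 then x i else z i"
  have "?c k \<in> poly_functions" for k
    by (cases "k = 0") (simp_all add: poly_functions.intros)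
  moreover have "x i + t * z i = (\<Sum>k\<le>Suc 0. ?c k z * t ^ k)" for t z
    by simp
  ultimately show ?case
    by (intro exI[of _ "Suc 0"] exI[of _ ?c] conjI allI)
next
  case (add p q)
  from add.IH(1) obtain n c where c: "\<forall>k. c k \<in> poly_functions"
    "\<forall>t z. p (\<lambda>i. x i + t * z i) = (\<Sum>k\<le>n. c k z * t ^ k)"
    by (elim exE conjE)
  from add.IH(2) obtain m d where d: "\<forall>k. d k \<in> poly_functions"
    "\<forall>t z. q (\<lambda>i. x i + t * z i) = (\<Sum>k\<le>m. d k z * t ^ k)"
    by (elim exE conjE)
  let ?c = "\<lambda>k z. (if k \<le> n then c k z else 0) + (if k \<le> m then d k z else 0)"
  have "?c k \<in> poly_functions" for k
    using c(1) d(1) poly_functions.const[of 0]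
    by (intro poly_functions.add) (cases "k \<le> n"; cases "k \<le> m"; simp)+
  moreover have "(\<Sum>k\<le>n. c k z * t ^ k) + (\<Sum>k\<le>m. d k z * t ^ k) = (\<Sum>k\<le>n+m. ?c k z * t ^ k)" for z t
    unfolding distrib_right sum.distrib
    by (intro arg_cong2[of _ _ _ _ "(+)"] sum.mono_neutral_cong_left) auto
  ultimately show ?case using c(2) d(2)
    by (intro exI[of _ "n+m"] exI[of _ ?c]) simp
next
  case (mult p q)
  from mult.IH(1) obtain n c where c: "\<forall>k. c k \<in> poly_functions"
    "\<forall>t z. p (\<lambda>i. x i + t * z i) = (\<Sum>k\<le>n. c k z * t ^ k)"
    by (elim exE conjE)
  from mult.IH(2) obtain m d where d: "\<forall>k. d k \<in> poly_functions"
    "\<forall>t z. q (\<lambda>i. x i + t * z i) = (\<Sum>k\<le>m. d k z * t ^ k)"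
    by (elim exE conjE)
  let ?c = "\<lambda>k z. if k \<le> n then c k z else 0" and ?d = "\<lambda>k z. if k \<le> m then d k z else 0"
  let ?e = "\<lambda>k z. \<Sum>i\<le>k. ?c i z * ?d (k - i) z"
  have "?e k \<in> poly_functions" for k
    using c(1) d(1) unfolding poly_functions_eq by (intro poly_on_intros) auto
  moreover have "(\<Sum>k\<le>n. c k z * t ^ k) * (\<Sum>k\<le>m. d k z * t ^ k) = (\<Sum>k\<le>n+m. ?e k z * t ^ k)" for z t
  proof -
    have "(\<Sum>k\<le>n. c k z * t ^ k) * (\<Sum>k\<le>m. d k z * t ^ k)
      = (\<Sum>k\<le>n. ?c k z * t ^ k) * (\<Sum>k\<le>m. ?d k z * t ^ k)"
      by simp
    also have "\<dots> = (\<Sum>k\<le>n+m. ?e k z * t ^ k)"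
      by (rule polynomial_product) auto
    finally show ?thesis .
  qed
  ultimately show ?case using c(2) d(2)
    by (intro exI[of _ "n+m"] exI[of _ ?e]) simp
qed

lemma poly_functions_tendsto:
  "P \<in> poly_functions \<Longrightarrow> (\<And>i. ((\<lambda>t. w t i) \<longlongrightarrow> z i) F) \<Longrightarrow> ((\<lambda>t. P (w t)) \<longlongrightarrow> P z) F"
  by (induction rule: poly_functions.induct) (auto intro: tendsto_intros)

section \<open>Zariski closure\<close>

text \<open>A closure without ambient index set, so that inclusions can be chained between spaces
  with different indices; \<open>closure_of_zariski\<close> relates it to the topology.\<close>

definition zcl :: "('i \<Rightarrow> complex) set \<Rightarrow> ('i \<Rightarrow> complex) set" where
  "zcl S = {y. \<forall>P\<in>poly_functions. (\<forall>x\<in>S. P x = 0) \<longrightarrow> P y = 0}"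

lemma zclI: "(\<And>P. P \<in> poly_functions \<Longrightarrow> (\<And>x. x \<in> S \<Longrightarrow> P x = 0) \<Longrightarrow> P y = 0) \<Longrightarrow> y \<in> zcl S"
  by (auto simp: zcl_def)

lemma zclD: "y \<in> zcl S \<Longrightarrow> P \<in> poly_functions \<Longrightarrow> (\<And>x. x \<in> S \<Longrightarrow> P x = 0) \<Longrightarrow> P y = 0"
  by (auto simp: zcl_def)

lemma zcl_superset: "S \<subseteq> zcl S"
  by (auto simp: zcl_def)

lemma zcl_least: "S \<subseteq> zcl S' \<Longrightarrow> zcl S \<subseteq> zcl S'"
  by (auto simp: zcl_def subset_iff)

lemma zcl_mono: "S \<subseteq> S' \<Longrightarrow> zcl S \<subseteq> zcl S'"
  by (auto simp: zcl_def subset_iff)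

lemma zcl_image:
  assumes "y \<in> zcl S" "\<And>i. (\<lambda>x. F x i) \<in> poly_functions"
  shows "F y \<in> zcl (F ` S)"
proof (rule zclI)
  fix P :: "('b \<Rightarrow> complex) \<Rightarrow> complex"
  assume P: "P \<in> poly_functions" "\<And>x. x \<in> F ` S \<Longrightarrow> P x = 0"
  have "(\<lambda>x. P (F x)) \<in> poly_functions"
    using poly_functions_subst[OF P(1), of F UNIV] assms(2) by (simp add: poly_functions_eq)
  then show "P (F y) = 0"
    using zclD[OF assms(1)] P(2) by blast
qed

text \<open>Continuity of polynomial maps, in the form used throughout: to place \<open>F y\<close>
  in a closure, replace \<open>y\<close> by points of a set whose closure contains it.\<close>

lemma zcl_image_subset:
  assumes "y \<in> zcl S" "\<And>i. (\<lambda>x. F x i) \<in> poly_functions" "\<And>x. x \<in> S \<Longrightarrow> F x \<in> zcl S'"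
  shows "F y \<in> zcl S'"
  using zcl_image[of y S F, OF assms(1,2)] zcl_least[of "F ` S" S'] assms(3) by blast

lemma closure_of_zariski:
  assumes "S \<subseteq> affine_space I"
  shows "zariski I closure_of S = affine_space I \<inter> zcl S"
proof -
  have "x \<in> zariski I closure_of S \<longleftrightarrow> x \<in> affine_space I \<inter> zcl S" for x
  proof
    assume x: "x \<in> zariski I closure_of S"
    then have xI: "x \<in> affine_space I"
      by (auto simp: closure_of_def topspace_zariski)
    have "x \<in> zcl S"
    proof (rule zclI, rule ccontr)
      fix P assume P: "P \<in> poly_functions" "\<And>x. x \<in> S \<Longrightarrow> P x = 0" "P x \<noteq> 0"
      have "openin (zariski I) (affine_space I - zero_locus I {P})"
        using P(1) by (auto simp: openin_zariski zariski_open_def)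
      moreover have "x \<in> affine_space I - zero_locus I {P}"
        using P(3) xI by (auto simp: zero_locus_def)
      ultimately obtain y where "y \<in> S" "y \<in> affine_space I - zero_locus I {P}"
        using x by (auto simp: closure_of_def)
      then show False using P(2) by (auto simp: zero_locus_def)
    qed
    with xI show "x \<in> affine_space I \<inter> zcl S" by simp
  next
    assume x: "x \<in> affine_space I \<inter> zcl S"
    have "\<exists>y\<in>S. y \<in> T" if T: "x \<in> T" "openin (zariski I) T" for T
    proof (rule ccontr)
      assume no: "\<not> ?thesis"
      obtain R where R: "R \<subseteq> poly_functions" "T = affine_space I - zero_locus I R"
        using T(2) by (auto simp: openin_zariski zariski_open_def)
      obtain P where P: "P \<in> R" "P x \<noteq> 0"
        using T(1) R(2) by (auto simp: zero_locus_def)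
      have "P y = 0" if "y \<in> S" for y
        using no that P(1) R(2) assms by (auto simp: zero_locus_def)
      then show False
        using zclD[of x S P] x P R(1) by auto
    qed
    then show "x \<in> zariski I closure_of S"
      using x by (auto simp: closure_of_def topspace_zariski)
  qed
  then show ?thesis by blast
qed

text \<open>Expanding \<open>P\<close> around the base point into homogeneous parts, the lowest nonzero part would
  have to vanish on all tangent vectors.\<close>

lemma affine_space_subset_zcl_if_tangent:
  assumes S: "S \<subseteq> affine_space K"
    and tangent: "\<And>z. z \<in> affine_space K \<Longrightarrow> \<exists>\<gamma>. (\<forall>t. \<gamma> t \<in> S) \<and> \<gamma> 0 = p \<and>
      (\<forall>k\<in>K. ((\<lambda>t. \<gamma> t k) has_field_derivative z k) (at 0))"
  shows "affine_space K \<subseteq> zcl S"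
proof (rule subsetI, rule zclI)
  fix y P assume y: "y \<in> affine_space K" and P: "P \<in> poly_functions" "\<And>x. x \<in> S \<Longrightarrow> P x = 0"
  obtain n c where c: "\<And>k. c k \<in> poly_functions"
    and exp: "\<And>t z. P (\<lambda>i. p i + t * z i) = (\<Sum>k\<le>n. c k z * t ^ k)"
    using poly_functions_homogeneous_expansion[OF P(1), of p] by metis
  have zero: "k \<le> n \<Longrightarrow> z \<in> affine_space K \<Longrightarrow> c k z = 0" for k z
  proof (induction k arbitrary: z rule: less_induct)
    case (less k)
    obtain \<gamma> where \<gamma>: "\<And>t. \<gamma> t \<in> S" "\<gamma> 0 = p"
      "\<And>k. k \<in> K \<Longrightarrow> ((\<lambda>t. \<gamma> t k) has_field_derivative z k) (at 0)"
      using tangent[OF less.prems(2)] by blast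
    define w where "w t i = (\<gamma> t i - p i) / t" for t i
    have pK: "p \<in> affine_space K" using \<gamma>(1)[of 0] \<gamma>(2) S by auto
    have wK: "w t \<in> affine_space K" for t
      using \<gamma>(1)[of t] S pK by (auto simp: w_def affine_space_def subset_iff)
    have lim: "((\<lambda>t. w t i) \<longlongrightarrow> z i) (at 0)" for i
    proof (cases "i \<in> K")
      case True
      show ?thesis using \<gamma>(3)[OF True] by (simp add: w_def has_field_derivative_iff \<gamma>(2))
    next
      case False
      then have "w t i = 0" "z i = 0" for t
        using wK less.prems(2) by (auto simp: affine_space_def)
      then show ?thesis by simp
    qed
    \<comment> \<open>The parts below \<open>k\<close> vanish by induction, so \<open>t ^ k\<close>
      splits off from \<open>P (\<gamma> t) = 0\<close>; the limit of the other factor is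
      \<open>c k z\<close>.\<close>
    let ?g = "\<lambda>t. \<Sum>j\<in>{k..n}. c j (w t) * t ^ (j - k)"
    have "((\<lambda>t. ?g t) \<longlongrightarrow> (\<Sum>j\<in>{k..n}. c j z * 0 ^ (j - k))) (at 0)"
      by (intro tendsto_intros poly_functions_tendsto[OF c] lim)
    moreover have "(\<Sum>j\<in>{k..n}. c j z * 0 ^ (j - k)) = (\<Sum>j\<in>{k}. c j z * 0 ^ (j - k))"
      using less.prems(1) by (intro sum.mono_neutral_right) auto
    moreover have "\<forall>\<^sub>F t in at 0. ?g t = 0"
    proof (rule eventually_at_filter[THEN iffD2], rule always_eventually, intro allI impI)
      fix t :: complex assume t: "t \<noteq> 0"
      have "\<gamma> t = (\<lambda>i. p i + t * w t i)"
        using t by (simp add: w_def)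
      then have "0 = (\<Sum>j\<le>n. c j (w t) * t ^ j)"
        using P(2)[OF \<gamma>(1), of t] exp[of t "w t"] by simp
      also have "\<dots> = (\<Sum>j\<in>{k..n}. c j (w t) * t ^ j)"
        using less.IH[OF _ _ wK] less.prems(1) by (intro sum.mono_neutral_right) auto
      also have "\<dots> = t ^ k * ?g t"
        by (auto simp: sum_distrib_left power_add[symmetric] mult_ac intro!: sum.cong)
      finally show "?g t = 0" using t by simp
    qed
    then have "((\<lambda>t. ?g t) \<longlongrightarrow> 0) (at 0)"
      by (rule tendsto_eventually)
    ultimately show "c k z = 0"
      by (auto dest: tendsto_unique[rotated])
  qed
  have pK: "p \<in> affine_space K"
    using tangent[OF y] S by blast
  have "P y = P (\<lambda>i. p i + 1 * (y i - p i))" by simp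
  also have "\<dots> = (\<Sum>k\<le>n. c k (\<lambda>i. y i - p i) * 1 ^ k)" by (rule exp)
  also have "\<dots> = 0"
    using zero[of _ "\<lambda>i. y i - p i"] y pK by (auto simp: affine_space_def)
  finally show "P y = 0" .
qed

section \<open>Algebraic dependence and dimension\<close>

definition deg_le :: "nat \<Rightarrow> (('i \<Rightarrow> complex) \<Rightarrow> complex) \<Rightarrow> bool" where
  "deg_le n f \<longleftrightarrow> (\<forall>x i. \<exists>p :: complex poly. degree p \<le> n \<and> (\<forall>t. f (x(i := t)) = poly p t))"

lemma deg_leI:
  "(\<And>x i. \<exists>p :: complex poly. degree p \<le> n \<and> (\<forall>t. f (x(i := t)) = poly p t)) \<Longrightarrow> deg_le n f"
  by (simp add: deg_le_def)

lemma deg_leE: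
  assumes "deg_le n f"
  obtains p :: "complex poly" where "degree p \<le> n" "\<And>t. f (x(i := t)) = poly p t"
  using assms unfolding deg_le_def by blast

lemma deg_le_mono: "deg_le n f \<Longrightarrow> n \<le> m \<Longrightarrow> deg_le m f"
  unfolding deg_le_def by (meson order_trans)

lemma deg_le_const: "deg_le n (\<lambda>x. c)"
  by (rule deg_leI, rule exI[of _ "[:c:]"]) simp

lemma deg_le_coord: "deg_le 1 (\<lambda>x. x k)"
proof (rule deg_leI)
  fix x :: "'a \<Rightarrow> complex" and i
  show "\<exists>p :: complex poly. degree p \<le> 1 \<and> (\<forall>t. (x(i := t)) k = poly p t)"
    by (rule exI[of _ "if i = k then [:0, 1:] else [:x k:]"]) simp
qed

lemma deg_le_add:
  assumes "deg_le n f" "deg_le n g"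
  shows "deg_le n (\<lambda>x. f x + g x)"
proof (rule deg_leI)
  fix x i
  obtain p where "degree p \<le> n" "\<And>t. f (x(i := t)) = poly p t" using deg_leE[OF assms(1)] by metis
  moreover obtain q where "degree q \<le> n" "\<And>t. g (x(i := t)) = poly q t"
    using deg_leE[OF assms(2)] by metis
  ultimately show "\<exists>p :: complex poly. degree p \<le> n \<and> (\<forall>t. f (x(i := t)) + g (x(i := t)) = poly p t)"
    by (intro exI[of _ "p + q"]) (auto intro: degree_add_le)
qed

lemma deg_le_mult:
  assumes "deg_le n f" "deg_le m g"
  shows "deg_le (n + m) (\<lambda>x. f x * g x)"
proof (rule deg_leI)
  fix x i
  obtain p where "degree p \<le> n" "\<And>t. f (x(i := t)) = poly p t" using deg_leE[OF assms(1)] by metis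
  moreover obtain q where "degree q \<le> m" "\<And>t. g (x(i := t)) = poly q t"
    using deg_leE[OF assms(2)] by metis
  ultimately show "\<exists>p :: complex poly. degree p \<le> n + m \<and> (\<forall>t. f (x(i := t)) * g (x(i := t)) = poly p t)"
    by (intro exI[of _ "p * q"]) (auto intro: degree_mult_le[THEN order_trans])
qed

lemma deg_le_prod:
  "finite A \<Longrightarrow> (\<And>a. a \<in> A \<Longrightarrow> deg_le n (f a)) \<Longrightarrow> deg_le (card A * n) (\<lambda>x. \<Prod>a\<in>A. f a x)"
proof (induction A rule: finite_induct)
  case empty
  then show ?case by (simp add: deg_le_const)
next
  case (insert a A)
  then show ?case using deg_le_mult[of n "f a" "card A * n" "\<lambda>x. \<Prod>a\<in>A. f a x"] by simp
qed

lemma deg_le_sum: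
  "(\<And>a. a \<in> A \<Longrightarrow> deg_le n (f a)) \<Longrightarrow> deg_le n (\<lambda>x. \<Sum>a\<in>A. f a x)"
  by (induction A rule: infinite_finite_induct) (auto intro: deg_le_add deg_le_const)

lemma poly_on_deg_le: "f \<in> poly_on J \<Longrightarrow> \<exists>n. deg_le n f"
proof (induction rule: poly_on.induct)
  case (add p q)
  then obtain n m where "deg_le n p" "deg_le m q" by blast
  then show ?case
    using deg_le_add[of "max n m" p q] deg_le_mono[of _ _ "max n m"] by fastforce
qed (blast intro: deg_le_const deg_le_coord deg_le_mult)+

text \<open>The coordinates leave the grid one at a time: in each of them \<open>f\<close> has
  degree at most \<open>n\<close> and \<open>n + 1\<close> zeros.\<close>

lemma poly_on_zero_if_zero_on_grid:
  assumes K: "finite K" and f: "f \<in> poly_on K" "deg_le n f"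
    and grid: "\<And>g. g \<in> PiE K (\<lambda>_. {..n}) \<Longrightarrow> f (\<lambda>k. of_nat (g k)) = 0"
  shows "f x = 0"
proof -
  \<comment> \<open>\<open>L\<close> holds the coordinates that are already arbitrary; the others
    are still on the grid.\<close>
  have "finite L \<Longrightarrow> L \<subseteq> K \<Longrightarrow> (\<And>k. k \<in> K - L \<Longrightarrow> x k \<in> of_nat ` {..n}) \<Longrightarrow> f x = 0" for L
  proof (induction L arbitrary: x rule: finite_induct)
    case empty
    define g where "g = (\<lambda>k\<in>K. SOME a. a \<le> n \<and> x k = of_nat a)"
    have g: "g k \<le> n \<and> x k = of_nat (g k)" if "k \<in> K" for k
    proof -
      have "\<exists>a. a \<le> n \<and> x k = of_nat a" using empty(2)[of k] that by auto
      from someI_ex[OF this] show ?thesis using that by (simp add: g_def)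
    qed
    have "g \<in> PiE K (\<lambda>_. {..n})" using g by (auto simp: g_def)
    from grid[OF this] show ?case
      using poly_on_cong[OF f(1), of x "\<lambda>k. of_nat (g k)"] g by auto
  next
    case (insert i L)
    obtain p where p: "degree p \<le> n" "\<And>t. f (x(i := t)) = poly p t"
      using deg_leE[OF f(2)] by metis
    have "poly p t = 0" if "t \<in> of_nat ` {..n}" for t
    proof -
      have "f (x(i := t)) = 0"
        using insert.prems that insert.hyps by (intro insert.IH) auto
      then show ?thesis by (simp add: p(2))
    qed
    then have sub: "of_nat ` {..n} \<subseteq> {t. poly p t = 0}" by auto
    have "p = 0"
    proof (rule ccontr)
      assume "p \<noteq> 0"
      then have "card (of_nat ` {..n} :: complex set) \<le> degree p"
        using card_mono[OF poly_roots_finite sub] card_poly_roots_bound[of p] by linarith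
      moreover have "card (of_nat ` {..n} :: complex set) = Suc n"
        by (subst card_image) (auto simp: inj_on_def)
      ultimately show False using p(1) by simp
    qed
    then have "f (x(i := x i)) = 0" by (simp only: p(2)) simp
    then show ?case by simp
  qed
  from this[of K] show ?thesis using K by auto
qed

lemma underdetermined_system:
  fixes w :: "'a \<Rightarrow> 'b \<Rightarrow> complex"
  shows "finite B \<Longrightarrow> finite A \<Longrightarrow> card B < card A \<Longrightarrow>
    \<exists>c. (\<exists>a\<in>A. c a \<noteq> 0) \<and> (\<forall>b\<in>B. (\<Sum>a\<in>A. c a * w a b) = 0)"
proof (induction B arbitrary: A w rule: finite_induct)
  case empty
  then obtain a where "a \<in> A" by fastforce
  then show ?case by (intro exI[of _ "\<lambda>_. 1"]) auto
next
  case (insert b B)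
  show ?case
  proof (cases "\<forall>a\<in>A. w a b = 0")
    case True
    obtain c where "\<exists>a\<in>A. c a \<noteq> 0" "\<forall>b\<in>B. (\<Sum>a\<in>A. c a * w a b) = 0"
      using insert.IH[of A w] insert.prems insert.hyps by auto
    then show ?thesis using True by (intro exI[of _ c]) auto
  next
    case False
    then obtain a0 where a0: "a0 \<in> A" "w a0 b \<noteq> 0" by blast
    define A' where "A' = A - {a0}"
    have A': "finite A'" "card B < card A'" "a0 \<notin> A'" "A = insert a0 A'"
      using insert.prems insert.hyps a0(1) by (auto simp: A'_def)
    \<comment> \<open>Equation \<open>b\<close> is solved for the unknown \<open>a0\<close> and
      substituted into the others.\<close>
    define w' where "w' a b' = w a b' - w a b / w a0 b * w a0 b'" for a b'
    obtain c where c: "\<exists>a\<in>A'. c a \<noteq> 0" "\<And>b'. b' \<in> B \<Longrightarrow> (\<Sum>a\<in>A'. c a * w' a b') = 0"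
      using insert.IH[OF A'(1,2), of w'] by blast
    define d where "d = (\<Sum>a\<in>A'. c a * w a b) / w a0 b"
    define c' where "c' = c(a0 := - d)"
    have c': "(\<Sum>a\<in>A. c' a * w a b') = (\<Sum>a\<in>A'. c a * w a b') - d * w a0 b'" for b'
    proof -
      have "(\<Sum>a\<in>A'. c' a * w a b') = (\<Sum>a\<in>A'. c a * w a b')"
        using A'(3) by (intro sum.cong) (auto simp: c'_def)
      then show ?thesis
        unfolding A'(4) using A'(1,3) by (simp add: c'_def)
    qed
    have "(\<Sum>a\<in>A. c' a * w a b') = 0" if "b' \<in> insert b B" for b'
    proof (cases "b' = b")
      case True
      then show ?thesis using a0(2) by (simp add: c' d_def)
    next
      case False
      then have "(\<Sum>a\<in>A'. c a * w' a b') = 0" using that c(2) by blast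
      then have "(\<Sum>a\<in>A'. c a * w a b') - (\<Sum>a\<in>A'. c a * w a b) * (w a0 b' / w a0 b) = 0"
        by (simp add: w'_def algebra_simps sum_subtractf sum_distrib_left sum_distrib_right)
      then show ?thesis by (simp add: c' d_def)
    qed
    moreover have "\<exists>a\<in>A. c' a \<noteq> 0"
      using c(1) A'(3,4) by (auto simp: c'_def)
    ultimately show ?thesis by blast
  qed
qed

text \<open>Counting: for large \<open>N\<close> the span of the \<open>N ^ d\<close> Lagrange polynomials of the grid
  \<open>{..<N} ^ d\<close> is larger than the number of grid points that detect the zero polynomial in the
  fewer coordinates \<open>K\<close>. With Lagrange polynomials instead of monomials the combination is
  visibly nonzero.\<close>

lemma algebraic_dependence:
  fixes g :: "nat \<Rightarrow> ('i \<Rightarrow> complex) \<Rightarrow> complex"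
  assumes K: "finite K" "card K < d" and g: "\<And>j. j < d \<Longrightarrow> g j \<in> poly_on K"
  obtains Q y where "Q \<in> poly_functions" "y \<in> affine_space {..<d}" "Q y \<noteq> 0"
    "\<And>x. Q (\<lambda>j. if j < d then g j x else 0) = 0"
proof -
  have "\<exists>n. \<forall>j<d. deg_le n (g j)"
  proof -
    have "\<forall>j<d. \<exists>n. deg_le n (g j)" using poly_on_deg_le g by blast
    then obtain n where n: "\<forall>j<d. deg_le (n j) (g j)" by metis
    have "deg_le (Max (n ` {..<d})) (g j)" if "j < d" for j
      by (rule deg_le_mono[of "n j"]) (use n that in auto)
    then show ?thesis by blast
  qed
  then obtain n where n: "\<And>j. j < d \<Longrightarrow> deg_le n (g j)" by blast
  \<comment> \<open>The constants are made for (M + 1)^|K| \<le> (C N)^|K| = C^|K| N^|K| < N^(|K| +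
    1) \<le> N^d, where \<open>M\<close> bounds the degree of a Lagrange polynomial after
    substitution of the \<open>g j\<close>.\<close>
  define C where "C = d * n + 1"
  define N where "N = C ^ card K + 1"
  define M where "M = d * (N * n)"
  define L :: "(nat \<Rightarrow> nat) \<Rightarrow> (nat \<Rightarrow> complex) \<Rightarrow> complex"
    where "L \<beta> y = (\<Prod>j<d. \<Prod>b\<in>{..<N} - {\<beta> j}. (y j - of_nat b))" for \<beta> y
  define A where "A = PiE {..<d} (\<lambda>_. {..<N})"
  define B where "B = PiE K (\<lambda>_. {..M})"
  have fin: "finite A" "finite B"
    using K by (auto simp: A_def B_def intro!: finite_PiE)
  have "M + 1 \<le> C * N"
    by (simp add: M_def C_def N_def algebra_simps)
  then have "card B \<le> (C * N) ^ card K"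
    using K(1) by (simp add: B_def card_PiE power_mono)
  also have "\<dots> = C ^ card K * N ^ card K"
    by (rule power_mult_distrib)
  also have "\<dots> < N * N ^ card K"
    by (intro mult_strict_right_mono) (simp_all add: N_def)
  also have "\<dots> \<le> N ^ d"
    using K(2) power_increasing[of "Suc (card K)" d N] by (simp add: N_def)
  also have "\<dots> = card A"
    by (simp add: A_def card_PiE)
  finally have "card B < card A" .
  from underdetermined_system[OF fin(2,1) this,
      of "\<lambda>\<beta> h. L \<beta> (\<lambda>j. if j < d then g j (\<lambda>k. of_nat (h k)) else 0)"]
  obtain c \<alpha> where \<alpha>: "\<alpha> \<in> A" "c \<alpha> \<noteq> 0"
    and c: "\<And>h. h \<in> B \<Longrightarrow>
      (\<Sum>\<beta>\<in>A. c \<beta> * L \<beta> (\<lambda>j. if j < d then g j (\<lambda>k. of_nat (h k)) else 0)) = 0"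
    by blast
  define Q where "Q y = (\<Sum>\<beta>\<in>A. c \<beta> * L \<beta> y)" for y
  have Lg: "L \<beta> (\<lambda>j. if j < d then g j x else 0) = (\<Prod>j<d. \<Prod>b\<in>{..<N} - {\<beta> j}. (g j x - of_nat b))"
    for \<beta> x
    by (simp add: L_def)
  have L_poly: "L \<beta> \<in> poly_functions" for \<beta>
    unfolding L_def poly_functions_eq
    by (intro poly_on_prod poly_on_diff poly_on.const poly_on.coord) simp
  have "deg_le M (\<lambda>x. L \<beta> (\<lambda>j. if j < d then g j x else 0))" for \<beta>
  proof -
    have "deg_le (N * n) (\<lambda>x. \<Prod>b\<in>{..<N} - {\<beta> j}. (g j x - of_nat b))" if "j < d" for j
    proof (rule deg_le_mono)
      show "deg_le (card ({..<N} - {\<beta> j}) * n) (\<lambda>x. \<Prod>b\<in>{..<N} - {\<beta> j}. (g j x - of_nat b))"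
        using deg_le_add[OF n[OF that] deg_le_const[of n "- of_nat b" for b]]
        by (intro deg_le_prod) auto
      show "card ({..<N} - {\<beta> j}) * n \<le> N * n"
        using card_mono[of "{..<N}" "{..<N} - {\<beta> j}"] by (intro mult_le_mono1) auto
    qed
    then have "deg_le (card {..<d} * (N * n)) (\<lambda>x. \<Prod>j<d. \<Prod>b\<in>{..<N} - {\<beta> j}. (g j x - of_nat b))"
      by (intro deg_le_prod) auto
    then show ?thesis by (simp add: Lg M_def)
  qed
  from deg_le_mult[OF deg_le_const[of 0] this]
  have deg: "deg_le M (\<lambda>x. Q (\<lambda>j. if j < d then g j x else 0))"
    unfolding Q_def by (intro deg_le_sum) simp
  have Qpoly: "(\<lambda>x. Q (\<lambda>j. if j < d then g j x else 0)) \<in> poly_on K"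
    unfolding Q_def Lg
    by (intro poly_on_sum poly_on.mult poly_on_prod poly_on_diff poly_on.const g) auto
  have "Q (\<lambda>j. if j < d then g j x else 0) = 0" for x
    using poly_on_zero_if_zero_on_grid[OF K(1) Qpoly deg] c by (simp add: Q_def B_def)
  moreover have "Q \<in> poly_functions"
    using L_poly unfolding Q_def poly_functions_eq
    by (intro poly_on_sum poly_on.mult poly_on.const) auto
  \<comment> \<open>At the grid point \<alpha> every Lagrange polynomial but its own vanishes, so
    \<open>Q y\<close> is a nonzero multiple of \<open>c \<alpha>\<close>.\<close>
  moreover define y where "y j = (if j < d then of_nat (\<alpha> j) else 0 :: complex)" for j
  have L0: "L \<beta> y = 0" if "\<beta> \<in> A" "\<beta> \<noteq> \<alpha>" for \<beta>
  proof -
    have "\<exists>j<d. \<beta> j \<noteq> \<alpha> j"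
    proof (rule ccontr)
      assume "\<not> ?thesis"
      then have "\<beta> = \<alpha>"
        by (intro PiE_ext[OF that(1)[unfolded A_def] \<alpha>(1)[unfolded A_def]]) auto
      with that(2) show False ..
    qed
    then obtain j where j: "j < d" "\<beta> j \<noteq> \<alpha> j" by blast
    then have "\<alpha> j \<in> {..<N} - {\<beta> j}" using \<alpha>(1) by (auto simp: A_def)
    then have "(\<Prod>b\<in>{..<N} - {\<beta> j}. (y j - of_nat b)) = 0"
      using j(1) by (intro prod_zero) (auto simp: y_def)
    then show ?thesis using j(1) unfolding L_def by (intro prod_zero) auto
  qed
  have L1: "L \<alpha> y \<noteq> 0"
    by (auto simp: L_def y_def)
  have "Q y = (\<Sum>\<beta>\<in>{\<alpha>}. c \<beta> * L \<beta> y)"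
    unfolding Q_def using fin(1) \<alpha>(1) L0 by (intro sum.mono_neutral_right) auto
  then have "Q y \<noteq> 0" using L1 \<alpha>(2) by simp
  moreover have "y \<in> affine_space {..<d}"
    by (auto simp: y_def affine_space_def)
  ultimately show ?thesis using that by blast
qed

text \<open>The coordinates in \<open>K\<close> are independent on \<open>X\<close>. Conversely,
  more than \<open>card K\<close> functions pulled back along \<psi> are dependent by
  \<open>algebraic_dependence\<close>, and the relation extends to the closure of the image.\<close>

lemma variety_dim_eq_card:
  fixes X :: "('i \<Rightarrow> complex) set" and \<psi> :: "('k \<Rightarrow> complex) \<Rightarrow> 'i \<Rightarrow> complex"
  assumes K: "finite K" and lower: "\<And>Q. Q \<in> poly_on K \<Longrightarrow> (\<And>x. x \<in> X \<Longrightarrow> Q x = 0) \<Longrightarrow> (\<And>x. Q x = 0)"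
    and K': "finite K'" "card K' = card K"
    and upper: "X \<subseteq> zcl (range \<psi>)" "\<And>i. (\<lambda>x. \<psi> x i) \<in> poly_on K'"
  shows "variety_dim X = card K"
  unfolding variety_dim_def
proof (rule cSup_eq_maximum)
  obtain e where e: "bij_betw e {..<card K} K"
    using ex_bij_betw_nat_finite[OF K] by (auto simp: atLeast0LessThan)
  have "alg_independent_on X (card K) (\<lambda>j x. x (e j))"
    unfolding alg_independent_on_def
  proof (intro ballI impI)
    fix Q :: "(nat \<Rightarrow> complex) \<Rightarrow> complex" and y
    assume Q: "Q \<in> poly_functions" "\<forall>x\<in>X. Q (\<lambda>j. if j < card K then x (e j) else 0) = 0"
      and y: "y \<in> affine_space {..<card K}"
    have "(\<lambda>x. Q (\<lambda>j. if j < card K then x (e j) else 0)) \<in> poly_on K"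
    proof (rule poly_functions_subst[of Q "\<lambda>x j. if j < card K then x (e j) else 0", OF Q(1)])
      fix j
      show "(\<lambda>x. if j < card K then x (e j) else 0) \<in> poly_on K"
        using e by (cases "j < card K") (auto intro!: poly_on.intros dest: bij_betwE)
    qed
    from lower[OF this] Q(2) have zero: "Q (\<lambda>j. if j < card K then x (e j) else 0) = 0" for x
      by blast
    have "(\<lambda>j. if j < card K then (y \<circ> inv_into {..<card K} e) (e j) else 0) = y"
      using y e by (auto simp: fun_eq_iff affine_space_def bij_betw_def)
    then show "Q y = 0" using zero[of "y \<circ> inv_into {..<card K} e"] by simp
  qed
  then show "card K \<in> {d. \<exists>f. (\<forall>j<d. f j \<in> poly_functions) \<and> alg_independent_on X d f}"
    by (auto intro!: exI[of _ "\<lambda>j x. x (e j)"] poly_functions.coord)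
next
  fix d assume "d \<in> {d. \<exists>f. (\<forall>j<d. f j \<in> poly_functions) \<and> alg_independent_on X d f}"
  then obtain f where f: "\<And>j. j < d \<Longrightarrow> f j \<in> poly_functions" "alg_independent_on X d f"
    by blast
  show "d \<le> card K"
  proof (rule ccontr)
    assume "\<not> d \<le> card K"
    then have d: "card K' < d" using K'(2) by simp
    have "(\<lambda>x. f j (\<psi> x)) \<in> poly_on K'" if "j < d" for j
      by (rule poly_functions_subst[of "f j" \<psi>, OF f(1)[OF that]]) (rule upper(2))
    from algebraic_dependence[OF K'(1) d, of "\<lambda>j x. f j (\<psi> x)", OF this]
    obtain Q y where Q: "Q \<in> poly_functions" "y \<in> affine_space {..<d}" "Q y \<noteq> 0"
      and zero: "\<And>x. Q (\<lambda>j. if j < d then f j (\<psi> x) else 0) = 0" by metis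
    have "(\<lambda>x. Q (\<lambda>j. if j < d then f j x else 0)) \<in> poly_functions"
      unfolding poly_functions_eq
    proof (rule poly_functions_subst[of Q "\<lambda>x j. if j < d then f j x else 0", OF Q(1)])
      fix j show "(\<lambda>x. if j < d then f j x else 0) \<in> poly_on UNIV"
        using f(1)[of j] by (cases "j < d") (auto simp: poly_functions_eq intro: poly_on.const)
    qed
    from zclD[OF _ this] zero upper(1)
    have "Q (\<lambda>j. if j < d then f j x else 0) = 0" if "x \<in> X" for x
      using that by blast
    then show False
      using f(2) Q unfolding alg_independent_on_def by blast
  qed
qed

section \<open>Extending points coordinate by coordinate\<close>

lemma poly_on_insert_expansion:
  "P \<in> poly_on (insert j J) \<Longrightarrow>
    \<exists>n c. (\<forall>k. c k \<in> poly_on J) \<and> (\<forall>x. P x = (\<Sum>k<n. c k x * x j ^ k))"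
proof (induction rule: poly_on.induct)
  case (const a)
  show ?case
    by (intro exI[of _ "Suc 0"] exI[of _ "\<lambda>k x. a"] conjI allI) (simp_all add: poly_on.const)
next
  case (coord i)
  show ?case
  proof (cases "i = j")
    case True
    let ?c = "\<lambda>(k :: nat) (x :: 'a \<Rightarrow> complex). if k = 0 then 0 else 1 :: complex"
    have "?c k \<in> poly_on J" for k by (cases "k = 0") (simp_all add: poly_on.const)
    moreover have "x i = (\<Sum>k<2. ?c k x * x j ^ k)" for x
      using True by (simp add: numeral_2_eq_2)
    ultimately show ?thesis by (intro exI[of _ 2] exI[of _ ?c] conjI allI)
  next
    case False
    then have "i \<in> J" using coord by simp
    then show ?thesis
      by (intro exI[of _ "Suc 0"] exI[of _ "\<lambda>k x. x i"] conjI allI) (simp_all add: poly_on.coord)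
  qed
next
  case (add p q)
  from add.IH(1) obtain n c where c: "\<forall>k. c k \<in> poly_on J"
    "\<forall>x. p x = (\<Sum>k<n. c k x * x j ^ k)"
    by (elim exE conjE)
  from add.IH(2) obtain m d where d: "\<forall>k. d k \<in> poly_on J"
    "\<forall>x. q x = (\<Sum>k<m. d k x * x j ^ k)"
    by (elim exE conjE)
  let ?c = "\<lambda>k x. (if k < n then c k x else 0) + (if k < m then d k x else 0)"
  have "?c k \<in> poly_on J" for k
    using c(1) d(1) by (intro poly_on_intros) auto
  moreover have "(\<Sum>k<n. c k x * x j ^ k) + (\<Sum>k<m. d k x * x j ^ k) = (\<Sum>k<n+m. ?c k x * x j ^ k)" for x
    unfolding distrib_right sum.distrib
    by (intro arg_cong2[of _ _ _ _ "(+)"] sum.mono_neutral_cong_left) auto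
  ultimately show ?case using c(2) d(2)
    by (intro exI[of _ "n+m"] exI[of _ ?c] conjI allI) simp_all
next
  case (mult p q)
  from mult.IH(1) obtain n c where c: "\<forall>k. c k \<in> poly_on J"
    "\<forall>x. p x = (\<Sum>k<n. c k x * x j ^ k)"
    by (elim exE conjE)
  from mult.IH(2) obtain m d where d: "\<forall>k. d k \<in> poly_on J"
    "\<forall>x. q x = (\<Sum>k<m. d k x * x j ^ k)"
    by (elim exE conjE)
  let ?c = "\<lambda>k x. if k < n then c k x else 0" and ?d = "\<lambda>k x. if k < m then d k x else 0"
  let ?e = "\<lambda>k x. \<Sum>i\<le>k. ?c i x * ?d (k - i) x"
  have "?e k \<in> poly_on J" for k
    using c(1) d(1) by (intro poly_on_intros) auto
  moreover have "(\<Sum>k<n. c k x * x j ^ k) * (\<Sum>k<m. d k x * x j ^ k) = (\<Sum>k<Suc (n+m). ?e k x * x j ^ k)" for x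
  proof -
    have "(\<Sum>k<n. c k x * x j ^ k) = (\<Sum>k\<le>n. ?c k x * x j ^ k)"
      "(\<Sum>k<m. d k x * x j ^ k) = (\<Sum>k\<le>m. ?d k x * x j ^ k)"
      by (intro sum.mono_neutral_cong_left; auto)+
    moreover have "(\<Sum>k\<le>n. ?c k x * x j ^ k) * (\<Sum>k\<le>m. ?d k x * x j ^ k) = (\<Sum>k\<le>n+m. ?e k x * x j ^ k)"
      by (rule polynomial_product) auto
    ultimately show ?thesis by (simp only: lessThan_Suc_atMost)
  qed
  ultimately show ?case using c(2) d(2)
    by (intro exI[of _ "Suc (n+m)"] exI[of _ ?e] conjI allI) simp_all
qed

text \<open>The leading coefficient \<open>b e\<close> is not invertible, so each reduction of the
  degree costs one factor \<open>b e\<close>; \<open>N\<close> counts these.\<close>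

lemma pseudo_division:
  assumes b: "\<And>k. b k \<in> poly_on J" and P: "P \<in> poly_on (insert j J)"
  shows "\<exists>N q r. q \<in> poly_on (insert j J) \<and> (\<forall>k. r k \<in> poly_on J) \<and>
    (\<forall>x. b e x ^ N * P x = q x * (\<Sum>k\<le>e. b k x * x j ^ k) + (\<Sum>k<e. r k x * x j ^ k))"
proof -
  have J: "f \<in> poly_on J \<Longrightarrow> f \<in> poly_on (insert j J)" for f
    using poly_on_mono[of f J "insert j J"] by auto
  have main: "(\<And>k. c k \<in> poly_on J) \<Longrightarrow> \<exists>N q r. q \<in> poly_on (insert j J) \<and> (\<forall>k. r k \<in> poly_on J) \<and>
    (\<forall>x. b e x ^ N * (\<Sum>k<n. c k x * x j ^ k) =
      q x * (\<Sum>k\<le>e. b k x * x j ^ k) + (\<Sum>k<e. r k x * x j ^ k))" for n and c :: "nat \<Rightarrow> _"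
  proof (induction n arbitrary: c)
    case 0
    show ?case
      by (intro exI[of _ 0] exI[of _ "\<lambda>x. 0"] exI[of _ "\<lambda>k x. 0"] conjI allI)
        (simp_all add: poly_on.const)
  next
    case (Suc n)
    show ?case
    proof (cases "n < e")
      case True
      let ?r = "\<lambda>k x. if k < Suc n then c k x else 0"
      have "?r k \<in> poly_on J" for k
        using Suc.prems by (intro poly_on_intros)
      moreover have "(\<Sum>k<Suc n. c k x * x j ^ k) = (\<Sum>k<e. ?r k x * x j ^ k)" for x
        using True by (intro sum.mono_neutral_cong_left) auto
      ultimately show ?thesis
        by (intro exI[of _ 0] exI[of _ "\<lambda>x. 0"] exI[of _ ?r] conjI allI)
          (simp_all only: power_0 mult_1 mult_zero_left add_0 poly_on.const)
    next
      case False
      \<comment> \<open>Coefficients of \<open>b e\<close> times the dividend minus the shifted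
        multiple of the divisor that cancels the term of degree \<open>n\<close>.\<close>
      let ?d = "\<lambda>k x. b e x * c k x - (if n - e \<le> k then c n x * b (k - (n - e)) x else 0)"
      have d: "?d k \<in> poly_on J" for k
        using Suc.prems b by (intro poly_on_intros)
      obtain N q r where IH: "q \<in> poly_on (insert j J)" "\<forall>k. r k \<in> poly_on J"
        "\<forall>x. b e x ^ N * (\<Sum>k<n. ?d k x * x j ^ k) =
          q x * (\<Sum>k\<le>e. b k x * x j ^ k) + (\<Sum>k<e. r k x * x j ^ k)"
        using Suc.IH[of ?d, OF d] by (elim exE conjE)
      let ?q = "\<lambda>x. q x + b e x ^ N * c n x * x j ^ (n - e)"
      have "?q \<in> poly_on (insert j J)"
        using IH(1) J b Suc.prems by (intro poly_on_intros poly_on.coord) auto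
      moreover have "b e x ^ Suc N * (\<Sum>k<Suc n. c k x * x j ^ k) =
        ?q x * (\<Sum>k\<le>e. b k x * x j ^ k) + (\<Sum>k<e. r k x * x j ^ k)" for x
      proof -
        have "c n x * x j ^ (n - e) * (\<Sum>k\<le>e. b k x * x j ^ k)
          = (\<Sum>k\<le>e. c n x * b k x * x j ^ (k + (n - e)))"
          by (simp add: sum_distrib_left power_add mult_ac)
        also have "\<dots> = (\<Sum>k\<in>{n-e..n}. c n x * b (k - (n - e)) x * x j ^ k)"
          using False
          by (intro sum.reindex_bij_witness[of _ "\<lambda>k. k - (n - e)" "\<lambda>k. k + (n - e)"]) auto
        also have "\<dots> = (\<Sum>k<Suc n. (if n - e \<le> k then c n x * b (k - (n - e)) x else 0) * x j ^ k)"
          by (intro sum.mono_neutral_cong_left) auto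
        finally have "b e x * (\<Sum>k<Suc n. c k x * x j ^ k)
            - c n x * x j ^ (n - e) * (\<Sum>k\<le>e. b k x * x j ^ k)
          = (\<Sum>k<Suc n. ?d k x * x j ^ k)"
          by (simp only: left_diff_distrib sum_subtractf sum_distrib_left mult.assoc)
        also have "\<dots> = (\<Sum>k<n. ?d k x * x j ^ k)"
          using False by simp
        finally have "b e x ^ N * (b e x * (\<Sum>k<Suc n. c k x * x j ^ k)
            - c n x * x j ^ (n - e) * (\<Sum>k\<le>e. b k x * x j ^ k)) =
          q x * (\<Sum>k\<le>e. b k x * x j ^ k) + (\<Sum>k<e. r k x * x j ^ k)"
          by (simp only: IH(3)[rule_format])
        then show ?thesis by (simp only: power_Suc2 algebra_simps)
      qed
      ultimately show ?thesis
        by (intro exI[of _ "Suc N"] exI[of _ ?q] exI[of _ r] conjI allI IH(2)[rule_format])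
    qed
  qed
  obtain n c where c: "\<forall>k. c k \<in> poly_on J" "\<forall>x. P x = (\<Sum>k<n. c k x * x j ^ k)"
    using poly_on_insert_expansion[OF P] by (elim exE conjE)
  obtain N q r where "q \<in> poly_on (insert j J)" "\<forall>k. r k \<in> poly_on J"
    "\<forall>x. b e x ^ N * (\<Sum>k<n. c k x * x j ^ k) =
      q x * (\<Sum>k\<le>e. b k x * x j ^ k) + (\<Sum>k<e. r k x * x j ^ k)"
    using main[of c n, OF c(1)[rule_format]] by (elim exE conjE)
  then show ?thesis
    by (intro exI[of _ N] exI[of _ q] exI[of _ r]) (simp only: c(2)[rule_format] simp_thms)
qed

section \<open>Adjoining coordinates to points of the closure of a projection\<close>

definition vanishes_on :: "('i \<Rightarrow> complex) set \<Rightarrow> (('i \<Rightarrow> complex) \<Rightarrow> complex) \<Rightarrow> bool" where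
  "vanishes_on \<Gamma> P \<longleftrightarrow> (\<forall>x\<in>\<Gamma>. P x = 0)"

text \<open>The points of the closure of the projection of \<open>\<Gamma>\<close> to the coordinates in \<open>J\<close>.\<close>

definition closure_point :: "('i \<Rightarrow> complex) set \<Rightarrow> 'i set \<Rightarrow> ('i \<Rightarrow> complex) \<Rightarrow> bool" where
  "closure_point \<Gamma> J y \<longleftrightarrow> (\<forall>P\<in>poly_on J. vanishes_on \<Gamma> P \<longrightarrow> P y = 0)"

definition irreducible_set :: "('i \<Rightarrow> complex) set \<Rightarrow> bool" where
  "irreducible_set \<Gamma> \<longleftrightarrow> (\<forall>P\<in>poly_functions. \<forall>Q\<in>poly_functions.
     vanishes_on \<Gamma> (\<lambda>x. P x * Q x) \<longrightarrow> vanishes_on \<Gamma> P \<or> vanishes_on \<Gamma> Q)"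

text \<open>Freezes the coordinates in \<open>J\<close> at \<open>y\<close>, leaving a univariate
  polynomial in the new coordinate to which roots and divisibility apply.\<close>

definition coeff_poly :: "nat \<Rightarrow> (nat \<Rightarrow> ('i \<Rightarrow> complex) \<Rightarrow> complex) \<Rightarrow> ('i \<Rightarrow> complex) \<Rightarrow> complex poly" where
  "coeff_poly n c y = (\<Sum>k<n. monom (c k y) k)"

lemma poly_coeff_poly: "poly (coeff_poly n c y) t = (\<Sum>k<n. c k y * t ^ k)"
  by (simp add: coeff_poly_def poly_sum poly_monom)

lemma coeff_coeff_poly: "coeff (coeff_poly n c y) i = (if i < n then c i y else 0)"
  by (simp add: coeff_poly_def coeff_sum)

lemma degree_coeff_poly_less: "n > 0 \<Longrightarrow> degree (coeff_poly n c y) < n"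
  by (rule degree_lessI) (auto simp: coeff_coeff_poly)

lemma degree_coeff_poly_Suc: "c n y \<noteq> 0 \<Longrightarrow> degree (coeff_poly (Suc n) c y) = n"
  using degree_coeff_poly_less[of "Suc n" c y] le_degree[of "coeff_poly (Suc n) c y" n]
  by (simp add: coeff_coeff_poly)

lemma poly_on_fun_upd: "P \<in> poly_on J \<Longrightarrow> j \<notin> J \<Longrightarrow> P (y(j := t)) = P y"
  by (rule poly_on_cong[of P J]) auto

text \<open>Top coefficients that vanish on \<Gamma> are dropped until a genuine leading coefficient
  appears.\<close>

lemma exists_leading_coeff:
  assumes c: "\<And>k. c k \<in> poly_on J" and van: "vanishes_on \<Gamma> (\<lambda>x. \<Sum>k<n. c k x * x j ^ k)"
    and k: "k < n" "\<not> vanishes_on \<Gamma> (c k)"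
  shows "\<exists>e<n. \<exists>b. (\<forall>k. b k \<in> poly_on J) \<and> vanishes_on \<Gamma> (\<lambda>x. \<Sum>k\<le>e. b k x * x j ^ k)
    \<and> \<not> vanishes_on \<Gamma> (b e)"
proof -
  define e where "e = Max {k. k < n \<and> \<not> vanishes_on \<Gamma> (c k)}"
  have fin: "finite {k. k < n \<and> \<not> vanishes_on \<Gamma> (c k)}" by simp
  have "e \<in> {k. k < n \<and> \<not> vanishes_on \<Gamma> (c k)}"
    unfolding e_def by (rule Max_in[OF fin]) (use k in auto)
  then have e: "e < n" "\<not> vanishes_on \<Gamma> (c e)" by auto
  have above: "vanishes_on \<Gamma> (c k)" if "e < k" "k < n" for k
  proof (rule ccontr)
    assume "\<not> vanishes_on \<Gamma> (c k)"
    then have "k \<le> e" unfolding e_def using that(2) by (intro Max_ge[OF fin]) auto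
    with that(1) show False by simp
  qed
  have "(\<Sum>k\<le>e. c k x * x j ^ k) = 0" if "x \<in> \<Gamma>" for x
  proof -
    have "(\<Sum>k\<le>e. c k x * x j ^ k) = (\<Sum>k<n. c k x * x j ^ k)"
      using e above that by (intro sum.mono_neutral_left) (auto simp: vanishes_on_def)
    then show ?thesis using van that by (simp add: vanishes_on_def)
  qed
  then show ?thesis using e c by (auto simp: vanishes_on_def)
qed

text \<open>If the new coordinate is algebraic over \<open>J\<close>, take a relation of minimal degree \<open>e\<close>: it
  divides every other relation up to a power of its leading coefficient, and it divides no power
  of \<open>f\<close>, which leaves a root where \<open>f\<close> does not vanish. Otherwise the new value is
  unconstrained.\<close>

lemma closure_point_extend:
  assumes irr: "irreducible_set \<Gamma>" and j: "j \<notin> J"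
    and f: "f \<in> poly_on (insert j J)" "\<not> vanishes_on \<Gamma> f"
  shows "\<exists>h\<in>poly_on J. \<not> vanishes_on \<Gamma> h \<and> (\<forall>y. closure_point \<Gamma> J y \<and> h y \<noteq> 0 \<longrightarrow>
    (\<exists>t. closure_point \<Gamma> (insert j J) (y(j := t)) \<and> f (y(j := t)) \<noteq> 0))"
proof -
  \<comment> \<open>\<open>E e\<close>: on \<Gamma> the new coordinate satisfies a relation of
    degree \<open>e\<close> over \<open>J\<close> whose leading coefficient does not vanish
    identically there.\<close>
  define E where "E e \<longleftrightarrow> (\<exists>b. (\<forall>k. b k \<in> poly_on J) \<and>
    vanishes_on \<Gamma> (\<lambda>x. \<Sum>k\<le>e. b k x * x j ^ k) \<and> \<not> vanishes_on \<Gamma> (b e))" for e :: nat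
  have upd: "P (y(j := t)) = P y" if "P \<in> poly_on J" for P y t
    using poly_on_fun_upd[OF that j] .
  show ?thesis
  proof (cases "\<exists>e. E e")
    case False
    have coeffs: "vanishes_on \<Gamma> (c k)" if "\<And>k. c k \<in> poly_on J"
      "vanishes_on \<Gamma> (\<lambda>x. \<Sum>k<n. c k x * x j ^ k)" "k < n"
      for c :: "nat \<Rightarrow> _" and n k
      using exists_leading_coeff[where c = c and n = n and k = k, OF that] False unfolding E_def by blast
    obtain n c where c: "\<forall>k. c k \<in> poly_on J" "\<forall>x. f x = (\<Sum>k<n. c k x * x j ^ k)"
      using poly_on_insert_expansion[OF f(1)] by (elim exE conjE)
    have "\<exists>k<n. \<not> vanishes_on \<Gamma> (c k)"
    proof (rule ccontr)
      assume "\<not> ?thesis"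
      then have "vanishes_on \<Gamma> f" using c(2) by (auto simp: vanishes_on_def)
      with f(2) show False ..
    qed
    then obtain k where k: "k < n" "\<not> vanishes_on \<Gamma> (c k)" by blast
    have "\<exists>t. closure_point \<Gamma> (insert j J) (y(j := t)) \<and> f (y(j := t)) \<noteq> 0"
      if y: "closure_point \<Gamma> J y" "c k y \<noteq> 0" for y
    proof -
      have "coeff (coeff_poly n c y) k \<noteq> 0" using k y(2) by (simp add: coeff_coeff_poly)
      then have "coeff_poly n c y \<noteq> 0" by auto
      then obtain t where t: "poly (coeff_poly n c y) t \<noteq> 0" using poly_all_0_iff_0 by blast
      have "f (y(j := t)) \<noteq> 0"
        using t c by (simp add: poly_coeff_poly upd)
      moreover have "closure_point \<Gamma> (insert j J) (y(j := t))"
        unfolding closure_point_def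
      proof (intro ballI impI)
        fix P assume P: "P \<in> poly_on (insert j J)" "vanishes_on \<Gamma> P"
        obtain n c where c: "\<forall>k. c k \<in> poly_on J" "\<forall>x. P x = (\<Sum>k<n. c k x * x j ^ k)"
          using poly_on_insert_expansion[OF P(1)] by (elim exE conjE)
        have "vanishes_on \<Gamma> (c k)" if "k < n" for k
          by (rule coeffs[of c n]) (use c P(2) that in \<open>auto simp: vanishes_on_def\<close>)
        then have "c k y = 0" if "k < n" for k
          using y(1) c(1) that by (auto simp: closure_point_def)
        then show "P (y(j := t)) = 0"
          using c by (simp add: upd)
      qed
      ultimately show ?thesis by blast
    qed
    then show ?thesis using k(2) c(1) by blast
  next
    case True
    define e where "e = (LEAST e. E e)"
    have "E e" unfolding e_def using True by (rule LeastI_ex)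
    then obtain b where b: "\<And>k. b k \<in> poly_on J"
      and G: "vanishes_on \<Gamma> (\<lambda>x. \<Sum>k\<le>e. b k x * x j ^ k)" and be: "\<not> vanishes_on \<Gamma> (b e)"
      unfolding E_def by blast
    have rem: "vanishes_on \<Gamma> (r k)" if "\<And>k. r k \<in> poly_on J"
      "vanishes_on \<Gamma> (\<lambda>x. \<Sum>k<e. r k x * x j ^ k)" "k < e"
      for r :: "nat \<Rightarrow> _" and k
    proof (rule ccontr)
      assume "\<not> ?thesis"
      from exists_leading_coeff[where c = r and n = e and k = k, OF that this]
      obtain e' where "e' < e" "E e'" unfolding E_def by blast
      then show False using Least_le[of E e'] unfolding e_def by simp
    qed
    \<comment> \<open>The exponent \<open>e\<close> is the degree of the specialized relation
      \<open>A\<close>, since \<open>nullstellensatz_univariate\<close> tests divisibility of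
      \<open>F ^ degree A\<close>.\<close>
    have fe: "(\<lambda>x. f x ^ e) \<in> poly_on (insert j J)" by (rule poly_on_power[OF f(1)])
    obtain N q r where q: "q \<in> poly_on (insert j J)" and r: "\<forall>k. r k \<in> poly_on J"
      and div: "\<forall>x. b e x ^ N * f x ^ e = q x * (\<Sum>k\<le>e. b k x * x j ^ k) + (\<Sum>k<e. r k x * x j ^ k)"
      using pseudo_division[of b J "\<lambda>x. f x ^ e" j e, OF b fe] by (elim exE conjE)
    note r = r[rule_format] and div = div[rule_format]
    have pow: "\<not> vanishes_on \<Gamma> (\<lambda>x. P x ^ n)" if "P \<in> poly_on L" "\<not> vanishes_on \<Gamma> P" for P n L
      using that(2) by (auto simp: vanishes_on_def)
    have prod: "\<not> vanishes_on \<Gamma> (\<lambda>x. P x * Q x)"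
      if "P \<in> poly_functions" "Q \<in> poly_functions" "\<not> vanishes_on \<Gamma> P" "\<not> vanishes_on \<Gamma> Q" for P Q
      using irr that unfolding irreducible_set_def by blast
    have "\<not> vanishes_on \<Gamma> (\<lambda>x. b e x ^ N * f x ^ e)"
      by (intro prod pow[OF b be] pow[OF f] poly_on_poly_functions[OF fe]
          poly_on_poly_functions[OF poly_on_power[OF b]])
    then have "\<not> vanishes_on \<Gamma> (\<lambda>x. \<Sum>k<e. r k x * x j ^ k)"
      using G by (auto simp: vanishes_on_def div)
    moreover have "vanishes_on \<Gamma> (\<lambda>x. \<Sum>k<e. r k x * x j ^ k)"
      if "\<And>k. k < e \<Longrightarrow> vanishes_on \<Gamma> (r k)"
      using that by (auto simp: vanishes_on_def)
    ultimately obtain k where k: "k < e" "\<not> vanishes_on \<Gamma> (r k)" by blast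
    \<comment> \<open>Off the zeros of \<open>h\<close> the relation keeps its degree over
      \<open>y\<close> and the remainder of \<open>f ^ e\<close> stays nonzero, so the relation does
      not divide \<open>F ^ e\<close>.\<close>
    define h where "h x = b e x * r k x" for x
    have "\<not> vanishes_on \<Gamma> h" "h \<in> poly_on J"
      unfolding h_def using prod[of "b e" "r k"] be k(2) b r
      by (auto intro: poly_on_poly_functions poly_on.mult)
    moreover have "\<exists>t. closure_point \<Gamma> (insert j J) (y(j := t)) \<and> f (y(j := t)) \<noteq> 0"
      if y: "closure_point \<Gamma> J y" "h y \<noteq> 0" for y
    proof -
      have bey: "b e y \<noteq> 0" and rky: "r k y \<noteq> 0" using y(2) by (auto simp: h_def)
      obtain nf cf where cf: "\<forall>k. cf k \<in> poly_on J" "\<forall>x. f x = (\<Sum>k<nf. cf k x * x j ^ k)"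
        using poly_on_insert_expansion[OF f(1)] by (elim exE conjE)
      obtain nq cq where cq: "\<forall>k. cq k \<in> poly_on J" "\<forall>x. q x = (\<Sum>k<nq. cq k x * x j ^ k)"
        using poly_on_insert_expansion[OF q] by (elim exE conjE)
      define F where "F = coeff_poly nf cf y"
      define A where "A = coeff_poly (Suc e) b y"
      define R where "R = coeff_poly e r y"
      have F: "poly F t = f (y(j := t))" for t
        using cf by (simp add: F_def poly_coeff_poly upd)
      have A: "poly A t = (\<Sum>k\<le>e. b k (y(j := t)) * (y(j := t)) j ^ k)" for t
        by (simp add: A_def poly_coeff_poly upd b lessThan_Suc_atMost)
      have degA: "degree A = e" unfolding A_def by (rule degree_coeff_poly_Suc[of b e y, OF bey])
      have "smult (b e y ^ N) (F ^ e) = coeff_poly nq cq y * A + R"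
      proof (rule poly_ext)
        fix t
        show "poly (smult (b e y ^ N) (F ^ e)) t = poly (coeff_poly nq cq y * A + R) t"
          using div[of "y(j := t)"] cq
          by (simp add: F A R_def poly_coeff_poly upd b r)
      qed
      have "\<not> A dvd F ^ degree A"
      proof
        assume "A dvd F ^ degree A"
        then have "A dvd smult (b e y ^ N) (F ^ e)" by (simp add: degA dvd_smult)
        then have "A dvd R"
          using \<open>smult _ _ = _\<close> by (simp add: dvd_add_right_iff)
        moreover have "coeff R k \<noteq> 0"
          using rky k(1) by (simp add: R_def coeff_coeff_poly)
        then have "R \<noteq> 0" by auto
        moreover have "degree R < e"
          using k(1) unfolding R_def by (intro degree_coeff_poly_less) simp
        ultimately show False using dvd_imp_degree_le[of A R] degA by simp
      qed
      moreover have "A \<noteq> 0" using degA k(1) by auto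
      ultimately obtain t where t: "poly A t = 0" "poly F t \<noteq> 0"
        using nullstellensatz_univariate[of A F] by blast
      have "closure_point \<Gamma> (insert j J) (y(j := t))"
        unfolding closure_point_def
      proof (intro ballI impI)
        fix P assume P: "P \<in> poly_on (insert j J)" "vanishes_on \<Gamma> P"
        obtain N q r where "q \<in> poly_on (insert j J)" and r: "\<forall>k. r k \<in> poly_on J"
          and div: "\<forall>x. b e x ^ N * P x = q x * (\<Sum>k\<le>e. b k x * x j ^ k) + (\<Sum>k<e. r k x * x j ^ k)"
          using pseudo_division[of b J P j e, OF b P(1)] by (elim exE conjE)
        note r = r[rule_format] and div = div[rule_format]
        have "vanishes_on \<Gamma> (\<lambda>x. \<Sum>k<e. r k x * x j ^ k)"
          unfolding vanishes_on_def
        proof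
          fix x assume "x \<in> \<Gamma>"
          then show "(\<Sum>k<e. r k x * x j ^ k) = 0"
            using div[of x] G P(2) by (simp add: vanishes_on_def)
        qed
        then have "vanishes_on \<Gamma> (r k)" if "k < e" for k using rem[of r k] r that by blast
        then have "r k y = 0" if "k < e" for k
          using y(1) r that by (auto simp: closure_point_def)
        then have "b e (y(j := t)) ^ N * P (y(j := t)) = 0"
          unfolding div using t(1)[unfolded A] by (simp add: upd r)
        then show "P (y(j := t)) = 0" using bey by (simp add: upd b)
      qed
      then show ?thesis using t(2) F by auto
    qed
    ultimately show ?thesis by blast
  qed
qed

text \<open>The open condition produced for the coordinate adjoined last serves as \<open>f\<close>
  for those adjoined before it.\<close>

lemma closure_point_extend_finite:
  assumes irr: "irreducible_set \<Gamma>" and L: "finite L"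
  shows "L \<inter> J = {} \<Longrightarrow> f \<in> poly_on (J \<union> L) \<Longrightarrow> \<not> vanishes_on \<Gamma> f \<Longrightarrow>
    \<exists>h\<in>poly_on J. \<not> vanishes_on \<Gamma> h \<and> (\<forall>y. closure_point \<Gamma> J y \<and> h y \<noteq> 0 \<longrightarrow>
    (\<exists>y'. (\<forall>i. i \<notin> L \<longrightarrow> y' i = y i) \<and> closure_point \<Gamma> (J \<union> L) y' \<and> f y' \<noteq> 0))"
  using L
proof (induction L arbitrary: f rule: finite_induct)
  case empty
  then show ?case by (intro bexI[of _ f]) auto
next
  case (insert j L)
  have eq: "J \<union> insert j L = insert j (J \<union> L)" by simp
  obtain h1 where h1: "h1 \<in> poly_on (J \<union> L)" "\<not> vanishes_on \<Gamma> h1"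
    "\<And>y. closure_point \<Gamma> (J \<union> L) y \<Longrightarrow> h1 y \<noteq> 0 \<Longrightarrow>
      \<exists>t. closure_point \<Gamma> (insert j (J \<union> L)) (y(j := t)) \<and> f (y(j := t)) \<noteq> 0"
    using closure_point_extend[OF irr, of j "J \<union> L" f] insert.prems insert.hyps unfolding eq
    by auto
  obtain h where h: "h \<in> poly_on J" "\<not> vanishes_on \<Gamma> h"
    "\<And>y. closure_point \<Gamma> J y \<Longrightarrow> h y \<noteq> 0 \<Longrightarrow>
      \<exists>y'. (\<forall>i. i \<notin> L \<longrightarrow> y' i = y i) \<and> closure_point \<Gamma> (J \<union> L) y' \<and> h1 y' \<noteq> 0"
    using insert.IH[OF _ h1(1,2)] insert.prems by auto
  show ?case
  proof (intro bexI[of _ h] conjI allI impI)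
    fix y assume "closure_point \<Gamma> J y \<and> h y \<noteq> 0"
    then obtain y' where y': "\<forall>i. i \<notin> L \<longrightarrow> y' i = y i" "closure_point \<Gamma> (J \<union> L) y'" "h1 y' \<noteq> 0"
      using h(3) by blast
    then obtain t where "closure_point \<Gamma> (insert j (J \<union> L)) (y'(j := t))" "f (y'(j := t)) \<noteq> 0"
      using h1(3) by blast
    then show "\<exists>y'. (\<forall>i. i \<notin> insert j L \<longrightarrow> y' i = y i) \<and> closure_point \<Gamma> (J \<union> insert j L) y' \<and> f y' \<noteq> 0"
      using y'(1) unfolding eq by (intro exI[of _ "y'(j := t)"]) auto
  qed (use h in auto)
qed

lemma irreducible_set_range:
  fixes F :: "('a \<Rightarrow> complex) \<Rightarrow> 'b \<Rightarrow> complex"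
  assumes "\<And>i. (\<lambda>x. F x i) \<in> poly_functions"
  shows "irreducible_set (range F)"
  unfolding irreducible_set_def
proof (intro ballI impI)
  fix P Q :: "('b \<Rightarrow> complex) \<Rightarrow> complex"
  assume PQ: "P \<in> poly_functions" "Q \<in> poly_functions" "vanishes_on (range F) (\<lambda>x. P x * Q x)"
  have "(\<lambda>x. P (F x)) \<in> poly_functions" "(\<lambda>x. Q (F x)) \<in> poly_functions"
    using poly_functions_subst[of P F UNIV] poly_functions_subst[of Q F UNIV] PQ(1,2) assms
    by (simp_all add: poly_functions_eq)
  note * = poly_functions_mult_nonzero[OF this(1) _ this(2)]
  show "vanishes_on (range F) P \<or> vanishes_on (range F) Q"
  proof (rule ccontr)
    assume "\<not> ?thesis"
    then obtain x y where "P (F x) \<noteq> 0" "Q (F y) \<noteq> 0" by (auto simp: vanishes_on_def)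
    from *[OF this] PQ(3) show False by (auto simp: vanishes_on_def)
  qed
qed

text \<open>A form of Chevalley's theorem. On the graph of \<Phi>, a preimage of \<open>y\<close>
  consists of further coordinates to be adjoined to \<open>y\<close>; the equations of the graph are
  polynomial, so they survive at closure points.\<close>

lemma image_contains_open:
  fixes \<Phi> :: "('p \<Rightarrow> complex) \<Rightarrow> 'o \<Rightarrow> complex"
  assumes A: "finite A" and Phi: "\<And>i. (\<lambda>x. \<Phi> x i) \<in> poly_on A" "\<And>x. \<Phi> x \<in> affine_space B"
    and f: "f \<in> poly_on A" "f x0 \<noteq> 0"
  obtains h x1 where "h \<in> poly_functions" "h (\<Phi> x1) \<noteq> 0"
    "\<And>y. y \<in> zcl (range \<Phi>) \<Longrightarrow> y \<in> affine_space B \<Longrightarrow> h y \<noteq> 0 \<Longrightarrow>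
      \<exists>x\<in>affine_space A. f x \<noteq> 0 \<and> \<Phi> x = y"
proof -
  define F where "F x = case_sum (\<Phi> x) x" for x :: "'p \<Rightarrow> complex"
  define \<Gamma> where "\<Gamma> = range F"
  have F: "(\<lambda>x. F x i) \<in> poly_functions" for i
    by (cases i) (simp_all add: F_def poly_on_poly_functions[OF Phi(1)] poly_functions.coord)
  have irr: "irreducible_set \<Gamma>"
    unfolding \<Gamma>_def by (rule irreducible_set_range[OF F])
  define f' where "f' = (\<lambda>z. f (\<lambda>i. z (Inr i :: 'o + 'p)))"
  have "f' \<in> poly_on (Inl ` B \<union> Inr ` A)"
    unfolding f'_def by (rule poly_on_subst[OF f(1), of "\<lambda>z i. z (Inr i)"]) (auto intro: poly_on.coord)
  moreover have "\<not> vanishes_on \<Gamma> f'"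
    using f(2) by (auto simp: vanishes_on_def \<Gamma>_def f'_def F_def)
  moreover have "Inr ` A \<inter> Inl ` B = {}" by auto
  ultimately obtain h where h: "h \<in> poly_on (Inl ` B)" "\<not> vanishes_on \<Gamma> h"
    "\<And>y. closure_point \<Gamma> (Inl ` B) y \<Longrightarrow> h y \<noteq> 0 \<Longrightarrow>
      \<exists>y'. (\<forall>i. i \<notin> Inr ` A \<longrightarrow> y' i = y i) \<and> closure_point \<Gamma> (Inl ` B \<union> Inr ` A) y' \<and> f' y' \<noteq> 0"
    using closure_point_extend_finite[OF irr, of "Inr ` A" "Inl ` B" f'] A by blast
  define g where "g y = h (case_sum y (\<lambda>_. 0))" for y
  have csum: "(\<lambda>y. case_sum y (\<lambda>_. 0 :: complex) i) \<in> poly_on UNIV" for i :: "'o + 'p"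
    by (cases i) (auto intro: poly_on.intros)
  have g_poly: "g \<in> poly_functions"
    unfolding g_def poly_functions_eq
    by (rule poly_on_subst[OF h(1), of "\<lambda>y. case_sum y (\<lambda>_. 0)"]) (rule csum)
  have hg: "h (F x) = g (\<Phi> x)" for x
    unfolding g_def F_def by (rule poly_on_cong[OF h(1)]) auto
  obtain x1 where x1: "g (\<Phi> x1) \<noteq> 0"
    using h(2) by (auto simp: vanishes_on_def \<Gamma>_def hg)
  have "\<exists>x\<in>affine_space A. f x \<noteq> 0 \<and> \<Phi> x = y"
    if y: "y \<in> zcl (range \<Phi>)" "y \<in> affine_space B" "g y \<noteq> 0" for y
  proof -
    have "closure_point \<Gamma> (Inl ` B) (case_sum y (\<lambda>_. 0))"
      unfolding closure_point_def
    proof (intro ballI impI)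
      fix P assume P: "P \<in> poly_on (Inl ` B :: ('o + 'p) set)" "vanishes_on \<Gamma> P"
      have "(\<lambda>y. P (case_sum y (\<lambda>_. 0))) \<in> poly_functions"
        unfolding poly_functions_eq
        by (rule poly_on_subst[OF P(1), of "\<lambda>y. case_sum y (\<lambda>_. 0)"]) (rule csum)
      moreover have "P (case_sum (\<Phi> x) (\<lambda>_. 0)) = 0" for x
      proof -
        have "P (case_sum (\<Phi> x) (\<lambda>_. 0)) = P (F x)"
          by (rule poly_on_cong[OF P(1)]) (auto simp: F_def)
        then show ?thesis using P(2) by (auto simp: vanishes_on_def \<Gamma>_def)
      qed
      ultimately show "P (case_sum y (\<lambda>_. 0)) = 0"
        using zclD[OF y(1)] by blast
    qed
    from h(3)[OF this] y(3) obtain y' where y': "\<And>i. i \<notin> Inr ` A \<Longrightarrow> y' i = case_sum y (\<lambda>_. 0) i"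
      "closure_point \<Gamma> (Inl ` B \<union> Inr ` A) y'" "f' y' \<noteq> 0"
      by (auto simp: g_def)
    \<comment> \<open>Coordinates outside \<open>A\<close> influence neither \<Phi> nor
      \<open>f\<close> and are set to zero.\<close>
    define x where "x = restrict_to A (\<lambda>i. y' (Inr i))"
    have Phi_x: "\<Phi> x i = \<Phi> (\<lambda>i. y' (Inr i)) i" for i
      by (rule poly_on_cong[OF Phi(1)]) (simp add: x_def restrict_to_def)
    have "\<Phi> x i = y i" for i
    proof (cases "i \<in> B")
      case True
      have "(\<lambda>z. z (Inl i) - \<Phi> (\<lambda>i. z (Inr i :: 'o + 'p)) i) \<in> poly_on (Inl ` B \<union> Inr ` A)"
        by (intro poly_on_diff poly_on.coord poly_on_subst[OF Phi(1), of "\<lambda>z i. z (Inr i)"])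
          (use True in \<open>auto intro: poly_on.coord\<close>)
      moreover have "vanishes_on \<Gamma> (\<lambda>z. z (Inl i) - \<Phi> (\<lambda>i. z (Inr i :: 'o + 'p)) i)"
        by (auto simp: vanishes_on_def \<Gamma>_def F_def)
      ultimately have "y' (Inl i) - \<Phi> (\<lambda>i. y' (Inr i)) i = 0"
        using y'(2) unfolding closure_point_def by blast
      then show ?thesis using y'(1)[of "Inl i"] by (auto simp: Phi_x)
    next
      case False
      then show ?thesis using Phi(2)[of x] y(2) by (auto simp: affine_space_def)
    qed
    moreover have "f x = f (\<lambda>i. y' (Inr i))"
      by (rule poly_on_cong[OF f(1)]) (simp add: x_def restrict_to_def)
    then have "f x \<noteq> 0" using y'(3) by (simp add: f'_def)
    ultimately show ?thesis by (intro bexI[of _ x]) (auto simp: x_def)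
  qed
  with g_poly x1 show ?thesis using that by blast
qed

text \<open>Up to powers of its leading coefficient, multiplication by a relation \<open>P\<close> modulo the relation
  \<open>G\<close> is given by a matrix over the functions in \<open>J\<close> that kills the vector of powers of the new
  coordinate on \<open>\<Gamma>\<close>; so its determinant vanishes at closure points. But the determinant is nonzero
  at a point over which \<open>P\<close> and \<open>G\<close> are coprime.\<close>

lemma closure_point_extend_integral:
  assumes j: "j \<notin> J" and b: "\<And>k. b k \<in> poly_on J"
    and G: "vanishes_on \<Gamma> (\<lambda>x. \<Sum>k\<le>e. b k x * x j ^ k)"
    and y: "closure_point \<Gamma> J y" "b e y \<noteq> 0"
  shows "\<exists>t. closure_point \<Gamma> (insert j J) (y(j := t))"
proof (rule ccontr)
  assume no: "\<not> ?thesis"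
  have upd: "P (y(j := t)) = P y" if "P \<in> poly_on J" for P t
    using poly_on_fun_upd[OF that j] .
  have e: "e > 0"
  proof (rule ccontr)
    assume "\<not> e > 0"
    then have "vanishes_on \<Gamma> (b e)" using G by simp
    then show False using y b by (auto simp: closure_point_def)
  qed
  define A where "A = coeff_poly (Suc e) b y"
  have A: "poly A t = (\<Sum>k\<le>e. b k (y(j := t)) * (y(j := t)) j ^ k)" for t
    by (simp add: A_def poly_coeff_poly upd b lessThan_Suc_atMost)
  have degA: "degree A = e" unfolding A_def by (rule degree_coeff_poly_Suc[of b e y, OF y(2)])
  have A0: "A \<noteq> 0" using degA e by auto
  \<comment> \<open>A single relation that is nonzero over all roots of \<open>A\<close>: relations
    for single roots are added with a factor avoiding the finitely many ratios that would create a
    zero.\<close>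
  have "finite R \<Longrightarrow> \<exists>P\<in>poly_on (insert j J). vanishes_on \<Gamma> P \<and> (\<forall>t\<in>R. P (y(j := t)) \<noteq> 0)" for R
  proof (induction R rule: finite_induct)
    case empty
    show ?case by (rule bexI[of _ "\<lambda>x. 0"]) (auto simp: vanishes_on_def poly_on.const)
  next
    case (insert t R)
    then obtain P where P: "P \<in> poly_on (insert j J)" "vanishes_on \<Gamma> P"
      "\<And>t. t \<in> R \<Longrightarrow> P (y(j := t)) \<noteq> 0" by blast
    obtain P' where P': "P' \<in> poly_on (insert j J)" "vanishes_on \<Gamma> P'" "P' (y(j := t)) \<noteq> 0"
      using no by (auto simp: closure_point_def)
    let ?bad = "(\<lambda>s. - P (y(j := s)) / P' (y(j := s))) ` insert t R"
    have "finite (insert 0 ?bad)" using insert.hyps by simp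
    then obtain c where c: "c \<notin> insert 0 ?bad"
      using ex_new_if_finite[OF infinite_UNIV_char_0] by blast
    let ?P = "\<lambda>x. P x + c * P' x"
    have nz: "?P (y(j := s)) \<noteq> 0" if "s \<in> insert t R" for s
    proof (cases "P' (y(j := s)) = 0")
      case True
      then have "s \<in> R" using that P'(3) by auto
      then show ?thesis using True P(3) by simp
    next
      case False
      have "c \<noteq> - P (y(j := s)) / P' (y(j := s))" using c that by blast
      then show ?thesis using False by (auto simp: field_simps add_eq_0_iff2)
    qed
    show ?case
    proof (intro bexI[of _ ?P] conjI ballI)
      show "vanishes_on \<Gamma> ?P" using P(2) P'(2) by (simp add: vanishes_on_def)
      show "?P \<in> poly_on (insert j J)" by (intro poly_on.intros P P')
    qed (rule nz)
  qed
  from this[OF poly_roots_finite[OF A0]]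
  obtain P where P: "P \<in> poly_on (insert j J)" "vanishes_on \<Gamma> P"
    "\<And>t. poly A t = 0 \<Longrightarrow> P (y(j := t)) \<noteq> 0" by blast
  have "\<forall>k. \<exists>N q r. q \<in> poly_on (insert j J) \<and> (\<forall>l. r l \<in> poly_on J) \<and>
    (\<forall>x. b e x ^ N * (x j ^ k * P x) = q x * (\<Sum>k\<le>e. b k x * x j ^ k) + (\<Sum>l<e. r l x * x j ^ l))"
  proof
    fix k
    have xP: "(\<lambda>x. x j ^ k * P x) \<in> poly_on (insert j J)"
      using P(1) by (intro poly_on_intros poly_on.coord) auto
    show "\<exists>N q r. q \<in> poly_on (insert j J) \<and> (\<forall>l. r l \<in> poly_on J) \<and>
      (\<forall>x. b e x ^ N * (x j ^ k * P x) = q x * (\<Sum>k\<le>e. b k x * x j ^ k) + (\<Sum>l<e. r l x * x j ^ l))"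
      by (rule pseudo_division[of b J "\<lambda>x. x j ^ k * P x" j e, OF b xP])
  qed
  from choice[OF this] obtain N where "\<forall>k. \<exists>q r. q \<in> poly_on (insert j J) \<and> (\<forall>l. r l \<in> poly_on J) \<and>
      (\<forall>x. b e x ^ N k * (x j ^ k * P x) = q x * (\<Sum>k\<le>e. b k x * x j ^ k) + (\<Sum>l<e. r l x * x j ^ l))"
    by (elim exE)
  from choice[OF this] obtain q where "\<forall>k. \<exists>r. q k \<in> poly_on (insert j J) \<and> (\<forall>l. r l \<in> poly_on J) \<and>
      (\<forall>x. b e x ^ N k * (x j ^ k * P x) = q k x * (\<Sum>k\<le>e. b k x * x j ^ k) + (\<Sum>l<e. r l x * x j ^ l))"
    by (elim exE)
  from choice[OF this] obtain r where "\<forall>k. q k \<in> poly_on (insert j J) \<and> (\<forall>l. r k l \<in> poly_on J) \<and>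
      (\<forall>x. b e x ^ N k * (x j ^ k * P x) = q k x * (\<Sum>k\<le>e. b k x * x j ^ k) + (\<Sum>l<e. r k l x * x j ^ l))"
    by (elim exE)
  then have q: "q k \<in> poly_on (insert j J)" and r: "r k l \<in> poly_on J"
    and div: "b e x ^ N k * (x j ^ k * P x) =
      q k x * (\<Sum>k\<le>e. b k x * x j ^ k) + (\<Sum>l<e. r k l x * x j ^ l)" for k l x
    by simp_all
  let ?M = "\<lambda>x. mat e e (\<lambda>(k, l). r k l x)"
  have "(\<lambda>x. det (?M x)) \<in> poly_on J" by (rule poly_on_det[OF r])
  moreover have "vanishes_on \<Gamma> (\<lambda>x. det (?M x))"
    unfolding vanishes_on_def
  proof
    fix x assume x: "x \<in> \<Gamma>"
    let ?v = "vec e (\<lambda>l. x j ^ l)"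
    have "?v $ 0 \<noteq> 0\<^sub>v e $ 0" using e by simp
    then have "?v \<noteq> 0\<^sub>v e" by metis
    moreover have "?M x *\<^sub>v ?v = 0\<^sub>v e"
    proof (rule eq_vecI)
      fix k assume "k < dim_vec (0\<^sub>v e :: complex vec)"
      then have k: "k < e" by simp
      have "(\<Sum>l<e. r k l x * x j ^ l) = 0"
        using div[of x k] G P(2) x by (simp add: vanishes_on_def)
      then show "(?M x *\<^sub>v ?v) $ k = 0\<^sub>v e $ k"
        using k by (simp add: scalar_prod_def atLeast0LessThan)
    qed simp
    ultimately show "det (?M x) = 0"
      by (subst det_0_iff_vec_prod_zero[of _ e]) (auto intro!: exI[of _ ?v])
  qed
  ultimately have "det (?M y) = 0" using y(1) unfolding closure_point_def by blast
  then have "det (transpose_mat (?M y)) = 0" by (subst det_transpose[of _ e]) auto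
  then obtain w where w: "w \<in> carrier_vec e" "w \<noteq> 0\<^sub>v e" "transpose_mat (?M y) *\<^sub>v w = 0\<^sub>v e"
    by (subst (asm) det_0_iff_vec_prod_zero[of _ e]) auto
  have w0: "(\<Sum>k<e. r k l y * w $ k) = 0" if "l < e" for l
  proof -
    have "(transpose_mat (?M y) *\<^sub>v w) $ l = 0" using w(3) that by simp
    then show ?thesis using that w(1) by (simp add: scalar_prod_def atLeast0LessThan)
  qed
  obtain nP cP where cP: "\<forall>k. cP k \<in> poly_on J" "\<forall>x. P x = (\<Sum>k<nP. cP k x * x j ^ k)"
    using poly_on_insert_expansion[OF P(1)] by (elim exE conjE)
  define PP where "PP = coeff_poly nP cP y"
  have PP: "poly PP t = P (y(j := t))" for t
    using cP by (simp add: PP_def poly_coeff_poly upd)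
  \<comment> \<open>The vector \<open>w\<close> in the left kernel of the matrix makes
    \<open>A\<close> divide \<open>W * PP\<close>. As \<open>A\<close> and \<open>PP\<close> are
    coprime, \<open>A\<close> divides \<open>W\<close>, which is nonzero of degree below
    \<open>e\<close>.\<close>
  define W where "W = coeff_poly e (\<lambda>k _. w $ k * b e y ^ N k) y"
  have "\<forall>k. \<exists>n c. (\<forall>i. c i \<in> poly_on J) \<and> (\<forall>x. q k x = (\<Sum>i<n. c i x * x j ^ i))"
    by (intro allI poly_on_insert_expansion q)
  from choice[OF this] obtain nq where
    "\<forall>k. \<exists>c. (\<forall>i. c i \<in> poly_on J) \<and> (\<forall>x. q k x = (\<Sum>i<nq k. c i x * x j ^ i))"
    by (elim exE)
  from choice[OF this] obtain cq where
    "\<forall>k. (\<forall>i. cq k i \<in> poly_on J) \<and> (\<forall>x. q k x = (\<Sum>i<nq k. cq k i x * x j ^ i))"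
    by (elim exE)
  then have cq: "cq k i \<in> poly_on J" "q k x = (\<Sum>i<nq k. cq k i x * x j ^ i)" for k i x
    by simp_all
  define Q where "Q = (\<Sum>k<e. smult (w $ k) (coeff_poly (nq k) (cq k) y))"
  have "W * PP = Q * A"
  proof (rule poly_ext)
    fix t
    have eq: "b e y ^ N k * (t ^ k * poly PP t)
      = poly (coeff_poly (nq k) (cq k) y) t * poly A t + (\<Sum>l<e. r k l y * t ^ l)" for k
      using div[of "y(j := t)" k] by (simp add: A PP cq(2) poly_coeff_poly upd b r cq(1))
    have "poly (W * PP) t = (\<Sum>k<e. w $ k * (b e y ^ N k * (t ^ k * poly PP t)))"
      by (simp add: W_def poly_coeff_poly sum_distrib_right sum_distrib_left mult_ac)
    also have "\<dots> = poly Q t * poly A t + (\<Sum>k<e. \<Sum>l<e. w $ k * (r k l y * t ^ l))"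
      unfolding eq by (simp add: Q_def poly_sum sum_distrib_right sum_distrib_left
          distrib_left sum.distrib mult_ac)
    also have "(\<Sum>k<e. \<Sum>l<e. w $ k * (r k l y * t ^ l)) = (\<Sum>l<e. (\<Sum>k<e. r k l y * w $ k) * t ^ l)"
      by (subst sum.swap) (simp add: sum_distrib_right sum_distrib_left mult_ac)
    also have "\<dots> = 0" using w0 by simp
    finally show "poly (W * PP) t = poly (Q * A) t" by simp
  qed
  then have "A dvd W * PP" by simp
  moreover have "coprime A PP"
  proof (rule coprimeI)
    fix c assume c: "c dvd A" "c dvd PP"
    show "is_unit c"
    proof (rule ccontr)
      assume "\<not> is_unit c"
      moreover have "c \<noteq> 0" using c(1) A0 by auto
      ultimately have "degree c \<noteq> 0" by (simp add: is_unit_iff_degree)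
      then obtain t where "poly c t = 0"
        using fundamental_theorem_of_algebra[of c] constant_degree[of c] by auto
      then have "poly A t = 0" "poly PP t = 0" using c by (auto elim!: dvdE)
      then show False using P(3) PP by simp
    qed
  qed
  ultimately have "A dvd W" by (simp add: coprime_dvd_mult_left_iff)
  moreover have "degree W < e" unfolding W_def by (rule degree_coeff_poly_less[OF e])
  moreover have "W \<noteq> 0"
  proof
    assume "W = 0"
    have "w $ k = 0" if "k < e" for k
    proof -
      have "coeff W k = 0" using \<open>W = 0\<close> by simp
      then show ?thesis using that y(2) by (simp add: W_def coeff_coeff_poly)
    qed
    then show False using w(1,2) by (auto intro!: eq_vecI)
  qed
  ultimately show False using dvd_imp_degree_le[of A W] degA by simp
qed

section \<open>Pencils from triangle networks\<close>

definition tens :: "nat \<Rightarrow> nat \<Rightarrow> (nat \<Rightarrow> nat \<Rightarrow> nat \<Rightarrow> complex) \<Rightarrow> nat \<times> nat \<times> nat \<Rightarrow> complex" where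
  "tens n1 n2 f = (\<lambda>(l, i, j). if l < 2 \<and> i < n1 \<and> j < n2 then f l i j else 0)"

lemma tens_apply: "tens n1 n2 f (l, i, j) = (if l < 2 \<and> i < n1 \<and> j < n2 then f l i j else 0)"
  by (simp add: tens_def)

lemma tens_mem [simp]: "tens n1 n2 f \<in> tensor_space 2 n1 n2"
  by (auto simp: tens_def affine_space_def)

lemma tens_cong:
  "(\<And>l i j. l < 2 \<Longrightarrow> i < n1 \<Longrightarrow> j < n2 \<Longrightarrow> f l i j = g l i j) \<Longrightarrow> tens n1 n2 f = tens n1 n2 g"
  by (auto simp: tens_def fun_eq_iff)

lemma tens_of_tensor: "T \<in> tensor_space 2 n1 n2 \<Longrightarrow> tens n1 n2 (\<lambda>l i j. T (l, i, j)) = T"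
  by (auto simp: tens_def affine_space_def fun_eq_iff)

lemma poly_on_tens:
  "(\<And>l i j. l < 2 \<Longrightarrow> i < n1 \<Longrightarrow> j < n2 \<Longrightarrow> (\<lambda>x. F x l i j) \<in> poly_on J) \<Longrightarrow> (\<lambda>x. tens n1 n2 (F x) k) \<in> poly_on J"
proof -
  assume F: "\<And>l i j. l < 2 \<Longrightarrow> i < n1 \<Longrightarrow> j < n2 \<Longrightarrow> (\<lambda>x. F x l i j) \<in> poly_on J"
  obtain l i j where "k = (l, i, j)" by (rule prod_cases3)
  then show ?thesis
    by (cases "l < 2 \<and> i < n1 \<and> j < n2") (auto simp: tens_apply intro: F poly_on.const)
qed

lemma sum_delta_lessThan:
  fixes f :: "nat \<Rightarrow> 'a :: semiring_1"
  shows "(\<Sum>x<n. f x * (if x = a then c else 0)) = (if a < n then f a * c else 0)"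
    "(\<Sum>x<n. f x * (if a = x then c else 0)) = (if a < n then f a * c else 0)"
    "(\<Sum>x<n. (if x = a then c else 0) * f x) = (if a < n then c * f a else 0)"
    "(\<Sum>x<n. (if a = x then c else 0) * f x) = (if a < n then c * f a else 0)"
proof -
  have "(\<Sum>x<n. f x * (if x = a then c else 0)) = (\<Sum>x<n. if x = a then f x * c else 0)"
    "(\<Sum>x<n. (if x = a then c else 0) * f x) = (\<Sum>x<n. if x = a then c * f x else 0)"
    by (intro sum.cong; simp)+
  then show "(\<Sum>x<n. f x * (if x = a then c else 0)) = (if a < n then f a * c else 0)"
    "(\<Sum>x<n. (if x = a then c else 0) * f x) = (if a < n then c * f a else 0)"
    by simp_all
  then show "(\<Sum>x<n. f x * (if a = x then c else 0)) = (if a < n then f a * c else 0)"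
    "(\<Sum>x<n. (if a = x then c else 0) * f x) = (if a < n then c * f a else 0)"
    by (simp_all only: eq_commute[of a])
qed

lemma sum_div_mod:
  fixes f :: "nat \<Rightarrow> 'a :: comm_monoid_add"
  shows "(\<Sum>u<a * b. f u) = (\<Sum>x<a. \<Sum>y<b. f (x * b + y))"
proof -
  have "sum f {x * b..<x * b + b} = (\<Sum>y<b. f (x * b + y))" for x
    using sum.shift_bounds_nat_ivl[of f 0 "x * b" b] by (simp add: atLeast0LessThan add.commute)
  moreover have "(\<Sum>u<a * b. f u) = (\<Sum>x<a. sum f {x * b..<x * b + b})"
    by (rule sum.nat_group[symmetric])
  ultimately show ?thesis by simp
qed

lemma sum_lessThan_add:
  fixes f :: "nat \<Rightarrow> 'a :: comm_monoid_add"
  shows "(\<Sum>u<a + b. f u) = (\<Sum>u<a. f u) + (\<Sum>y<b. f (a + y))"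
proof -
  have "(\<Sum>u<a + b. f u) = (\<Sum>u\<in>{0..<a}. f u) + (\<Sum>u\<in>{a..<a + b}. f u)"
    by (simp add: lessThan_atLeast0 sum.atLeastLessThan_concat)
  then show ?thesis
    using sum.shift_bounds_nat_ivl[of f 0 a b] by (simp add: atLeast0LessThan add.commute)
qed

text \<open>The pencil \<open>X1 (B \<otimes> id\<^sub>k) X2\<^sup>t\<close>.\<close>

definition tri :: "nat \<Rightarrow> nat \<Rightarrow> nat \<Rightarrow> nat \<Rightarrow> nat \<Rightarrow> (nat \<Rightarrow> nat \<Rightarrow> nat \<Rightarrow> complex) \<Rightarrow>
  (nat \<Rightarrow> nat \<Rightarrow> nat \<Rightarrow> complex) \<Rightarrow> (nat \<Rightarrow> nat \<Rightarrow> nat \<Rightarrow> complex) \<Rightarrow> nat \<times> nat \<times> nat \<Rightarrow> complex" where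
  "tri a k b n1 n2 B X1 X2 =
     tens n1 n2 (\<lambda>l i j. \<Sum>x<a. \<Sum>y<k. \<Sum>z<b. B l x z * X1 i x y * X2 j y z)"

lemma apply_tensor_maps_triangle:
  "apply_tensor_maps 2 n1 n2 ({..<a} \<times> {..<b}) ({..<a} \<times> {..<k}) ({..<k} \<times> {..<b})
     X0 X1 X2 (triangle_tensor a k b)
   = tri a k b n1 n2 (\<lambda>l x z. X0 l (x, z)) (\<lambda>i x y. X1 i (x, y)) (\<lambda>j y z. X2 j (y, z))"
proof -
  let ?P = "{..<a} \<times> {..<b}" and ?Q = "{..<a} \<times> {..<k}" and ?R = "{..<k} \<times> {..<b}"
  have "(\<Sum>p\<in>?P. \<Sum>q\<in>?Q. \<Sum>r\<in>?R. X0 l p * X1 i q * X2 j r * triangle_tensor a k b (p, q, r))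
    = (\<Sum>x<a. \<Sum>y<k. \<Sum>z<b. X0 l (x, z) * X1 i (x, y) * X2 j (y, z))" for l i j
  proof -
    let ?f = "\<lambda>x y z p q r. X0 l p * X1 i q * X2 j r *
      (if p = (x, z) then if q = (x, y) then if r = (y, z) then 1 else 0 else 0 else 0)"
    have "(\<Sum>p\<in>?P. \<Sum>q\<in>?Q. \<Sum>r\<in>?R. X0 l p * X1 i q * X2 j r * triangle_tensor a k b (p, q, r))
      = (\<Sum>p\<in>?P. \<Sum>q\<in>?Q. \<Sum>r\<in>?R. \<Sum>x<a. \<Sum>y<k. \<Sum>z<b. ?f x y z p q r)"
      unfolding triangle_tensor_def sum_distrib_left by (intro sum.cong refl) auto
    also have "\<dots> = (\<Sum>x<a. \<Sum>y<k. \<Sum>z<b. \<Sum>p\<in>?P. \<Sum>q\<in>?Q. \<Sum>r\<in>?R. ?f x y z p q r)"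
      by (simp only: sum.swap[of _ "{..<a}" ?R] sum.swap[of _ "{..<a}" ?Q] sum.swap[of _ "{..<a}" ?P]
         sum.swap[of _ "{..<k}" ?R] sum.swap[of _ "{..<k}" ?Q] sum.swap[of _ "{..<k}" ?P]
         sum.swap[of _ "{..<b}" ?R] sum.swap[of _ "{..<b}" ?Q] sum.swap[of _ "{..<b}" ?P])
    also have "\<dots> = (\<Sum>x<a. \<Sum>y<k. \<Sum>z<b. X0 l (x, z) * X1 i (x, y) * X2 j (y, z))"
    proof (intro sum.cong refl)
      fix x y z assume xyz: "x \<in> {..<a}" "y \<in> {..<k}" "z \<in> {..<b}"
      have delta: "finite A \<Longrightarrow> (\<Sum>r\<in>A. f r * (if r = a then c else 0)) = (if a \<in> A then f a * c else 0)"
        for f :: "nat \<times> nat \<Rightarrow> complex" and A a c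
        by (simp add: if_distrib[of "\<lambda>t. _ * t"] sum.delta cong: if_cong)
      have "(\<Sum>p\<in>?P. \<Sum>q\<in>?Q. \<Sum>r\<in>?R. ?f x y z p q r)
        = (\<Sum>p\<in>?P. X0 l p * (if p = (x, z) then
            \<Sum>q\<in>?Q. X1 i q * (if q = (x, y) then
            \<Sum>r\<in>?R. X2 j r * (if r = (y, z) then 1 else 0) else 0) else 0))"
        by (intro sum.cong refl) (auto simp: sum_distrib_left mult.assoc intro!: sum.cong)
      also have "\<dots> = X0 l (x, z) * X1 i (x, y) * X2 j (y, z)"
        using xyz by (simp add: delta)
      finally show "(\<Sum>p\<in>?P. \<Sum>q\<in>?Q. \<Sum>r\<in>?R. ?f x y z p q r) = X0 l (x, z) * X1 i (x, y) * X2 j (y, z)" .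
    qed
    finally show ?thesis .
  qed
  then show ?thesis
    by (auto simp: apply_tensor_maps_def tri_def tens_def fun_eq_iff)
qed

definition tri_image :: "nat \<Rightarrow> nat \<Rightarrow> nat \<Rightarrow> nat \<Rightarrow> nat \<Rightarrow> (nat \<times> nat \<times> nat \<Rightarrow> complex) set" where
  "tri_image a k b n1 n2 = {tri a k b n1 n2 B X1 X2 | B X1 X2. True}"

lemma tri_image_subset: "tri_image a k b n1 n2 \<subseteq> tensor_space 2 n1 n2"
  by (auto simp: tri_image_def tri_def)

lemma TNS_triangle_eq: "TNS_triangle a k b 2 n1 n2 = tensor_space 2 n1 n2 \<inter> zcl (tri_image a k b n1 n2)"
proof -
  have "{T. \<exists>X0 X1 X2. T = apply_tensor_maps 2 n1 n2 ({..<a} \<times> {..<b}) ({..<a} \<times> {..<k}) ({..<k} \<times> {..<b})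
     X0 X1 X2 (triangle_tensor a k b)} = tri_image a k b n1 n2"
  proof (intro Set.set_eqI iffI)
    fix T assume "T \<in> tri_image a k b n1 n2"
    then obtain B X1 X2 where "T = tri a k b n1 n2 B X1 X2" by (auto simp: tri_image_def)
    then have "T = apply_tensor_maps 2 n1 n2 ({..<a} \<times> {..<b}) ({..<a} \<times> {..<k}) ({..<k} \<times> {..<b})
      (\<lambda>l (x, z). B l x z) (\<lambda>i (x, y). X1 i x y) (\<lambda>j (y, z). X2 j y z) (triangle_tensor a k b)"
      by (simp add: apply_tensor_maps_triangle)
    then show "T \<in> {T. \<exists>X0 X1 X2. T = apply_tensor_maps 2 n1 n2 ({..<a} \<times> {..<b}) ({..<a} \<times> {..<k})
      ({..<k} \<times> {..<b}) X0 X1 X2 (triangle_tensor a k b)}"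
      by blast
  qed (auto simp: apply_tensor_maps_triangle tri_image_def)
  then show ?thesis
    unfolding TNS_triangle_def using closure_of_zariski[OF tri_image_subset] by simp
qed

definition pencil_mult ::
  "nat \<Rightarrow> nat \<Rightarrow> nat \<Rightarrow> nat \<Rightarrow> (nat \<Rightarrow> nat \<Rightarrow> complex) \<Rightarrow> (nat \<Rightarrow> nat \<Rightarrow> complex) \<Rightarrow>
   (nat \<times> nat \<times> nat \<Rightarrow> complex) \<Rightarrow> nat \<times> nat \<times> nat \<Rightarrow> complex" where
  "pencil_mult n1 n2 n1' n2' g1 g2 T =
     tens n1 n2 (\<lambda>l i j. \<Sum>u<n1'. \<Sum>v<n2'. g1 i u * T (l, u, v) * g2 j v)"

lemma poly_pencil_mult: "(\<lambda>T. pencil_mult n1 n2 n1' n2' g1 g2 T k) \<in> poly_functions"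
  unfolding pencil_mult_def poly_functions_eq
  by (intro poly_on_tens poly_on_intros poly_on.coord) auto

lemma pencil_mult_tri:
  "pencil_mult n1 n2 n1' n2' g1 g2 (tri a k b n1' n2' B X1 X2) =
   tri a k b n1 n2 B (\<lambda>i x y. \<Sum>u<n1'. g1 i u * X1 u x y) (\<lambda>j y z. \<Sum>v<n2'. g2 j v * X2 v y z)"
  unfolding pencil_mult_def tri_def
proof (rule tens_cong)
  fix l i j :: nat assume l: "l < 2"
  have "(\<Sum>u<n1'. \<Sum>v<n2'. g1 i u * tens n1' n2' (\<lambda>l i j. \<Sum>x<a. \<Sum>y<k. \<Sum>z<b. B l x z * X1 i x y * X2 j y z) (l, u, v) * g2 j v)
    = (\<Sum>u<n1'. \<Sum>v<n2'. \<Sum>x<a. \<Sum>y<k. \<Sum>z<b. B l x z * (g1 i u * X1 u x y) * (g2 j v * X2 v y z))"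
    using l by (intro sum.cong refl) (simp add: tens_apply sum_distrib_left sum_distrib_right mult_ac)
  also have "\<dots> = (\<Sum>x<a. \<Sum>y<k. \<Sum>z<b. \<Sum>u<n1'. \<Sum>v<n2'. B l x z * (g1 i u * X1 u x y) * (g2 j v * X2 v y z))"
    by (simp only: sum.swap[of _ "{..<a}" "{..<n2'}"] sum.swap[of _ "{..<a}" "{..<n1'}"]
      sum.swap[of _ "{..<k}" "{..<n2'}"] sum.swap[of _ "{..<k}" "{..<n1'}"]
      sum.swap[of _ "{..<b}" "{..<n2'}"] sum.swap[of _ "{..<b}" "{..<n1'}"])
  also have "\<dots> = (\<Sum>x<a. \<Sum>y<k. \<Sum>z<b. B l x z * (\<Sum>u<n1'. g1 i u * X1 u x y) * (\<Sum>v<n2'. g2 j v * X2 v y z))"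
    by (simp add: sum_distrib_left sum_distrib_right mult_ac)
  finally show "(\<Sum>u<n1'. \<Sum>v<n2'. g1 i u * tens n1' n2' (\<lambda>l i j. \<Sum>x<a. \<Sum>y<k. \<Sum>z<b. B l x z * X1 i x y * X2 j y z) (l, u, v) * g2 j v)
    = (\<Sum>x<a. \<Sum>y<k. \<Sum>z<b. B l x z * (\<Sum>u<n1'. g1 i u * X1 u x y) * (\<Sum>v<n2'. g2 j v * X2 v y z))" .
qed

text \<open>The factors may be rectangular, so this serves both to spread normal forms over their
  orbits and to cut networks down to square ones.\<close>

lemma pencil_mult_zcl_tri_image:
  assumes "T \<in> zcl (tri_image a k b n1' n2')"
  shows "pencil_mult n1 n2 n1' n2' g1 g2 T \<in> zcl (tri_image a k b n1 n2)"
proof (rule zcl_image_subset[of T _ "pencil_mult n1 n2 n1' n2' g1 g2", OF assms poly_pencil_mult])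
  fix x assume "x \<in> tri_image a k b n1' n2'"
  then obtain B X1 X2 where x: "x = tri a k b n1' n2' B X1 X2" by (auto simp: tri_image_def)
  have "pencil_mult n1 n2 n1' n2' g1 g2 x \<in> tri_image a k b n1 n2"
    unfolding tri_image_def x pencil_mult_tri by blast
  then show "pencil_mult n1 n2 n1' n2' g1 g2 x \<in> zcl (tri_image a k b n1 n2)"
    using zcl_superset by blast
qed

text \<open>The infinitesimal condition for the orbit of the pencil \<open>B\<close> under left and right multiplication
  to be open.\<close>

definition tangent_full :: "nat \<Rightarrow> nat \<Rightarrow> (nat \<Rightarrow> nat \<Rightarrow> nat \<Rightarrow> complex) \<Rightarrow> bool" where
  "tangent_full a b B \<longleftrightarrow> (\<forall>C :: nat \<Rightarrow> nat \<Rightarrow> nat \<Rightarrow> complex. \<exists>e d. \<forall>l<2. \<forall>i<a. \<forall>j<b.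
     (\<Sum>x<a. e i x * B l x j) + (\<Sum>z<b. B l i z * d z j) = C l i j)"

lemma tangent_full_transpose: "tangent_full a b B \<Longrightarrow> tangent_full b a (\<lambda>l i j. B l j i)"
  unfolding tangent_full_def
proof
  fix C :: "nat \<Rightarrow> nat \<Rightarrow> nat \<Rightarrow> complex"
  assume "\<forall>C :: nat \<Rightarrow> nat \<Rightarrow> nat \<Rightarrow> complex. \<exists>e d. \<forall>l<2. \<forall>i<a. \<forall>j<b.
     (\<Sum>x<a. e i x * B l x j) + (\<Sum>z<b. B l i z * d z j) = C l i j"
  from spec[OF this, of "\<lambda>l i j. C l j i"] obtain e d where ed: "\<forall>l<2. \<forall>i<a. \<forall>j<b.
     (\<Sum>x<a. e i x * B l x j) + (\<Sum>z<b. B l i z * d z j) = C l j i"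
    by (elim exE)
  show "\<exists>e d. \<forall>l<2. \<forall>i<b. \<forall>j<a. (\<Sum>x<b. e i x * B l j x) + (\<Sum>z<a. B l z i * d z j) = C l i j"
  proof (intro exI allI impI)
    fix l i j :: nat assume "l < 2" "i < b" "j < a"
    with ed show "(\<Sum>x<b. d x i * B l j x) + (\<Sum>z<a. B l z i * e j z) = C l i j"
      by (simp add: mult.commute add.commute)
  qed
qed

text \<open>At the truncated identity matrices the tangent condition for \<open>B\<close> tensored
  with the identity splits into \<open>k * k\<close> copies of the condition for \<open>B\<close>,
  one for each pair of positions inside the blocks.\<close>

lemma tri_orbit_dense:
  assumes full: "tangent_full a b B" and n: "n1 \<le> a * k" "n2 \<le> b * k"
  shows "tensor_space 2 n1 n2 \<subseteq> zcl {tri a k b n1 n2 B X1 X2 | X1 X2. True}"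
proof (rule affine_space_subset_zcl_if_tangent)
  let ?I = "\<lambda>i x y. if i = x * k + y then 1 else 0 :: complex"
  let ?J = "\<lambda>j y z. if j = z * k + y then 1 else 0 :: complex"
  show "{tri a k b n1 n2 B X1 X2 | X1 X2. True} \<subseteq> tensor_space 2 n1 n2"
    by (auto simp: tri_def)
  fix z :: "nat \<times> nat \<times> nat \<Rightarrow> complex"
  \<comment> \<open>The entries at positions \<open>p\<close> of all blocks form an \<open>a\<close>
    by \<open>b\<close> pencil, to which \<open>tangent_full\<close> applies.\<close>
  have "\<forall>p. \<exists>f. \<forall>l<2. \<forall>i<a. \<forall>j<b. (\<Sum>x<a. fst f i x * B l x j) + (\<Sum>w<b. B l i w * snd f w j)
    = z (l, i * k + fst p, j * k + snd p)"
  proof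
    fix p :: "nat \<times> nat"
    obtain e d where "\<forall>l<2. \<forall>i<a. \<forall>j<b. (\<Sum>x<a. e i x * B l x j) + (\<Sum>w<b. B l i w * d w j)
      = z (l, i * k + fst p, j * k + snd p)"
      using spec[OF full[unfolded tangent_full_def], of "\<lambda>l i j. z (l, i * k + fst p, j * k + snd p)"]
      by (elim exE)
    then show "\<exists>f. \<forall>l<2. \<forall>i<a. \<forall>j<b. (\<Sum>x<a. fst f i x * B l x j) + (\<Sum>w<b. B l i w * snd f w j)
      = z (l, i * k + fst p, j * k + snd p)"
      by (intro exI[of _ "(e, d)"]) simp
  qed
  from choice[OF this] obtain f where f: "\<forall>p. \<forall>l<2. \<forall>i<a. \<forall>j<b.
    (\<Sum>x<a. fst (f p) i x * B l x j) + (\<Sum>w<b. B l i w * snd (f p) w j) = z (l, i * k + fst p, j * k + snd p)"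
    by (elim exE)
  define e where "e y y' = fst (f (y, y'))" for y y'
  define d where "d y y' = snd (f (y, y'))" for y y'
  have ed: "(\<Sum>x<a. e y y' i x * B l x j) + (\<Sum>w<b. B l i w * d y y' w j) = z (l, i * k + y, j * k + y')"
    if "l < 2" "i < a" "j < b" for y y' l i j
    using f[rule_format, OF that, of "(y, y')"] by (simp add: e_def d_def)
  define E where "E i x y = e (i mod k) y (i div k) x" for i x y
  define D where "D j y w = d y (j mod k) w (j div k)" for j y w
  let ?\<gamma> = "\<lambda>t. tri a k b n1 n2 B (\<lambda>i x y. ?I i x y + t * E i x y) (\<lambda>j y z. ?J j y z + t * D j y z)"
  show "\<exists>\<gamma>. (\<forall>t. \<gamma> t \<in> {tri a k b n1 n2 B X1 X2 | X1 X2. True}) \<and>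
      \<gamma> 0 = tri a k b n1 n2 B ?I ?J \<and>
      (\<forall>q\<in>tensor_index 2 n1 n2. ((\<lambda>t. \<gamma> t q) has_field_derivative z q) (at 0))"
  proof (intro exI[of _ ?\<gamma>] conjI ballI allI)
    fix q assume "q \<in> tensor_index 2 n1 n2"
    then obtain l i j where q: "q = (l, i, j)" "l < 2" "i < n1" "j < n2" by auto
    have k: "k > 0" using q(3) n by (cases "k = 0") auto
    have ij: "i div k < a" "j div k < b"
      using q n k by (auto simp: less_mult_imp_div_less)
    have I: "?I i x y = (if x = i div k then if y = i mod k then 1 else 0 else 0)" if "y < k" for x y
      using that by auto
    have J: "?J j y w = (if w = j div k then if y = j mod k then 1 else 0 else 0)" if "y < k" for w y
      using that by auto
    have "((\<lambda>t. \<Sum>x<a. \<Sum>y<k. \<Sum>w<b. B l x w * (?I i x y + t * E i x y) * (?J j y w + t * D j y w))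
      has_field_derivative (\<Sum>x<a. \<Sum>y<k. \<Sum>w<b. B l x w * E i x y * ?J j y w + B l x w * ?I i x y * D j y w)) (at 0)"
      by (intro DERIV_sum) (auto intro!: derivative_eq_intros)
    moreover have "(\<Sum>x<a. \<Sum>y<k. \<Sum>w<b. B l x w * E i x y * ?J j y w + B l x w * ?I i x y * D j y w)
      = (\<Sum>x<a. B l x (j div k) * E i x (j mod k)) + (\<Sum>w<b. B l (i div k) w * D j (i mod k) w)"
    proof -
      have 1: "(\<Sum>y<k. \<Sum>w<b. B l x w * E i x y * ?J j y w) = B l x (j div k) * E i x (j mod k)" for x
      proof -
        have "(\<Sum>y<k. \<Sum>w<b. B l x w * E i x y * ?J j y w)
          = (\<Sum>y<k. \<Sum>w<b. if w = j div k then if y = j mod k then B l x w * E i x y else 0 else 0)"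
          by (intro sum.cong refl) (simp add: J)
        also have "\<dots> = B l x (j div k) * E i x (j mod k)"
          using ij k by (simp add: sum.delta)
        finally show ?thesis .
      qed
      have 2: "(\<Sum>y<k. \<Sum>w<b. B l x w * ?I i x y * D j y w)
        = (if x = i div k then \<Sum>w<b. B l x w * D j (i mod k) w else 0)" for x
      proof -
        have "(\<Sum>y<k. \<Sum>w<b. B l x w * ?I i x y * D j y w)
          = (\<Sum>y<k. if y = i mod k then \<Sum>w<b. if x = i div k then B l x w * D j y w else 0 else 0)"
          by (intro sum.cong refl) (auto simp: I intro!: sum.neutral)
        also have "\<dots> = (\<Sum>w<b. if x = i div k then B l x w * D j (i mod k) w else 0)"
          using k by (simp add: sum.delta)
        finally show ?thesis by simp
      qed
      show ?thesis
        using ij by (simp only: sum.distrib 1 2) (simp add: sum.delta)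
    qed
    moreover have "\<dots> = z q"
      using ed[OF q(2) ij, of "i mod k" "j mod k"] by (simp add: E_def D_def q(1) mult.commute)
    ultimately show "((\<lambda>t. ?\<gamma> t q) has_field_derivative z q) (at 0)"
      using q by (simp add: tri_def tens_apply)
  qed (auto simp: tri_def)
qed

section \<open>Pencils with an open orbit\<close>

text \<open>The conditions on the left factor couple its entries along the diagonals
  \<open>(i, j), (i + r, j + r), \<dots>\<close>. They are solved downwards from the start of a diagonal below the
  main diagonal and upwards from its end above it.\<close>

function solve_down :: "nat \<Rightarrow> (nat \<Rightarrow> nat \<Rightarrow> complex) \<Rightarrow> nat \<Rightarrow> nat \<Rightarrow> complex" where
  "solve_down r G i j = (if r = 0 \<or> i < r then 0 else if j < r then G i j
     else G i j + solve_down r G (i - r) (j - r))"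
  by auto
termination by (relation "measure (\<lambda>(r, G, i, j). i)") auto

function solve_up :: "nat \<Rightarrow> nat \<Rightarrow> (nat \<Rightarrow> nat \<Rightarrow> complex) \<Rightarrow> nat \<Rightarrow> nat \<Rightarrow> complex" where
  "solve_up a r G i j = (if r = 0 \<or> a \<le> i + r then 0 else if a \<le> j + r then - G (i + r) (j + r)
     else solve_up a r G (i + r) (j + r) - G (i + r) (j + r))"
  by auto
termination by (relation "measure (\<lambda>(a, r, G, i, j). a - i)") auto

declare solve_down.simps [simp del] solve_up.simps [simp del]

lemma solve_diagonals:
  assumes r: "r > 0" and b: "b = a + r"
  obtains E :: "nat \<Rightarrow> nat \<Rightarrow> complex" where
    "\<And>i j. r \<le> i \<Longrightarrow> i < a \<Longrightarrow> j < b \<Longrightarrow>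
      (if j < a then E i j else 0) - (if r \<le> j then E (i - r) (j - r) else 0) = G i j"
proof
  define E where "E i j = (if j \<le> i then solve_down r G i j else solve_up a r G i j)" for i j
  fix i j assume ij: "r \<le> i" "i < a" "j < b"
  show "(if j < a then E i j else 0) - (if r \<le> j then E (i - r) (j - r) else 0) = G i j"
  proof (cases "j \<le> i")
    case True
    then show ?thesis using ij r
      by (auto simp: E_def solve_down.simps[of r G i j])
  next
    case False
    moreover from this have "r \<le> j" using ij by simp
    moreover from calculation have "\<not> j - r \<le> i - r" using ij by simp
    ultimately show ?thesis using ij r
      by (auto simp: E_def solve_up.simps[of a r G "i - r" "j - r"])
  qed
qed

text \<open>The slices are (id | 0) and (0 | id), shifted by \<open>r = b - a\<close>. Slice 0
  determines the rows below \<open>a\<close> of the right factor, slice 1 those from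
  \<open>r\<close> on; agreement on the common rows is the system of \<open>solve_diagonals\<close>
  for the left factor.\<close>

lemma tangent_full_shift:
  assumes ab: "a < b"
  shows "tangent_full a b (\<lambda>l i j. if j = i + l * (b - a) then 1 else 0)"
  unfolding tangent_full_def
proof
  fix C :: "nat \<Rightarrow> nat \<Rightarrow> nat \<Rightarrow> complex"
  define r where "r = b - a"
  have r: "r > 0" "b = a + r" using ab by (auto simp: r_def)
  obtain E where E: "\<And>i j. r \<le> i \<Longrightarrow> i < a \<Longrightarrow> j < b \<Longrightarrow>
      (if j < a then E i j else 0) - (if r \<le> j then E (i - r) (j - r) else 0) = C 0 i j - C 1 (i - r) j"
    using solve_diagonals[OF r, of "\<lambda>i j. C 0 i j - C 1 (i - r) j"] by blast
  define D where "D i j = (if i < a then C 0 i j - (if j < a then E i j else 0)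
    else C 1 (i - r) j - (if r \<le> j then E (i - r) (j - r) else 0))" for i j
  show "\<exists>e d. \<forall>l<2. \<forall>i<a. \<forall>j<b.
     (\<Sum>x<a. e i x * (if j = x + l * (b - a) then 1 else 0))
     + (\<Sum>z<b. (if z = i + l * (b - a) then 1 else 0) * d z j) = C l i j"
  proof (rule exI[of _ E], rule exI[of _ D], intro allI impI)
    fix l i j :: nat assume lij: "l < 2" "i < a" "j < b"
    consider "l = 0" | "l = 1" using lij(1) by linarith
    then show "(\<Sum>x<a. E i x * (if j = x + l * (b - a) then 1 else 0))
     + (\<Sum>z<b. (if z = i + l * (b - a) then 1 else 0) * D z j) = C l i j"
    proof cases
      case 1
      then show ?thesis using lij ab by (simp add: sum_delta_lessThan D_def)
    next
      case 2
      have "(\<Sum>x<a. E i x * (if j = x + r then 1 else 0))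
        = (\<Sum>x<a. E i x * (if x = j - r then if r \<le> j then 1 else 0 else 0))"
        by (intro sum.cong) auto
      also have "\<dots> = (if r \<le> j then E i (j - r) else 0)"
        using lij r by (auto simp: sum_delta_lessThan)
      finally have 1: "(\<Sum>x<a. E i x * (if j = x + r then 1 else 0)) = (if r \<le> j then E i (j - r) else 0)" .
      have 2: "(\<Sum>z<b. (if z = i + r then 1 else 0) * D z j) = D (i + r) j"
        using lij r by (simp add: sum_delta_lessThan)
      have "(if r \<le> j then E i (j - r) else 0) + D (i + r) j = C 1 i j" (is ?eq)
      proof (cases "i + r < a")
        case True
        have "C 0 (i + r) j = C 1 i j + (if j < a then E (i + r) j else 0) - (if r \<le> j then E i (j - r) else 0)"
          using E[of "i + r" j] lij True by (simp add: diff_eq_eq eq_diff_eq algebra_simps)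
        then show ?eq using True by (simp add: D_def)
      qed (simp add: D_def)
      then show ?thesis using \<open>l = 1\<close> 1 2 by (simp add: r_def)
    qed
  qed
qed

text \<open>The pencil \<open>(diag(l\<^sub>0, \<dots>, l\<^bsub>n - 1\<^esub>) | l\<^sub>n (1, \<dots>, 1)\<^sup>t)\<close> with \<open>l\<^sub>j = v\<^sub>0 + \<xi>\<^sub>j v\<^sub>1\<close>.\<close>

lemma tangent_full_diag_column:
  fixes \<xi> :: "nat \<Rightarrow> complex"
  assumes inj: "inj_on \<xi> {..n}"
  shows "tangent_full n (Suc n) (\<lambda>l i j. if j = i \<or> j = n then if l = 0 then 1 else \<xi> j else 0)"
  unfolding tangent_full_def
proof
  fix C :: "nat \<Rightarrow> nat \<Rightarrow> nat \<Rightarrow> complex"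
  let ?B = "\<lambda>l i j. if j = i \<or> j = n then if l = 0 then 1 else \<xi> j else 0 :: complex"
  let ?L = "\<lambda>l j. if l = (0 :: nat) then 1 else \<xi> j"
  \<comment> \<open>Two distinct forms are a basis of the linear forms: \<open>sol p q c\<close> is
    the coordinate of \<open>c\<close> at the form with index \<open>p\<close>, and the rest is that
    at \<open>q\<close>.\<close>
  define sol where "sol p q c = (c 1 - c 0 * \<xi> q) / (\<xi> p - \<xi> q)" for p q and c :: "nat \<Rightarrow> complex"
  have sol: "sol p q c * ?L l p + (c 0 - sol p q c) * ?L l q = c l"
    if "p \<le> n" "q \<le> n" "p \<noteq> q" "l < 2" for p q c l
  proof -
    have nz: "\<xi> p - \<xi> q \<noteq> 0" using inj that by (auto simp: inj_on_def)
    consider "l = 0" | "l = 1" using \<open>l < 2\<close> by linarith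
    then show ?thesis
    proof cases
      case 2
      have "sol p q c * \<xi> p + (c 0 - sol p q c) * \<xi> q = sol p q c * (\<xi> p - \<xi> q) + c 0 * \<xi> q"
        by (simp add: algebra_simps)
      then show ?thesis using 2 nz by (simp add: sol_def)
    qed simp
  qed
  \<comment> \<open>Diagonal entries are split between the forms \<open>j\<close> and
    \<open>n\<close>, which fixes row \<open>n\<close> of \<open>d\<close>. What remains off the
    diagonal, \<open>h i j\<close>, is split between \<open>j\<close> (taken by \<open>e\<close>)
    and \<open>i\<close> (taken by \<open>d\<close>). The last column sees only the row sums of
    \<open>e\<close>; the diagonal of \<open>e\<close> adjusts them to \<open>t\<close>.\<close>
  define g where "g j = sol j n (\<lambda>l. C l j j)" for j
  define f where "f j = C 0 j j - g j" for j
  define h where "h i j l = C l i j - ?L l n * f j" for i j l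
  define t where "t i = sol n i (\<lambda>l. C l i n)" for i
  define e where "e i j = (if i = j then t i - (\<Sum>x\<in>{..<n} - {i}. sol x i (h i x)) else sol j i (h i j))" for i j
  define d where "d i j = (if j = n then (if i = n then 0 else C 0 i n - t i) else if i = n then f j
    else if i = j then g j - e j j else h i j 0 - e i j)" for i j
  show "\<exists>e d. \<forall>l<2. \<forall>i<n. \<forall>j<Suc n. (\<Sum>x<n. e i x * ?B l x j) + (\<Sum>z<Suc n. ?B l i z * d z j) = C l i j"
  proof (rule exI[of _ e], rule exI[of _ d], intro allI impI)
    fix l i j :: nat assume lij: "l < 2" "i < n" "j < Suc n"
    have R: "(\<Sum>z<Suc n. ?B l i z * d z j) = ?L l i * d i j + ?L l n * d n j"
    proof -
      have "(\<Sum>z<n. ?B l i z * d z j) = (\<Sum>z<n. (if z = i then ?L l i else 0) * d z j)"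
        by (intro sum.cong) auto
      then show ?thesis using lij by (simp add: sum_delta_lessThan)
    qed
    show "(\<Sum>x<n. e i x * ?B l x j) + (\<Sum>z<Suc n. ?B l i z * d z j) = C l i j"
    proof (cases "j = n")
      case True
      have "(\<Sum>x<n. e i x) = e i i + (\<Sum>x\<in>{..<n} - {i}. e i x)"
        using lij by (intro sum.remove) auto
      also have "(\<Sum>x\<in>{..<n} - {i}. e i x) = (\<Sum>x\<in>{..<n} - {i}. sol x i (h i x))"
        by (intro sum.cong) (auto simp: e_def)
      finally have "(\<Sum>x<n. e i x) = t i" by (simp add: e_def)
      then have L: "(\<Sum>x<n. e i x * ?B l x j) = t i * ?L l n"
        using True by (simp flip: sum_distrib_right)
      have "t i * ?L l n + (C 0 i n - t i) * ?L l i = C l i n"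
        using sol[of n i l "\<lambda>l. C l i n"] lij by (simp add: t_def)
      then show ?thesis using lij True unfolding L R by (simp add: d_def mult.commute)
    next
      case False
      then have j: "j < n" using lij by simp
      have "(\<Sum>x<n. e i x * ?B l x j) = (\<Sum>x<n. e i x * (if x = j then ?L l j else 0))"
        using False by (intro sum.cong) auto
      then have L: "(\<Sum>x<n. e i x * ?B l x j) = e i j * ?L l j"
        using j by (simp add: sum_delta_lessThan)
      show ?thesis
      proof (cases "i = j")
        case True
        have "g j * ?L l j + f j * ?L l n = C l j j"
          using sol[of j n l "\<lambda>l. C l j j"] lij j by (simp add: g_def f_def)
        then show ?thesis unfolding L R using True False
          by (cases "l = 0") (simp_all add: d_def algebra_simps)
      next
        case F: False
        have "e i j * ?L l j + (h i j 0 - e i j) * ?L l i = h i j l"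
          using sol[of j i l "h i j"] lij j F by (simp add: e_def)
        then show ?thesis unfolding L R using F False j lij by (simp add: d_def h_def algebra_simps)
      qed
    qed
  qed
qed

section \<open>Square bond pencils\<close>

text \<open>The linear form \<open>(1 + \<tau> \<rho>) v\<^sub>0 - \<rho> v\<^sub>1\<close> takes the value \<open>1\<close> at \<open>(1, \<tau>)\<close> and the value
  \<open>z - \<rho>\<close> at \<open>(z, z \<tau> + 1)\<close>.\<close>

definition root_form :: "complex \<Rightarrow> nat \<Rightarrow> complex \<Rightarrow> complex" where
  "root_form \<tau> l \<rho> = (if l = 0 then 1 + \<tau> * \<rho> else - \<rho>)"

text \<open>Generic square pencils are diagonalizable. At the diagonal pencil with the distinct
  roots 0, ..., m - 1, entry (i, j) off the diagonal moves along two independent forms, and a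
  diagonal entry moves by scaling and by shifting its root.\<close>

lemma diagonal_pencils_dense:
  "tensor_space 2 m m \<subseteq>
    zcl {tens m m (\<lambda>l i j. \<Sum>k<m. P i k * root_form \<tau> l (\<rho> k) * Q k j) | P \<rho> Q. True}"
    (is "_ \<subseteq> zcl ?S")
proof (rule affine_space_subset_zcl_if_tangent)
  let ?I = "\<lambda>i j :: nat. if i = j then 1 else 0 :: complex"
  show "?S \<subseteq> tensor_space 2 m m" by auto
  fix z :: "nat \<times> nat \<times> nat \<Rightarrow> complex"
  \<comment> \<open>The value of the tangent vector at (1, \<tau>), where every root form is 1; off
    the diagonal it has to equal \<open>a i j + b i j\<close>.\<close>
  define s where "s i j = z (0, i, j) + \<tau> * z (1, i, j)" for i j
  define a where "a i j = (if i = j then s i i else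
    (- z (1, i, j) - of_nat i * s i j) / (of_nat j - of_nat i))" for i j
  define b where "b i j = (if i = j then 0 else s i j - a i j)" for i j
  define r where "r i = - z (1, i, i) - a i i * of_nat i" for i
  let ?\<gamma> = "\<lambda>t. tens m m (\<lambda>l i j. \<Sum>k<m. (?I i k + t * a i k)
      * root_form \<tau> l (of_nat k + t * r k) * (?I k j + t * b k j))"
  show "\<exists>\<gamma>. (\<forall>t. \<gamma> t \<in> ?S) \<and>
      \<gamma> 0 = tens m m (\<lambda>l i j. \<Sum>k<m. ?I i k * root_form \<tau> l (of_nat k) * ?I k j) \<and>
      (\<forall>q\<in>tensor_index 2 m m. ((\<lambda>t. \<gamma> t q) has_field_derivative z q) (at 0))"
  proof (intro exI[of _ ?\<gamma>] conjI ballI allI)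
    fix t
    show "?\<gamma> t \<in> ?S"
      unfolding mem_Collect_eq
      by (rule exI[of _ "\<lambda>i k. ?I i k + t * a i k"], rule exI[of _ "\<lambda>k. of_nat k + t * r k"],
          rule exI[of _ "\<lambda>k j. ?I k j + t * b k j"]) simp
  next
    fix q assume "q \<in> tensor_index 2 m m"
    then obtain l i j where q: "q = (l, i, j)" "l < 2" "i < m" "j < m" by auto
    let ?L = "\<lambda>k. root_form \<tau> l (of_nat k)" and ?c = "if l = 0 then \<tau> else - 1"
    have aff: "root_form \<tau> l (of_nat k + t * r k) = ?L k + t * r k * ?c" for k t
      by (simp add: root_form_def algebra_simps)
    have "((\<lambda>t. \<Sum>k<m. (?I i k + t * a i k) * (?L k + t * r k * ?c) * (?I k j + t * b k j))
      has_field_derivative (\<Sum>k<m. a i k * ?L k * ?I k j + ?I i k * (r k * ?c) * ?I k j + ?I i k * ?L k * b k j)) (at 0)"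
      by (intro DERIV_sum) (auto intro!: derivative_eq_intros simp: algebra_simps)
    moreover have "(\<Sum>k<m. a i k * ?L k * ?I k j + ?I i k * (r k * ?c) * ?I k j + ?I i k * ?L k * b k j)
      = a i j * ?L j + (if i = j then r i * ?c else 0) + ?L i * b i j"
    proof -
      have 1: "(\<Sum>k<m. a i k * ?L k * ?I k j) = a i j * ?L j"
        using q by (simp add: sum_delta_lessThan)
      have 2: "(\<Sum>k<m. ?I i k * (r k * ?c) * ?I k j) = (if i = j then r i * ?c else 0)"
      proof -
        have "(\<Sum>k<m. ?I i k * (r k * ?c) * ?I k j) = ?I i j * (r j * ?c)"
          using q by (subst sum_delta_lessThan(1)) simp
        then show ?thesis by simp
      qed
      have 3: "(\<Sum>k<m. ?I i k * ?L k * b k j) = ?L i * b i j"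
        using q sum_delta_lessThan(4)[where f = "\<lambda>k. ?L k * b k j" and a = i and c = 1 and n = m]
        by (simp add: mult.assoc)
      show ?thesis unfolding sum.distrib 1 2 3 ..
    qed
    moreover have "\<dots> = z q"
    proof (cases "i = j")
      case True
      consider "l = 0" | "l = 1" using q(2) by linarith
      then show ?thesis
        using True by cases (simp_all add: q(1) a_def b_def r_def s_def root_form_def algebra_simps)
    next
      case False
      then have nz: "of_nat j - of_nat i \<noteq> (0 :: complex)" by simp
      have "a i j * (of_nat j - of_nat i) = - z (1, i, j) - of_nat i * s i j"
        using False nz by (simp add: a_def)
      then have e1: "a i j * of_nat j + b i j * of_nat i = - z (1, i, j)"
        using False by (simp add: b_def algebra_simps)
      have e0: "a i j + b i j = z (0, i, j) + \<tau> * z (1, i, j)"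
        using False by (simp add: b_def s_def)
      consider "l = 0" | "l = 1" using q(2) by linarith
      then show ?thesis
      proof cases
        case 1
        have "a i j * (1 + \<tau> * of_nat j) + (1 + \<tau> * of_nat i) * b i j
          = (a i j + b i j) + \<tau> * (a i j * of_nat j + b i j * of_nat i)"
          by (simp add: algebra_simps)
        then show ?thesis using 1 False e0 e1 by (simp add: q(1) root_form_def)
      next
        case 2
        have "a i j * - of_nat j + - of_nat i * b i j = - (a i j * of_nat j + b i j * of_nat i)"
          by (simp add: algebra_simps)
        then show ?thesis using 2 False e1 by (simp add: q(1) root_form_def)
      qed
    qed
    ultimately show "((\<lambda>t. ?\<gamma> t q) has_field_derivative z q) (at 0)"
      using q by (simp add: tens_apply aff)
  qed simp
qed

section \<open>Pencils with \<open>m\<close> groups of \<open>s\<close> rows, each group divisible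
  by one linear form\<close>

definition scaled_rows :: "nat \<Rightarrow> nat \<Rightarrow> complex \<Rightarrow> (nat \<Rightarrow> complex) \<Rightarrow> (nat \<Rightarrow> nat \<Rightarrow> nat \<Rightarrow> complex) \<Rightarrow>
  nat \<Rightarrow> nat \<Rightarrow> nat \<Rightarrow> complex" where
  "scaled_rows m s \<tau> \<rho> M l u j = (if u < m * s then root_form \<tau> l (\<rho> (u div s)) * M 0 u j else M l u j)"

text \<open>The left factor \<open>G\<close> is arbitrary: being equivalent to a pencil with
  divisible rows is what survives of a network with square bond pencil.\<close>

definition row_family :: "nat \<Rightarrow> nat \<Rightarrow> nat \<Rightarrow> nat \<Rightarrow> complex \<Rightarrow> (nat \<times> nat \<times> nat \<Rightarrow> complex) set" where
  "row_family n1 n2 m s \<tau> =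
     {tens n1 n2 (\<lambda>l i j. \<Sum>u<n1. G i u * scaled_rows m s \<tau> \<rho> M l u j) | G \<rho> M. True}"

definition diag_family :: "nat \<Rightarrow> nat \<Rightarrow> nat \<Rightarrow> nat \<Rightarrow> complex \<Rightarrow> (nat \<times> nat \<times> nat \<Rightarrow> complex) set" where
  "diag_family n1 n2 m k \<tau> = {tens n1 n2 (\<lambda>l i j. \<Sum>x<m. \<Sum>y<k. Z (i, x, y) * root_form \<tau> l (\<rho> x) * X2 j y x) | Z \<rho> X2. True}"

text \<open>With \<open>X1\<close> and \<open>X2\<close> fixed the pencil is linear in
  \<open>B\<close>, so \<open>B\<close> may be taken diagonalizable; the diagonalizing matrices are
  absorbed into \<open>X1\<close> and \<open>X2\<close>.\<close>

lemma tri_mem_zcl_diag_family: "tri m k m n1 n2 B X1 X2 \<in> zcl (diag_family n1 n2 m k \<tau>)"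
proof -
  let ?F = "\<lambda>b. tri m k m n1 n2 (\<lambda>l x z. b (l, x, z)) X1 X2"
  have "tens m m B \<in> zcl {tens m m (\<lambda>l i j. \<Sum>k<m. P i k * root_form \<tau> l (\<rho> k) * Q k j) | P \<rho> Q. True}"
    using diagonal_pencils_dense by (rule subsetD) simp
  then have "?F (tens m m B) \<in> zcl (diag_family n1 n2 m k \<tau>)"
  proof (rule zcl_image_subset[of _ _ ?F])
    show "(\<lambda>b. ?F b i) \<in> poly_functions" for i
      unfolding tri_def poly_functions_eq by (intro poly_on_tens poly_on_intros poly_on.coord) auto
  next
    fix x assume "x \<in> {tens m m (\<lambda>l i j. \<Sum>k<m. P i k * root_form \<tau> l (\<rho> k) * Q k j) | P \<rho> Q. True}"
    then obtain P \<rho> Q where x: "x = tens m m (\<lambda>l i j. \<Sum>k<m. P i k * root_form \<tau> l (\<rho> k) * Q k j)"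
      by blast
    let ?Z = "\<lambda>(i, w, y). \<Sum>x<m. X1 i x y * P x w" and ?X = "\<lambda>j y w. \<Sum>z<m. Q w z * X2 j y z"
    have "?F x = tens n1 n2 (\<lambda>l i j. \<Sum>w<m. \<Sum>y<k. ?Z (i, w, y) * root_form \<tau> l (\<rho> w) * ?X j y w)"
      unfolding tri_def
    proof (rule tens_cong)
      fix l i j :: nat assume l: "l < 2"
      have "(\<Sum>x'<m. \<Sum>y<k. \<Sum>z<m. x (l, x', z) * X1 i x' y * X2 j y z)
        = (\<Sum>x'<m. \<Sum>y<k. \<Sum>z<m. \<Sum>w<m. X1 i x' y * P x' w * root_form \<tau> l (\<rho> w) * (Q w z * X2 j y z))"
        using l by (intro sum.cong refl) (simp add: x tens_apply sum_distrib_left sum_distrib_right mult_ac)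
      also have "\<dots> = (\<Sum>w<m. \<Sum>y<k. \<Sum>x'<m. \<Sum>z<m. X1 i x' y * P x' w * root_form \<tau> l (\<rho> w) * (Q w z * X2 j y z))"
      proof -
        have "(\<Sum>x'<m. \<Sum>y<k. \<Sum>z<m. \<Sum>w<m. f x' y z w) = (\<Sum>w<m. \<Sum>y<k. \<Sum>x'<m. \<Sum>z<m. f x' y z w)"
          for f :: "nat \<Rightarrow> nat \<Rightarrow> nat \<Rightarrow> nat \<Rightarrow> complex"
        proof -
          have "(\<Sum>x'<m. \<Sum>y<k. \<Sum>z<m. \<Sum>w<m. f x' y z w) = (\<Sum>x'<m. \<Sum>y<k. \<Sum>w<m. \<Sum>z<m. f x' y z w)"
            by (intro sum.cong refl sum.swap)
          also have "\<dots> = (\<Sum>x'<m. \<Sum>w<m. \<Sum>y<k. \<Sum>z<m. f x' y z w)"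
            by (intro sum.cong refl sum.swap)
          also have "\<dots> = (\<Sum>w<m. \<Sum>x'<m. \<Sum>y<k. \<Sum>z<m. f x' y z w)"
            by (rule sum.swap)
          also have "\<dots> = (\<Sum>w<m. \<Sum>y<k. \<Sum>x'<m. \<Sum>z<m. f x' y z w)"
            by (intro sum.cong refl sum.swap)
          finally show ?thesis .
        qed
        then show ?thesis .
      qed
      also have "\<dots> = (\<Sum>w<m. \<Sum>y<k. ?Z (i, w, y) * root_form \<tau> l (\<rho> w) * ?X j y w)"
        by (simp add: sum_distrib_left sum_distrib_right mult_ac)
      finally show "(\<Sum>x'<m. \<Sum>y<k. \<Sum>z<m. x (l, x', z) * X1 i x' y * X2 j y z)
        = (\<Sum>w<m. \<Sum>y<k. ?Z (i, w, y) * root_form \<tau> l (\<rho> w) * ?X j y w)" .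
    qed
    then have "?F x \<in> diag_family n1 n2 m k \<tau>"
      unfolding diag_family_def mem_Collect_eq
      by (intro exI[of _ ?Z] exI[of _ \<rho>] exI[of _ ?X] conjI TrueI)
    then show "?F x \<in> zcl (diag_family n1 n2 m k \<tau>)"
      using zcl_superset by blast
  qed
  moreover have "?F (tens m m B) = tri m k m n1 n2 B X1 X2"
    unfolding tri_def by (intro tens_cong sum.cong) (simp_all add: tens_apply)
  ultimately show ?thesis by simp
qed

text \<open>At \<open>G = id\<close> and the matrix \<open>base_rows\<close>, a row \<open>u < m s\<close> of \<open>Z\<close> can be moved freely off its own
  block \<open>c = u div s\<close> by adding multiples of the other rows, as \<open>base_rows\<close> without the rows and
  columns of block \<open>c\<close> is invertible. For the last rows this is because every maximal minor of
  \<open>(id | (1, \<dots>, 1)\<^sup>t)\<close> is nonzero.\<close>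

definition base_rows :: "nat \<Rightarrow> nat \<Rightarrow> nat \<Rightarrow> nat \<Rightarrow> nat \<Rightarrow> nat \<Rightarrow> complex" where
  "base_rows m s k1 u x y =
    (if u < m * s then if u = x * s + y \<and> y < s then 1 else 0
     else if s \<le> y \<and> (u - m * s) mod k1 = y - s then
       (if (u - m * s) div k1 = x then 1 else 0) + (if x = m - 1 then 1 else 0) else 0)"

lemma base_rows_lower:
  "y' < k1 \<Longrightarrow> base_rows m s k1 (m * s + (x' * k1 + y')) x y =
    (if s \<le> y \<and> y' = y - s then (if x' = x then 1 else 0) + (if x = m - 1 then 1 else 0) else 0)"
proof -
  assume "y' < k1"
  then have "(x' * k1 + y') div k1 = x'" "(x' * k1 + y') mod k1 = y'" by simp_all
  then show ?thesis
    by (simp only: base_rows_def not_add_less1 if_False diff_add_inverse)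
qed

lemma base_rows_combination:
  fixes f :: "nat \<Rightarrow> complex"
  assumes k1: "k1 > 0" and x: "x < m" and y: "y < s + k1"
  shows "(\<Sum>u<m * s + (m - 1) * k1. f u * base_rows m s k1 u x y) =
    (if y < s then f (x * s + y)
     else (if x < m - 1 then f (m * s + x * k1 + (y - s)) else 0)
       + (if x = m - 1 then \<Sum>x'<m - 1. f (m * s + x' * k1 + (y - s)) else 0))"
proof -
  have top: "(\<Sum>u<m * s. f u * base_rows m s k1 u x y) = (if y < s then f (x * s + y) else 0)"
  proof -
    have "x * s + y < m * s" if "y < s"
      using that x by (metis add.commute mult_le_mono1 less_le_trans nat_add_left_cancel_less Suc_leI mult_Suc)
    moreover have "(\<Sum>u<m * s. f u * base_rows m s k1 u x y)
      = (\<Sum>u<m * s. f u * (if u = x * s + y then if y < s then 1 else 0 else 0))"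
      by (intro sum.cong) (auto simp: base_rows_def)
    ultimately show ?thesis by (simp add: sum_delta_lessThan)
  qed
  have bot: "(\<Sum>u<(m - 1) * k1. f (m * s + u) * base_rows m s k1 (m * s + u) x y) =
    (if s \<le> y then (if x < m - 1 then f (m * s + x * k1 + (y - s)) else 0)
       + (if x = m - 1 then \<Sum>x'<m - 1. f (m * s + x' * k1 + (y - s)) else 0) else 0)"
  proof (cases "s \<le> y")
    case True
    have inner: "(\<Sum>y'<k1. f (m * s + (x' * k1 + y')) * base_rows m s k1 (m * s + (x' * k1 + y')) x y)
      = f (m * s + x' * k1 + (y - s)) * ((if x' = x then 1 else 0) + (if x = m - 1 then 1 else 0))" for x'
    proof -
      have "(\<Sum>y'<k1. f (m * s + (x' * k1 + y')) * base_rows m s k1 (m * s + (x' * k1 + y')) x y)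
        = (\<Sum>y'<k1. f (m * s + (x' * k1 + y')) * (if y' = y - s then
           (if x' = x then 1 else 0) + (if x = m - 1 then 1 else 0) else 0))"
        using True by (intro sum.cong refl) (simp only: base_rows_lower lessThan_iff simp_thms)
      then show ?thesis using y True by (simp add: sum_delta_lessThan add.assoc)
    qed
    have "(\<Sum>u<(m - 1) * k1. f (m * s + u) * base_rows m s k1 (m * s + u) x y)
      = (\<Sum>x'<m - 1. f (m * s + x' * k1 + (y - s)) * (if x' = x then 1 else 0))
        + (\<Sum>x'<m - 1. f (m * s + x' * k1 + (y - s)) * (if x = m - 1 then 1 else 0))"
      unfolding sum_div_mod inner by (simp add: distrib_left sum.distrib)
    then show ?thesis using True by (simp add: sum_delta_lessThan)
  next
    case False
    then show ?thesis by (simp add: base_rows_def)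
  qed
  show ?thesis unfolding sum_lessThan_add top bot by auto
qed

lemma restrict_mem_zcl_block_rows:
  fixes Z :: "nat \<times> nat \<times> nat \<Rightarrow> complex"
  assumes m: "m \<ge> 1" and s: "s > 0" and Z: "Z \<in> affine_space ({..<m * s + (m - 1) * k1} \<times> {..<m} \<times> {..<s + k1})"
  shows "Z \<in> zcl {restrict_to ({..<m * s + (m - 1) * k1} \<times> {..<m} \<times> {..<s + k1})
      (\<lambda>(i, x, y). \<Sum>u<m * s + (m - 1) * k1. G i u * W u x y) | G W.
      \<forall>u<m * s. \<forall>x. x \<noteq> u div s \<longrightarrow> W u x = (\<lambda>y. 0)}" (is "_ \<in> zcl ?S")
proof -
  let ?n = "m * s + (m - 1) * k1"
  let ?K = "{..<?n} \<times> {..<m} \<times> {..<s + k1}"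
  let ?I = "\<lambda>i u :: nat. if i = u then 1 else 0 :: complex"
  have "affine_space ?K \<subseteq> zcl ?S"
  proof (rule affine_space_subset_zcl_if_tangent)
    show "?S \<subseteq> affine_space ?K" by auto
    fix z :: "nat \<times> nat \<times> nat \<Rightarrow> complex"
    define c where "c i = i div s" for i
    \<comment> \<open>The last block column \<open>x = m - 1\<close> sees the sum of the lower rows.
      The coefficient at index \<open>c i\<close>, whose own column is not prescribed, is used to
      give this sum its value.\<close>
    define corr where "corr i y' = z (i, m - 1, s + y') - (\<Sum>x\<in>{..<m - 1} - {c i}. z (i, x, s + y'))" for i y'
    define A where "A i u = (if i < m * s then
        if u < m * s then (if u div s = c i then 0 else z (i, u div s, u mod s))
        else let x = (u - m * s) div k1; y' = (u - m * s) mod k1 in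
          if x = c i then corr i y' else z (i, x, s + y') else 0)" for i u
    let ?B = "base_rows m s k1"
    \<comment> \<open>\<open>W\<close> absorbs what \<open>A\<close> leaves over. For a divisible
      row \<open>A\<close> leaves nothing off its own block, so the support condition on
      \<open>W\<close> is kept along the curve.\<close>
    define V where "V i x y = (if i < m * s \<and> x \<noteq> c i then 0 else z (i, x, y) - (\<Sum>u<?n. A i u * ?B u x y))" for i x y
    let ?\<gamma> = "\<lambda>t. restrict_to ?K (\<lambda>(i, x, y). \<Sum>u<?n. (?I i u + t * A i u) * (?B u x y + t * V u x y))"
    have block: "u div s < m" if "u < m * s" for u
      using that s by (simp add: less_mult_imp_div_less)
    have B0: "?B u x y = 0" if "u < m * s" "x \<noteq> u div s" for u x y
      using that by (auto simp: base_rows_def)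
    have key: "(\<Sum>u<?n. A i u * ?B u x y) = z (i, x, y)"
      if i: "i < m * s" and x: "x < m" "x \<noteq> c i" and y: "y < s + k1" for i x y
    proof (cases "y < s")
      case True
      have xs: "x * s + y < m * s"
        using True x(1) by (metis add.commute mult_le_mono1 less_le_trans nat_add_left_cancel_less Suc_leI mult_Suc)
      show ?thesis
      proof (cases "k1 = 0")
        case k: True
        have "(\<Sum>u<?n. A i u * ?B u x y) = (\<Sum>u<m * s. A i u * (if u = x * s + y then 1 else 0))"
          using k True by (intro sum.cong) (auto simp: base_rows_def)
        then show ?thesis using True xs i x by (simp add: sum_delta_lessThan A_def)
      next
        case False
        then have k1: "k1 > 0" by simp
        show ?thesis
          unfolding base_rows_combination[OF k1 x(1) y] using True xs i x by (simp add: A_def)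
      qed
    next
      case False
      then have k1: "k1 > 0" and ys: "y - s < k1" using y by auto
      have A: "A i (m * s + x' * k1 + (y - s)) = (if x' = c i then corr i (y - s) else z (i, x', y))" for x'
      proof -
        have d: "(x' * k1 + (y - s)) div k1 = x'" "(x' * k1 + (y - s)) mod k1 = y - s"
          using ys by simp_all
        have "s + (y - s) = y" using False by simp
        then show ?thesis
          by (simp only: A_def add.assoc not_add_less1 if_False if_True diff_add_inverse Let_def d i)
      qed
      show ?thesis
      proof (cases "x < m - 1")
        case True
        then show ?thesis
          unfolding base_rows_combination[OF k1 x(1) y] A using False x by simp
      next
        case xm: False
        then have xm: "x = m - 1" using x by simp
        have ci: "c i < m - 1" using block[OF i] x(2) xm by (simp add: c_def)
        have "(\<Sum>x'<m - 1. A i (m * s + x' * k1 + (y - s)))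
          = corr i (y - s) + (\<Sum>x'\<in>{..<m - 1} - {c i}. A i (m * s + x' * k1 + (y - s)))"
          using ci by (subst sum.remove[of _ "c i"]) (auto simp: A)
        also have "(\<Sum>x'\<in>{..<m - 1} - {c i}. A i (m * s + x' * k1 + (y - s)))
          = (\<Sum>x'\<in>{..<m - 1} - {c i}. z (i, x', y))"
          by (intro sum.cong) (auto simp: A)
        finally have "(\<Sum>x'<m - 1. A i (m * s + x' * k1 + (y - s))) = z (i, x, y)"
          using False xm by (simp add: corr_def)
        then show ?thesis
          unfolding base_rows_combination[OF k1 x(1) y] using False xm by simp
      qed
    qed
    show "\<exists>\<gamma>. (\<forall>t. \<gamma> t \<in> ?S) \<and> \<gamma> 0 = restrict_to ?K (\<lambda>(i, x, y). \<Sum>u<?n. ?I i u * ?B u x y) \<and>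
      (\<forall>q\<in>?K. ((\<lambda>t. \<gamma> t q) has_field_derivative z q) (at 0))"
    proof (intro exI[of _ ?\<gamma>] conjI ballI allI)
      fix t
      have "\<forall>u<m * s. \<forall>x. x \<noteq> u div s \<longrightarrow> (\<lambda>y. ?B u x y + t * V u x y) = (\<lambda>y. 0)"
        by (auto simp: B0 V_def c_def)
      then show "?\<gamma> t \<in> ?S"
        unfolding mem_Collect_eq
        by (intro exI[of _ "\<lambda>i u. ?I i u + t * A i u"] exI[of _ "\<lambda>u x y. ?B u x y + t * V u x y"] conjI refl)
    next
      fix q assume "q \<in> ?K"
      then obtain i x y where q: "q = (i, x, y)" "i < ?n" "x < m" "y < s + k1" by auto
      have "((\<lambda>t. \<Sum>u<?n. (?I i u + t * A i u) * (?B u x y + t * V u x y)) has_field_derivative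
        (\<Sum>u<?n. A i u * ?B u x y + ?I i u * V u x y)) (at 0)"
        by (intro DERIV_sum) (auto intro!: derivative_eq_intros)
      moreover have "(\<Sum>u<?n. A i u * ?B u x y + ?I i u * V u x y) = (\<Sum>u<?n. A i u * ?B u x y) + V i x y"
        using q by (simp add: sum.distrib sum_delta_lessThan)
      moreover have "\<dots> = z q"
        using q key[of i x y] by (auto simp: V_def)
      ultimately show "((\<lambda>t. ?\<gamma> t q) has_field_derivative z q) (at 0)"
        using q by (simp add: restrict_to_def)
    qed (simp add: fun_eq_iff)
  qed
  then show ?thesis using Z by blast
qed

text \<open>For fixed \<rho> and \<open>X2\<close> the pencil is linear in \<open>Z\<close>. By
  \<open>restrict_mem_zcl_block_rows\<close> the rows may be assumed supported on single blocks, and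
  such a row meets only the form of its block.\<close>

lemma diag_family_subset_zcl_row_family:
  assumes m: "m \<ge> 1" and s: "s > 0" and n1: "n1 = m * s + (m - 1) * k1"
  shows "diag_family n1 n2 m (s + k1) \<tau> \<subseteq> zcl (row_family n1 n2 m s \<tau>)"
proof
  fix T assume "T \<in> diag_family n1 n2 m (s + k1) \<tau>"
  then obtain Z \<rho> X2 where T: "T = tens n1 n2 (\<lambda>l i j. \<Sum>x<m. \<Sum>y<s + k1. Z (i, x, y) * root_form \<tau> l (\<rho> x) * X2 j y x)"
    unfolding diag_family_def by blast
  let ?F = "\<lambda>Z. tens n1 n2 (\<lambda>l i j. \<Sum>x<m. \<Sum>y<s + k1. Z (i, x, y) * root_form \<tau> l (\<rho> x) * X2 j y x)"
  let ?K = "{..<n1} \<times> {..<m} \<times> {..<s + k1}"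
  let ?S = "{restrict_to ?K (\<lambda>(i, x, y). \<Sum>u<n1. G i u * W u x y) | G W.
      \<forall>u<m * s. \<forall>x. x \<noteq> u div s \<longrightarrow> W u x = (\<lambda>y. 0)}"
  have "restrict_to ?K Z \<in> zcl ?S"
    using restrict_mem_zcl_block_rows[OF m s, of "restrict_to ?K Z" k1] by (simp add: n1)
  then have "?F (restrict_to ?K Z) \<in> zcl (row_family n1 n2 m s \<tau>)"
  proof (rule zcl_image_subset[of _ _ ?F])
    show "(\<lambda>Z. ?F Z i) \<in> poly_functions" for i
      unfolding poly_functions_eq by (intro poly_on_tens poly_on_intros poly_on.coord) auto
  next
    fix Y assume "Y \<in> ?S"
    then obtain G W where Y: "Y = restrict_to ?K (\<lambda>(i, x, y). \<Sum>u<n1. G i u * W u x y)"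
      and W: "\<And>u x. u < m * s \<Longrightarrow> x \<noteq> u div s \<Longrightarrow> W u x = (\<lambda>y. 0)" by blast
    define M where "M l u j = (if u < m * s then \<Sum>y<s + k1. W u (u div s) y * X2 j y (u div s)
      else \<Sum>x<m. \<Sum>y<s + k1. W u x y * root_form \<tau> l (\<rho> x) * X2 j y x)" for l u j
    have rows: "(\<Sum>x<m. \<Sum>y<s + k1. W u x y * root_form \<tau> l (\<rho> x) * X2 j y x) = scaled_rows m s \<tau> \<rho> M l u j"
      for l u j
    proof (cases "u < m * s")
      case True
      have c: "u div s < m" using True s by (simp add: less_mult_imp_div_less)
      have "(\<Sum>x<m. \<Sum>y<s + k1. W u x y * root_form \<tau> l (\<rho> x) * X2 j y x)
        = (\<Sum>x\<in>{u div s}. \<Sum>y<s + k1. W u x y * root_form \<tau> l (\<rho> x) * X2 j y x)"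
        using c W[OF True] by (intro sum.mono_neutral_right) auto
      then show ?thesis using True by (simp add: scaled_rows_def M_def sum_distrib_left mult_ac)
    qed (simp add: scaled_rows_def M_def)
    have "?F Y = tens n1 n2 (\<lambda>l i j. \<Sum>u<n1. G i u * scaled_rows m s \<tau> \<rho> M l u j)"
    proof (rule tens_cong)
      fix l i j :: nat assume i: "i < n1"
      have "(\<Sum>x<m. \<Sum>y<s + k1. Y (i, x, y) * root_form \<tau> l (\<rho> x) * X2 j y x)
        = (\<Sum>x<m. \<Sum>y<s + k1. \<Sum>u<n1. G i u * (W u x y * root_form \<tau> l (\<rho> x) * X2 j y x))"
        using i by (intro sum.cong refl) (simp add: Y restrict_to_def sum_distrib_right mult.assoc)
      also have "\<dots> = (\<Sum>u<n1. \<Sum>x<m. \<Sum>y<s + k1. G i u * (W u x y * root_form \<tau> l (\<rho> x) * X2 j y x))"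
        by (simp only: sum.swap[of _ "{..<n1}" "{..<s + k1}"] sum.swap[of _ "{..<n1}" "{..<m}"])
      also have "\<dots> = (\<Sum>u<n1. G i u * scaled_rows m s \<tau> \<rho> M l u j)"
        by (simp only: rows[symmetric] sum_distrib_left)
      finally show "(\<Sum>x<m. \<Sum>y<s + k1. Y (i, x, y) * root_form \<tau> l (\<rho> x) * X2 j y x)
        = (\<Sum>u<n1. G i u * scaled_rows m s \<tau> \<rho> M l u j)" .
    qed
    then have "?F Y \<in> row_family n1 n2 m s \<tau>"
      unfolding row_family_def mem_Collect_eq by (intro exI[of _ G] exI[of _ \<rho>] exI[of _ M] conjI TrueI)
    then show "?F Y \<in> zcl (row_family n1 n2 m s \<tau>)" using zcl_superset by blast
  qed
  moreover have "?F (restrict_to ?K Z) = T"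
    unfolding T by (intro tens_cong sum.cong refl) (simp add: restrict_to_def)
  ultimately show "T \<in> zcl (row_family n1 n2 m s \<tau>)" by simp
qed

lemma tri_image_subset_zcl_row_family:
  assumes "m \<ge> 1" "s > 0" "n1 = m * s + (m - 1) * k1"
  shows "tri_image m (s + k1) m n1 n2 \<subseteq> zcl (row_family n1 n2 m s \<tau>)"
  using zcl_least[OF diag_family_subset_zcl_row_family[OF assms, of n2 \<tau>]] tri_mem_zcl_diag_family
  by (fastforce simp: tri_image_def)

section \<open>The normal form\<close>

text \<open>The entries of \<open>normal_form\<close>, slice by slice; \<open>normal_form_eq\<close>
  identifies the two.\<close>

definition nf :: "nat \<Rightarrow> nat \<Rightarrow> (nat \<Rightarrow> complex) \<Rightarrow> (nat \<times> nat \<times> nat \<Rightarrow> complex) \<Rightarrow> nat \<Rightarrow> nat \<Rightarrow> nat \<Rightarrow> complex" where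
  "nf m s \<xi> T2 l u v =
    (if u < m * s then if v = u then if l = 0 then 1 else \<xi> (u div s) else 0
     else if v < m * s then 0 else T2 (l, u - m * s, v - m * s))"

text \<open>Arbitrary matrices instead of invertible ones make this the image of an affine space;
  invertibility is imposed later as an open condition.\<close>

definition normal_family :: "nat \<Rightarrow> nat \<Rightarrow> nat \<Rightarrow> nat \<Rightarrow> (nat \<times> nat \<times> nat \<Rightarrow> complex) set" where
  "normal_family n1 n2 m s =
     {pencil_mult n1 n2 n1 n2 g1 g2 (tens n1 n2 (nf m s \<xi> T2)) | g1 g2 \<xi> T2. True}"

lemma pencil_mult_pencil_mult:
  "pencil_mult n1 n2 a b g1 g2 (pencil_mult a b c d h1 h2 T) =
   pencil_mult n1 n2 c d (\<lambda>i w. \<Sum>u<a. g1 i u * h1 u w) (\<lambda>j w. \<Sum>v<b. g2 j v * h2 v w) T"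
  unfolding pencil_mult_def
proof (rule tens_cong)
  fix l i j :: nat assume l: "l < 2"
  have "(\<Sum>u<a. \<Sum>v<b. g1 i u * tens a b (\<lambda>l i j. \<Sum>u<c. \<Sum>v<d. h1 i u * T (l, u, v) * h2 j v) (l, u, v) * g2 j v)
    = (\<Sum>u<a. \<Sum>v<b. \<Sum>w<c. \<Sum>x<d. (g1 i u * h1 u w) * T (l, w, x) * (g2 j v * h2 v x))"
    using l by (intro sum.cong refl) (simp add: tens_apply sum_distrib_left sum_distrib_right mult_ac)
  also have "\<dots> = (\<Sum>w<c. \<Sum>x<d. \<Sum>u<a. \<Sum>v<b. (g1 i u * h1 u w) * T (l, w, x) * (g2 j v * h2 v x))"
    by (simp only: sum.swap[of _ "{..<c}" "{..<b}"] sum.swap[of _ "{..<c}" "{..<a}"]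
      sum.swap[of _ "{..<d}" "{..<b}"] sum.swap[of _ "{..<d}" "{..<a}"])
  also have "\<dots> = (\<Sum>w<c. \<Sum>x<d. (\<Sum>u<a. g1 i u * h1 u w) * T (l, w, x) * (\<Sum>v<b. g2 j v * h2 v x))"
    by (simp add: sum_distrib_left sum_distrib_right mult_ac)
  finally show "(\<Sum>u<a. \<Sum>v<b. g1 i u * tens a b (\<lambda>l i j. \<Sum>u<c. \<Sum>v<d. h1 i u * T (l, u, v) * h2 j v) (l, u, v) * g2 j v)
    = (\<Sum>w<c. \<Sum>x<d. (\<Sum>u<a. g1 i u * h1 u w) * T (l, w, x) * (\<Sum>v<b. g2 j v * h2 v x))" .
qed

lemma pencil_mult_normal_family:
  "T \<in> normal_family n1 n2 m s \<Longrightarrow> pencil_mult n1 n2 n1 n2 g1 g2 T \<in> normal_family n1 n2 m s"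
  unfolding normal_family_def mem_Collect_eq
  by (elim exE conjE) (simp only: pencil_mult_pencil_mult, blast)

text \<open>The product rule for one slice at a diagonal pencil: left factor, pencil and right
  factor contribute one term each.\<close>

lemma pencil_mult_curve:
  fixes i j :: nat and U V F N :: "nat \<Rightarrow> nat \<Rightarrow> complex"
  assumes n: "n1 \<le> n2" "i < n1" "j < n2"
    and nf0: "\<And>u v. u < n1 \<Longrightarrow> v < n2 \<Longrightarrow> F u v = (if v = u then \<mu> u else 0)"
  shows "((\<lambda>t. \<Sum>u<n1. \<Sum>v<n2. ((if i = u then 1 else 0) + t * U i u) * (F u v + t * N u v)
      * ((if j = v then 1 else 0) + t * V j v))
    has_field_derivative (if j < n1 then U i j * \<mu> j else 0) + N i j + \<mu> i * V j i) (at (0 :: complex))"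
proof -
  let ?I = "\<lambda>i u :: nat. if i = u then 1 else 0 :: complex"
  have "((\<lambda>t. \<Sum>u<n1. \<Sum>v<n2. (?I i u + t * U i u) * (F u v + t * N u v) * (?I j v + t * V j v))
    has_field_derivative
      (\<Sum>u<n1. \<Sum>v<n2. U i u * F u v * ?I j v + ?I i u * N u v * ?I j v + ?I i u * F u v * V j v)) (at 0)"
    by (intro DERIV_sum) (auto intro!: derivative_eq_intros simp: algebra_simps)
  moreover have "(\<Sum>u<n1. \<Sum>v<n2. U i u * F u v * ?I j v) = (if j < n1 then U i j * \<mu> j else 0)"
  proof -
    have "(\<Sum>u<n1. \<Sum>v<n2. U i u * F u v * ?I j v) = (\<Sum>u<n1. U i u * F u j)"
      using n by (intro sum.cong refl) (simp add: sum_delta_lessThan)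
    also have "\<dots> = (\<Sum>u<n1. (U i u * \<mu> u) * ?I j u)"
      using n nf0 by (intro sum.cong refl) simp
    finally show ?thesis by (simp add: sum_delta_lessThan)
  qed
  moreover have "(\<Sum>u<n1. \<Sum>v<n2. ?I i u * N u v * ?I j v) = N i j"
  proof -
    have "(\<Sum>u<n1. \<Sum>v<n2. ?I i u * N u v * ?I j v) = (\<Sum>u<n1. ?I i u * N u j)"
      using n by (intro sum.cong refl) (simp add: sum_delta_lessThan)
    then show ?thesis using n by (simp add: sum_delta_lessThan)
  qed
  moreover have "(\<Sum>u<n1. \<Sum>v<n2. ?I i u * F u v * V j v) = \<mu> i * V j i"
  proof -
    have "(\<Sum>u<n1. \<Sum>v<n2. ?I i u * F u v * V j v) = (\<Sum>u<n1. ?I i u * (\<Sum>v<n2. F u v * V j v))"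
      by (simp add: sum_distrib_left mult.assoc)
    also have "\<dots> = (\<Sum>v<n2. F i v * V j v)"
      using n by (simp add: sum_delta_lessThan)
    also have "\<dots> = (\<Sum>v<n2. (if v = i then \<mu> i else 0) * V j v)"
      using n nf0 by (intro sum.cong refl) simp
    finally show ?thesis using n by (simp add: sum_delta_lessThan)
  qed
  ultimately show ?thesis by (simp add: sum.distrib)
qed

text \<open>For fixed \<open>\<rho>\<close> the pencils \<open>scaled_rows\<close> form a linear space, in which the normal forms are
  dense up to equivalence.\<close>

lemma scaled_rows_mem_zcl_normal_family:
  assumes n: "m * s \<le> n1" "n1 \<le> n2" and s: "s > 0"
  shows "tens n1 n2 (scaled_rows m s 0 \<rho> M) \<in> zcl (normal_family n1 n2 m s)"
proof -
  let ?K = "{(l :: nat, u, j). l < 2 \<and> u < n1 \<and> j < n2 \<and> (u < m * s \<longrightarrow> l = 0)}"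
  let ?T = "\<lambda>x. tens n1 n2 (scaled_rows m s 0 \<rho> (\<lambda>l u j. x (l, u, j)))"
  let ?S = "{x \<in> affine_space ?K. ?T x \<in> normal_family n1 n2 m s}"
  let ?I = "\<lambda>i u :: nat. if i = u then 1 else 0 :: complex"
  define \<xi> where "\<xi> i = - \<rho> i" for i
  \<comment> \<open>The base point has \<open>T2 = (v0 + \<eta> v1) (id | 0)\<close> with a root not
    shared by the first \<open>m * s\<close> rows, so that the lower left block can be moved
    freely.\<close>
  obtain \<eta> where \<eta>: "\<eta> \<notin> \<xi> ` {..<m}"
    using ex_new_if_finite[OF infinite_UNIV_char_0, of "\<xi> ` {..<m}"] by blast
  define D0 where "D0 = (\<lambda>(l :: nat, i :: nat, j :: nat). if j = i then if l = 0 then 1 else \<eta> else 0)"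
  define \<mu> where "\<mu> l u = (if l = (0 :: nat) then 1 else if u < m * s then \<xi> (u div s) else \<eta>)" for l u
  have nf0: "nf m s \<xi> D0 l u v = (if v = u then \<mu> l u else 0)" for l u v
    by (auto simp: nf_def D0_def \<mu>_def)
  have "affine_space ?K \<subseteq> zcl ?S"
  proof (rule affine_space_subset_zcl_if_tangent)
    fix z :: "nat \<times> nat \<times> nat \<Rightarrow> complex"
    \<comment> \<open>In the lower left block both slices must be met by \<open>U\<close> times the
      form of column \<open>j\<close> plus \<open>V'\<close> times the form with \<eta>.\<close>
    define V' where "V' j u = (z (1, u, j) - \<xi> (j div s) * z (0, u, j)) / (\<eta> - \<xi> (j div s))" for j u
    define V where "V j u = (if u < m * s then z (0, u, j) else if j < m * s then V' j u else 0)" for j u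
    define U where "U u j = (if m * s \<le> u \<and> j < m * s then z (0, u, j) - V' j u else 0)" for u j
    define D where "D = (\<lambda>(l, i, j). z (l, m * s + i, m * s + j))"
    define N where "N l u v = (if u < m * s \<or> v < m * s then 0 else z (l, u, v))" for l u v
    have nf_t: "nf m s \<xi> (\<lambda>q. D0 q + t * D q) l u v = nf m s \<xi> D0 l u v + t * N l u v" for t l u v
      by (simp add: nf_def N_def D_def)
    let ?P = "\<lambda>t. pencil_mult n1 n2 n1 n2 (\<lambda>i u. ?I i u + t * U i u) (\<lambda>j v. ?I j v + t * V j v)
      (tens n1 n2 (nf m s \<xi> (\<lambda>q. D0 q + t * D q)))"
    let ?\<gamma> = "\<lambda>t. restrict_to ?K (?P t)"
    have P: "?P t (l, i, j) = (\<Sum>u<n1. \<Sum>v<n2. (?I i u + t * U i u) * (nf m s \<xi> D0 l u v + t * N l u v)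
      * (?I j v + t * V j v))" if "l < 2" "i < n1" "j < n2" for t l i j
      using that unfolding pencil_mult_def tens_apply
      by (auto simp: tens_apply nf_t intro!: sum.cong)
    show "\<exists>\<gamma>. (\<forall>t. \<gamma> t \<in> ?S) \<and> \<gamma> 0 = restrict_to ?K (pencil_mult n1 n2 n1 n2 ?I ?I (tens n1 n2 (nf m s \<xi> D0))) \<and>
      (\<forall>q\<in>?K. ((\<lambda>t. \<gamma> t q) has_field_derivative z q) (at 0))"
    proof (intro exI[of _ ?\<gamma>] conjI ballI allI)
      fix t
      \<comment> \<open>As \<open>U\<close> vanishes in the upper rows, these stay divisible by
        their form for every \<open>t\<close>, not only to first order. Hence the curve stays in
        \<open>?S\<close>.\<close>
      have top: "?P t (l, u, j) = (if l = 0 then 1 else \<xi> (u div s)) * (?I j u + t * V j u)"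
        if "l < 2" "u < m * s" "j < n2" for l u j
      proof -
        have u: "u < n1" "u < n2" using that n by auto
        have "?P t (l, u, j) = (\<Sum>u'<n1. ?I u u' * (\<Sum>v<n2. (nf m s \<xi> D0 l u' v + t * N l u' v) * (?I j v + t * V j v)))"
          using that u by (subst P) (auto simp: U_def sum_distrib_left mult.assoc intro!: sum.cong)
        also have "\<dots> = (\<Sum>v<n2. (nf m s \<xi> D0 l u v + t * N l u v) * (?I j v + t * V j v))"
          using u by (simp add: sum_delta_lessThan)
        also have "\<dots> = (\<Sum>v<n2. (if v = u then if l = 0 then 1 else \<xi> (u div s) else 0) * (?I j v + t * V j v))"
          using that by (intro sum.cong refl) (simp add: nf0 N_def \<mu>_def)
        finally show ?thesis using u by (simp only: sum_delta_lessThan) simp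
      qed
      have "?T (?\<gamma> t) = ?P t"
      proof (rule ext)
        fix q :: "nat \<times> nat \<times> nat"
        obtain l u j where q: "q = (l, u, j)" by (rule prod_cases3)
        show "?T (?\<gamma> t) q = ?P t q"
        proof (cases "l < 2 \<and> u < n1 \<and> j < n2")
          case True
          show ?thesis
          proof (cases "u < m * s")
            case u: True
            have "?T (?\<gamma> t) q = root_form 0 l (\<rho> (u div s)) * ?P t (0, u, j)"
              using True u by (simp add: q tens_apply scaled_rows_def restrict_to_def)
            also have "\<dots> = ?P t q"
              using True u by (simp add: q top root_form_def \<xi>_def)
            finally show ?thesis .
          next
            case False
            then show ?thesis using True by (simp add: q tens_apply scaled_rows_def restrict_to_def)
          qed
        qed (auto simp: q tens_apply pencil_mult_def)
      qed
      then have "?T (?\<gamma> t) \<in> normal_family n1 n2 m s"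
        unfolding normal_family_def by blast
      then show "?\<gamma> t \<in> ?S" by simp
    next
      fix q assume "q \<in> ?K"
      then obtain l i j where q: "q = (l, i, j)" "l < 2" "i < n1" "j < n2" "i < m * s \<Longrightarrow> l = 0" by auto
      have "((\<lambda>t. ?P t q) has_field_derivative (if j < n1 then U i j * \<mu> l j else 0) + N l i j + \<mu> l i * V j i) (at 0)"
        using pencil_mult_curve[OF n(2) q(3,4), of "nf m s \<xi> D0 l" "\<mu> l" U "N l" V] q
        by (simp add: P nf0)
      moreover have "(if j < n1 then U i j * \<mu> l j else 0) + N l i j + \<mu> l i * V j i = z q"
      proof (cases "i < m * s")
        case True
        then show ?thesis using q by (simp add: U_def N_def \<mu>_def V_def)
      next
        case i: False
        show ?thesis
        proof (cases "j < m * s")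
          case True
          then have "j div s < m" using s by (simp add: less_mult_imp_div_less)
          then have nz: "\<eta> - \<xi> (j div s) \<noteq> 0" using \<eta> by auto
          then have "V' j i * (\<eta> - \<xi> (j div s)) = z (1, i, j) - \<xi> (j div s) * z (0, i, j)"
            by (simp add: V'_def)
          then have "(z (0, i, j) - V' j i) * \<xi> (j div s) + \<eta> * V' j i = z (1, i, j)"
            by (simp add: algebra_simps)
          moreover have "l = 0 \<or> l = 1" using q(2) by linarith
          ultimately show ?thesis using q i True n
            by (elim disjE) (simp_all add: U_def N_def \<mu>_def V_def)
        next
          case False
          then show ?thesis using q i by (simp add: U_def N_def V_def)
        qed
      qed
      ultimately show "((\<lambda>t. ?\<gamma> t q) has_field_derivative z q) (at 0)"
        using q by (simp add: restrict_to_def)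
    qed simp
  qed auto
  then have "restrict_to ?K (\<lambda>(l, u, j). M l u j) \<in> zcl ?S" using restrict_to_mem by blast
  then have "?T (restrict_to ?K (\<lambda>(l, u, j). M l u j)) \<in> zcl (normal_family n1 n2 m s)"
  proof (rule zcl_image_subset[of _ _ ?T])
    show "(\<lambda>x. ?T x i) \<in> poly_functions" for i
      unfolding poly_functions_eq scaled_rows_def
      by (intro poly_on_tens poly_on_intros poly_on.coord) auto
  qed (use zcl_superset in blast)
  moreover have "?T (restrict_to ?K (\<lambda>(l, u, j). M l u j)) = tens n1 n2 (scaled_rows m s 0 \<rho> M)"
    by (intro tens_cong) (auto simp: scaled_rows_def restrict_to_def)
  ultimately show ?thesis by simp
qed

lemma row_family_subset_zcl_normal_family:
  assumes n: "m * s \<le> n1" "n1 \<le> n2" and s: "s > 0"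
  shows "row_family n1 n2 m s 0 \<subseteq> zcl (normal_family n1 n2 m s)"
proof
  fix T assume "T \<in> row_family n1 n2 m s 0"
  then obtain G \<rho> M where T: "T = tens n1 n2 (\<lambda>l i j. \<Sum>u<n1. G i u * scaled_rows m s 0 \<rho> M l u j)"
    unfolding row_family_def by blast
  let ?I = "\<lambda>i u :: nat. if i = u then 1 else 0 :: complex"
  let ?F = "pencil_mult n1 n2 n1 n2 G ?I"
  have "?F (tens n1 n2 (scaled_rows m s 0 \<rho> M)) \<in> zcl (normal_family n1 n2 m s)"
    by (rule zcl_image_subset[of _ _ ?F, OF scaled_rows_mem_zcl_normal_family[OF assms] poly_pencil_mult])
      (rule zcl_superset[THEN subsetD, OF pencil_mult_normal_family])
  moreover have "?F (tens n1 n2 (scaled_rows m s 0 \<rho> M)) = T"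
    unfolding T pencil_mult_def by (intro tens_cong sum.cong refl) (simp add: tens_apply sum_delta_lessThan)
  ultimately show "T \<in> zcl (normal_family n1 n2 m s)" by simp
qed

lemma poly_on_nf:
  "(\<And>i. i < m \<Longrightarrow> (\<lambda>x. \<xi> x i) \<in> poly_on J) \<Longrightarrow>
   (\<And>l i j. l < 2 \<Longrightarrow> i < p \<Longrightarrow> j < q \<Longrightarrow> (\<lambda>x. T2 x (l, i, j)) \<in> poly_on J) \<Longrightarrow>
   s > 0 \<Longrightarrow> l < 2 \<Longrightarrow> u < m * s + p \<Longrightarrow> v < m * s + q \<Longrightarrow> (\<lambda>x. nf m s (\<xi> x) (T2 x) l u v) \<in> poly_on J"
proof -
  assume *: "\<And>i. i < m \<Longrightarrow> (\<lambda>x. \<xi> x i) \<in> poly_on J"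
    "\<And>l i j. l < 2 \<Longrightarrow> i < p \<Longrightarrow> j < q \<Longrightarrow> (\<lambda>x. T2 x (l, i, j)) \<in> poly_on J"
    "s > 0" "l < 2" "u < m * s + p" "v < m * s + q"
  show ?thesis
  proof (cases "u < m * s")
    case True
    then have "u div s < m" using *(3) by (simp add: less_mult_imp_div_less)
    then show ?thesis using True * by (cases "v = u"; cases "l = 0") (auto simp: nf_def poly_on.const)
  next
    case False
    then show ?thesis using * by (cases "v < m * s") (auto simp: nf_def poly_on.const)
  qed
qed

text \<open>The middle bond splits as \<open>s + k1\<close>: its first \<open>s\<close> positions
  produce the diagonal blocks, the others carry a network for \<open>T2\<close>. The bond pencil of
  that network is the constant matrix (id | (1, ..., 1)^t), called \<open>w\<close>, times the
  diagonal one, so \<open>w\<close> can be absorbed into \<open>Y1\<close>.\<close>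

lemma tens_nf_tri:
  assumes m: "m \<ge> 1" and s: "s > 0" and p_def: "p = (m - 1) * k1"
  shows "tens (m * s + p) (m * s + q)
      (nf m s \<xi> (tri (m - 1) k1 m p q (\<lambda>l x z. if z = x \<or> z = m - 1 then if l = 0 then 1 else \<xi> z else 0) X1 X2))
    \<in> tri_image m (s + k1) m (m * s + p) (m * s + q)"
proof -
  let ?L = "\<lambda>l z. if l = (0 :: nat) then 1 else \<xi> z"
  define B where "B l x z = (if z = x then ?L l x else 0)" for l x z :: nat
  define w where "w x z = (if z = x \<or> z = m - 1 then 1 else 0 :: complex)" for x z :: nat
  define Y1 where "Y1 i x y = (if i < m * s then if y < s \<and> i = x * s + y then 1 else 0
    else if y < s then 0 else \<Sum>x'<m - 1. X1 (i - m * s) x' (y - s) * w x' x)" for i x y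
  define Y2 where "Y2 j y z = (if j < m * s then if y < s \<and> j = z * s + y then 1 else 0
    else if y < s then 0 else X2 (j - m * s) (y - s) z)" for j y z
  let ?T2 = "tri (m - 1) k1 m p q (\<lambda>l x z. if z = x \<or> z = m - 1 then ?L l z else 0) X1 X2"
  have "nf m s \<xi> ?T2 l i j = (\<Sum>x<m. \<Sum>y<s + k1. \<Sum>z<m. B l x z * Y1 i x y * Y2 j y z)"
    if lij: "l < 2" "i < m * s + p" "j < m * s + q" for l i j
  proof -
    have "(\<Sum>x<m. \<Sum>y<s + k1. \<Sum>z<m. B l x z * Y1 i x y * Y2 j y z)
      = (\<Sum>x<m. \<Sum>y<s + k1. ?L l x * Y1 i x y * Y2 j y x)"
    proof (intro sum.cong refl)
      fix x y assume "x \<in> {..<m}"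
      have "(\<Sum>z<m. B l x z * Y1 i x y * Y2 j y z) = (\<Sum>z<m. (if z = x then ?L l x else 0) * (Y1 i x y * Y2 j y z))"
        by (intro sum.cong refl) (simp add: B_def mult.assoc)
      then show "(\<Sum>z<m. B l x z * Y1 i x y * Y2 j y z) = ?L l x * Y1 i x y * Y2 j y x"
        using \<open>x \<in> {..<m}\<close> by (simp only: sum_delta_lessThan) (simp add: mult.assoc)
    qed
    also have "\<dots> = (\<Sum>x<m. \<Sum>y<s. ?L l x * Y1 i x y * Y2 j y x) + (\<Sum>x<m. \<Sum>y<k1. ?L l x * Y1 i x (s + y) * Y2 j (s + y) x)"
      unfolding sum_lessThan_add by (rule sum.distrib)
    also have "(\<Sum>x<m. \<Sum>y<s. ?L l x * Y1 i x y * Y2 j y x) = (if i < m * s \<and> j = i then ?L l (i div s) else 0)"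
    proof -
      have "(\<Sum>x<m. \<Sum>y<s. ?L l x * Y1 i x y * Y2 j y x)
        = (\<Sum>x<m. \<Sum>y<s. if x * s + y = i then if i < m * s \<and> j = i then ?L l (i div s) else 0 else 0)"
        by (intro sum.cong refl) (auto simp: Y1_def Y2_def)
      also have "\<dots> = (\<Sum>u<m * s. if u = i then if i < m * s \<and> j = i then ?L l (i div s) else 0 else 0)"
        by (rule sum_div_mod[symmetric])
      finally show ?thesis by simp
    qed
    also have "(\<Sum>x<m. \<Sum>y<k1. ?L l x * Y1 i x (s + y) * Y2 j (s + y) x)
      = (if i < m * s \<or> j < m * s then 0 else ?T2 (l, i - m * s, j - m * s))"
    proof (cases "i < m * s \<or> j < m * s")
      case True
      then show ?thesis by (auto simp: Y1_def Y2_def)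
    next
      case False
      have "(\<Sum>x<m. \<Sum>y<k1. ?L l x * Y1 i x (s + y) * Y2 j (s + y) x)
        = (\<Sum>z<m. \<Sum>y<k1. \<Sum>x<m - 1. (w x z * ?L l z) * X1 (i - m * s) x y * X2 (j - m * s) y z)"
        using False by (intro sum.cong refl)
          (simp add: Y1_def Y2_def sum_distrib_left sum_distrib_right mult_ac)
      also have "\<dots> = (\<Sum>z<m. \<Sum>x<m - 1. \<Sum>y<k1. (w x z * ?L l z) * X1 (i - m * s) x y * X2 (j - m * s) y z)"
        by (intro sum.cong refl sum.swap)
      also have "\<dots> = (\<Sum>x<m - 1. \<Sum>z<m. \<Sum>y<k1. (w x z * ?L l z) * X1 (i - m * s) x y * X2 (j - m * s) y z)"
        by (rule sum.swap)
      also have "\<dots> = (\<Sum>x<m - 1. \<Sum>y<k1. \<Sum>z<m. (w x z * ?L l z) * X1 (i - m * s) x y * X2 (j - m * s) y z)"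
        by (intro sum.cong refl sum.swap)
      also have "\<dots> = (\<Sum>x<m - 1. \<Sum>y<k1. \<Sum>z<m. (if z = x \<or> z = m - 1 then ?L l z else 0)
          * X1 (i - m * s) x y * X2 (j - m * s) y z)"
        by (intro sum.cong refl) (simp add: w_def)
      also have "\<dots> = ?T2 (l, i - m * s, j - m * s)"
      proof -
        have "i - m * s < p" "j - m * s < q" using lij False by auto
        then show ?thesis unfolding tri_def tens_apply using lij(1) by simp
      qed
      finally show ?thesis using False by simp
    qed
    finally show ?thesis by (auto simp: nf_def)
  qed
  then have "tens (m * s + p) (m * s + q) (nf m s \<xi> ?T2) = tri m (s + k1) m (m * s + p) (m * s + q) B Y1 Y2"
    unfolding tri_def by (intro tens_cong)
  then show ?thesis unfolding tri_image_def by blast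
qed

text \<open>For distinct \<open>\<xi> i\<close> the bond pencil for \<open>T2\<close> in
  \<open>tens_nf_tri\<close> has a dense orbit, so every \<open>T2\<close> is reached; coinciding
  values follow since distinctness is an open condition.\<close>

lemma normal_family_subset_zcl_tri_image:
  assumes m: "m \<ge> 1" and s: "s > 0" and q: "q \<le> m * k1"
    and n1_def: "n1 = m * s + (m - 1) * k1" and n2_def: "n2 = m * s + q"
  shows "normal_family n1 n2 m s \<subseteq> zcl (tri_image m (s + k1) m n1 n2)"
proof -
  let ?p = "(m - 1) * k1"
  have inj: "tens n1 n2 (nf m s \<xi> T2) \<in> zcl (tri_image m (s + k1) m n1 n2)"
    if xi: "inj_on \<xi> {..<m}" and T2: "T2 \<in> tensor_space 2 ?p q" for \<xi> T2
  proof -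
    have eq: "Suc (m - 1) = m" "{..m - 1} = {..<m}" using m by auto
    have "inj_on \<xi> {..m - 1}" using xi unfolding eq .
    from tangent_full_diag_column[OF this]
    have full: "tangent_full (m - 1) m (\<lambda>l x z. if z = x \<or> z = m - 1 then if l = 0 then 1 else \<xi> z else 0)"
      unfolding eq .
    have "T2 \<in> zcl {tri (m - 1) k1 m ?p q (\<lambda>l x z. if z = x \<or> z = m - 1 then if l = 0 then 1 else \<xi> z else 0) X1 X2 | X1 X2. True}"
      using subsetD[OF tri_orbit_dense[OF full le_refl q] T2] .
    then show ?thesis
    proof (rule zcl_image_subset[of _ _ "\<lambda>T2. tens n1 n2 (nf m s \<xi> T2)"])
      show "(\<lambda>T2. tens n1 n2 (nf m s \<xi> T2) i) \<in> poly_functions" for i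
        unfolding poly_functions_eq n1_def n2_def
        by (intro poly_on_tens poly_on_nf[where p = ?p and q = q] poly_on.const poly_on.coord s) auto
    next
      fix x assume "x \<in> {tri (m - 1) k1 m ?p q (\<lambda>l x z. if z = x \<or> z = m - 1 then if l = 0 then 1 else \<xi> z else 0) X1 X2 | X1 X2. True}"
      then obtain X1 X2 where "x = tri (m - 1) k1 m ?p q (\<lambda>l x z. if z = x \<or> z = m - 1 then if l = 0 then 1 else \<xi> z else 0) X1 X2"
        by blast
      then show "tens n1 n2 (nf m s \<xi> x) \<in> zcl (tri_image m (s + k1) m n1 n2)"
        using tens_nf_tri[OF m s refl, of k1 q \<xi> X1 X2] zcl_superset unfolding n1_def n2_def by blast
    qed
  qed
  have any: "tens n1 n2 (nf m s \<xi> T2) \<in> zcl (tri_image m (s + k1) m n1 n2)" for \<xi> T2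
  proof (rule zclI)
    fix P assume P: "P \<in> poly_functions" "\<And>x. x \<in> tri_image m (s + k1) m n1 n2 \<Longrightarrow> P x = 0"
    let ?R = "restrict_to (tensor_index 2 ?p q) T2"
    have R: "tens n1 n2 (nf m s \<xi> T2) = tens n1 n2 (nf m s \<xi> ?R)" for \<xi>
      by (intro tens_cong) (auto simp: nf_def restrict_to_def n1_def n2_def)
    define h where "h \<xi> = (\<Prod>i<m. \<Prod>j\<in>{..<m} - {i}. (\<xi> i - \<xi> j))" for \<xi> :: "nat \<Rightarrow> complex"
    have "P (tens n1 n2 (nf m s \<xi> ?R)) = 0"
    proof (rule poly_functions_zero_if_generic[of "\<lambda>\<xi>. P (tens n1 n2 (nf m s \<xi> ?R))" h "of_nat"])
      show "(\<lambda>\<xi>. P (tens n1 n2 (nf m s \<xi> ?R))) \<in> poly_functions"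
        unfolding poly_functions_eq
        by (rule poly_functions_subst[of P "\<lambda>\<xi>. tens n1 n2 (nf m s \<xi> ?R)", OF P(1)], unfold n1_def n2_def)
          (intro poly_on_tens poly_on_nf[where p = ?p and q = q] poly_on.const poly_on.coord s; simp)
      show "h \<in> poly_functions"
        unfolding h_def poly_functions_eq by (intro poly_on_prod poly_on_diff poly_on.coord) auto
      show "h of_nat \<noteq> 0" by (auto simp: h_def)
    next
      fix \<xi> :: "nat \<Rightarrow> complex" assume "h \<xi> \<noteq> 0"
      then have "inj_on \<xi> {..<m}" by (force simp: h_def inj_on_def)
      from zclD[OF inj[OF this restrict_to_mem] P] show "P (tens n1 n2 (nf m s \<xi> ?R)) = 0" .
    qed
    then show "P (tens n1 n2 (nf m s \<xi> T2)) = 0" by (simp only: R)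
  qed
  show ?thesis
    unfolding normal_family_def using pencil_mult_zcl_tri_image[OF any] by blast
qed

section \<open>Dimension\<close>

text \<open>In the second slice, of the first \<open>m s\<close> rows only the entries off the \<open>m\<close> diagonal blocks are
  kept, up to column \<open>n1\<close>, and the first diagonal entry of each block. In \<open>dim_param\<close> these hold the
  off-diagonal entries of the left factor and the roots.\<close>

definition dim_index :: "nat \<Rightarrow> nat \<Rightarrow> nat \<Rightarrow> nat \<Rightarrow> (nat \<times> nat \<times> nat) set" where
  "dim_index n1 n2 m s = {(l, u, j). l < 2 \<and> u < n1 \<and> j < n2 \<and> (l = 1 \<and> u < m * s \<longrightarrow>
     j < n1 \<and> (j < m * s \<and> j div s = u div s \<longrightarrow> j = u \<and> u mod s = 0))}"

lemma finite_dim_index: "finite (dim_index n1 n2 m s)"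
  by (rule finite_subset[of _ "{..<2} \<times> {..<n1} \<times> {..<n2}"]) (auto simp: dim_index_def)

text \<open>The three terms are slice 0, the last rows of slice 1, and its first
  \<open>m * s\<close> rows with \<open>n1 - s\<close> columns each and one extra entry per
  block.\<close>

lemma card_dim_index:
  assumes n: "m * s \<le> n1" "n1 \<le> n2" and s: "s > 0"
  shows "card (dim_index n1 n2 m s) = n1 * n2 + (n1 - m * s) * n2 + m * (s * (n1 - s) + 1)"
proof -
  define R where "R u = {j. j < n1 \<and> (j < m * s \<and> j div s = u div s \<longrightarrow> j = u \<and> u mod s = 0)}" for u
  have split: "dim_index n1 n2 m s =
    {0} \<times> {..<n1} \<times> {..<n2} \<union> ({1} \<times> {m * s..<n1} \<times> {..<n2} \<union> {1} \<times> (SIGMA u:{..<m * s}. R u))"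
    (is "_ = ?A \<union> (?B \<union> ?C)")
  proof (rule Set.set_eqI)
    fix q :: "nat \<times> nat \<times> nat"
    obtain l u j where q: "q = (l, u, j)" by (rule prod_cases3)
    consider "l = 0" | "l = 1" | "l \<ge> 2" by linarith
    then show "q \<in> dim_index n1 n2 m s \<longleftrightarrow> q \<in> ?A \<union> (?B \<union> ?C)"
      using n by cases (auto simp: q dim_index_def R_def)
  qed
  have cardR: "card (R u) = n1 - s + (if u mod s = 0 then 1 else 0)" if u: "u < m * s" for u
  proof -
    define b where "b = u div s * s"
    have "u div s < m" using u s by (simp add: less_mult_imp_div_less)
    then have "Suc (u div s) * s \<le> m * s" by (intro mult_le_mono1) simp
    then have bs: "b + s \<le> m * s" by (simp add: b_def)
    have ub: "b \<le> u" "u < b + s" using s unfolding b_def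
      by (simp_all add: div_times_less_eq_dividend dividend_less_div_times add.commute)
    have blk: "j div s = u div s \<longleftrightarrow> b \<le> j \<and> j < b + s" for j
    proof
      assume "j div s = u div s"
      then show "b \<le> j \<and> j < b + s"
        using div_times_less_eq_dividend[of j s] dividend_less_div_times[of s j] s
        by (simp add: b_def add.commute)
    next
      assume "b \<le> j \<and> j < b + s"
      then obtain d where "j = u div s * s + d" "d < s" unfolding b_def
        by (metis le_Suc_ex nat_add_left_cancel_less)
      then show "j div s = u div s" by simp
    qed
    have R: "R u = ({..<n1} - {b..<b + s}) \<union> (if u mod s = 0 then {u} else {})"
      using bs ub n u by (auto simp: R_def blk)
    have "card ({..<n1} - {b..<b + s}) = n1 - s"
      using bs n by (subst card_Diff_subset) auto
    then show ?thesis unfolding R using ub by (subst card_Un_disjoint) auto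
  qed
  have "card (SIGMA u:{..<m * s}. R u) = (\<Sum>u<m * s. card (R u))"
    by (intro card_SigmaI) (auto simp: R_def)
  also have "\<dots> = (\<Sum>u<m * s. n1 - s + (if u mod s = 0 then 1 else 0))"
    using cardR by (intro sum.cong) auto
  also have "\<dots> = (\<Sum>x<m. \<Sum>y<s. n1 - s + (if y = 0 then 1 else 0))"
    unfolding sum_div_mod by (intro sum.cong refl) auto
  also have "\<dots> = m * (s * (n1 - s) + 1)"
    using s by (simp add: sum.distrib sum.delta)
  finally have C: "card (SIGMA u:{..<m * s}. R u) = m * (s * (n1 - s) + 1)" .
  have finC: "finite (SIGMA u:{..<m * s}. R u)"
    by (rule finite_SigmaI) (auto simp: R_def)
  have "card (dim_index n1 n2 m s) = card ?A + card (?B \<union> ?C)"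
    unfolding split by (rule card_Un_disjoint) (use finC in auto)
  also have "card (?B \<union> ?C) = card ?B + card ?C"
    by (rule card_Un_disjoint) (use finC in auto)
  finally show ?thesis using C by (simp add: card_cartesian_product)
qed

text \<open>The base point is the normal form with \<open>\<xi>\<^sub>i = i + 1\<close> and \<open>T\<^sub>2 = v\<^sub>0 (id | 0)\<close>.\<close>

lemma normal_family_projection_dense:
  assumes n: "m * s \<le> n1" "n1 \<le> n2" and s: "s > 0"
  shows "affine_space (dim_index n1 n2 m s) \<subseteq>
    zcl (restrict_to (dim_index n1 n2 m s) ` normal_family n1 n2 m s)"
proof (rule affine_space_subset_zcl_if_tangent)
  let ?K = "dim_index n1 n2 m s"
  let ?I = "\<lambda>i u :: nat. if i = u then 1 else 0 :: complex"
  define \<xi> :: "nat \<Rightarrow> complex" where "\<xi> i = of_nat (Suc i)" for i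
  define D0 :: "nat \<times> nat \<times> nat \<Rightarrow> complex"
    where "D0 = (\<lambda>(l, i, j). if j = i \<and> l = 0 then 1 else 0)"
  define \<mu> where "\<mu> u = (if u < m * s then \<xi> (u div s) else 0)" for u
  define L where "L l u = (if l = (0 :: nat) then 1 else \<mu> u)" for l u
  have nf0: "nf m s \<xi> D0 l u v = (if v = u then L l u else 0)" for l u v
    by (auto simp: nf_def D0_def L_def \<mu>_def)
  show "restrict_to ?K ` normal_family n1 n2 m s \<subseteq> affine_space ?K" by auto
  fix z :: "nat \<times> nat \<times> nat \<Rightarrow> complex"
  \<comment> \<open>Entry (i, j) moves by \<open>U i j\<close> times form \<open>j\<close> plus
    \<open>V j i\<close> times form \<open>i\<close>. Distinct \<mu> allow both slices to be solved;
    inside a diagonal block slice 0 alone is solved, by \<open>U\<close>.\<close>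
  define U where "U i j = (if m * s \<le> i \<and> m * s \<le> j then 0
    else if \<mu> i = \<mu> j then z (0, i, j) else (z (1, i, j) - \<mu> i * z (0, i, j)) / (\<mu> j - \<mu> i))" for i j
  define V where "V j i = (if m * s \<le> i \<and> m * s \<le> j then 0
    else if j < n1 then z (0, i, j) - U i j else z (0, i, j))" for j i
  \<comment> \<open>The motion of the root of block \<open>c\<close>, read off at the only entry of
    that block which \<open>?K\<close> keeps in slice 1.\<close>
  define \<delta> where "\<delta> c = z (1, c * s, c * s) - \<mu> (c * s) * z (0, c * s, c * s)" for c
  define D where "D = (\<lambda>(l, i, j). z (l, m * s + i, m * s + j))"
  define N where "N l u v = (if u < m * s then if v = u \<and> l \<noteq> 0 then \<delta> (u div s) else 0
    else if v < m * s then 0 else z (l, u, v))" for l u v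
  have nf_t: "nf m s (\<lambda>i. \<xi> i + t * \<delta> i) (\<lambda>q. D0 q + t * D q) l u v = nf m s \<xi> D0 l u v + t * N l u v" for t l u v
    by (simp add: nf_def N_def D_def)
  let ?P = "\<lambda>t. pencil_mult n1 n2 n1 n2 (\<lambda>i u. ?I i u + t * U i u) (\<lambda>j v. ?I j v + t * V j v)
    (tens n1 n2 (nf m s (\<lambda>i. \<xi> i + t * \<delta> i) (\<lambda>q. D0 q + t * D q)))"
  have P: "?P t (l, i, j) = (\<Sum>u<n1. \<Sum>v<n2. (?I i u + t * U i u) * (nf m s \<xi> D0 l u v + t * N l u v)
    * (?I j v + t * V j v))" if "l < 2" "i < n1" "j < n2" for t l i j
    using that unfolding pencil_mult_def tens_apply
    by (auto simp: tens_apply nf_t intro!: sum.cong)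
  have block: "u div s < m" if "u < m * s" for u
    using that s by (simp add: less_mult_imp_div_less)
  have mu_eq: "\<mu> i = \<mu> j \<longleftrightarrow> j < m * s \<and> j div s = i div s" if "i < m * s" for i j
    using that by (auto simp: \<mu>_def \<xi>_def simp flip: of_nat_Suc)
  have mu_ne: "\<mu> i \<noteq> \<mu> j" if "m * s \<le> i" "j < m * s" for i j
    using that by (auto simp: \<mu>_def \<xi>_def simp flip: of_nat_Suc)
  show "\<exists>\<gamma>. (\<forall>t. \<gamma> t \<in> restrict_to ?K ` normal_family n1 n2 m s) \<and>
    \<gamma> 0 = restrict_to ?K (pencil_mult n1 n2 n1 n2 ?I ?I (tens n1 n2 (nf m s \<xi> D0))) \<and>
    (\<forall>q\<in>?K. ((\<lambda>t. \<gamma> t q) has_field_derivative z q) (at 0))"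
  proof (intro exI[of _ "\<lambda>t. restrict_to ?K (?P t)"] conjI ballI allI)
    fix t
    have "?P t \<in> normal_family n1 n2 m s" unfolding normal_family_def by blast
    then show "restrict_to ?K (?P t) \<in> restrict_to ?K ` normal_family n1 n2 m s" by (rule imageI)
  next
    fix q assume qK: "q \<in> ?K"
    then obtain l i j where q: "q = (l, i, j)" "l < 2" "i < n1" "j < n2"
      "l = 1 \<Longrightarrow> i < m * s \<Longrightarrow> j < n1 \<and> (j < m * s \<and> j div s = i div s \<longrightarrow> j = i \<and> i mod s = 0)"
      by (auto simp: dim_index_def)
    have "((\<lambda>t. ?P t q) has_field_derivative (if j < n1 then U i j * L l j else 0) + N l i j + L l i * V j i) (at 0)"
      using pencil_mult_curve[OF n(2) q(3,4), of "nf m s \<xi> D0 l" "L l" U "N l" V] q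
      by (simp add: P nf0)
    moreover have "(if j < n1 then U i j * L l j else 0) + N l i j + L l i * V j i = z q"
    proof (cases "m * s \<le> i \<and> m * s \<le> j")
      case True
      then show ?thesis by (simp add: q(1) U_def V_def N_def)
    next
      case F: False
      show ?thesis
      proof (cases "l = 0")
        case True
        then show ?thesis using F n by (auto simp: q(1) L_def V_def N_def U_def)
      next
        case False
        then have l: "l = 1" using q(2) by simp
        show ?thesis
        proof (cases "\<mu> i = \<mu> j")
          case True
          then have i: "i < m * s" using mu_ne[of i j] F by force
          then have j: "j < m * s" "j div s = i div s" using True mu_eq[OF i] by auto
          then have "j = i" "i mod s = 0" using q(5)[OF l i] by auto
          moreover from this have "i div s * s = i" by auto
          ultimately show ?thesis using i n l
            by (simp add: q(1) L_def V_def N_def U_def \<delta>_def mult.commute)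
        next
          case ne: False
          have N0: "N l i j = 0"
          proof (cases "i < m * s")
            case True
            then show ?thesis using ne by (auto simp: N_def)
          qed (use F in \<open>auto simp: N_def\<close>)
          have j: "j < n1"
            using q(5)[OF l] F n by (cases "i < m * s") auto
          have "\<mu> j - \<mu> i \<noteq> 0" using ne by simp
          then have "U i j * (\<mu> j - \<mu> i) = z (1, i, j) - \<mu> i * z (0, i, j)"
            using ne unfolding U_def if_not_P[OF F] by simp
          then have "U i j * \<mu> j + \<mu> i * (z (0, i, j) - U i j) = z (1, i, j)"
            by (simp add: algebra_simps)
          then show ?thesis using j F l N0 by (auto simp: q(1) L_def V_def)
        qed
      qed
    qed
    ultimately show "((\<lambda>t. restrict_to ?K (?P t) q) has_field_derivative z q) (at 0)"
      using qK by (simp add: restrict_to_def)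
  qed (simp add: fun_eq_iff)
qed

definition dim_param :: "nat \<Rightarrow> nat \<Rightarrow> nat \<Rightarrow> nat \<Rightarrow> (nat \<times> nat \<times> nat \<Rightarrow> complex) \<Rightarrow> nat \<times> nat \<times> nat \<Rightarrow> complex" where
  "dim_param n1 n2 m s x = tens n1 n2 (\<lambda>l i j. \<Sum>u<n1.
     (if i < m * s \<and> \<not> (u < m * s \<and> u div s = i div s) then x (1, i, u) else if i = u then 1 else 0)
     * scaled_rows m s 0 (\<lambda>c. x (1, c * s, c * s)) (\<lambda>l u j. x (l, u, j)) l u j)"

text \<open>Only coordinates in \<open>dim_index\<close> are read, so there are as many parameters
  as independent coordinates.\<close>

lemma poly_on_dim_param:
  assumes n: "m * s \<le> n1" "n1 \<le> n2" and s: "s > 0"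
  shows "(\<lambda>x. dim_param n1 n2 m s x q) \<in> poly_on (dim_index n1 n2 m s)"
  unfolding dim_param_def
proof (rule poly_on_tens, rule poly_on_sum, rule poly_on.mult)
  fix l i j u :: nat assume lij: "l < 2" "i < n1" "j < n2" "u \<in> {..<n1}"
  show "(\<lambda>x. if i < m * s \<and> \<not> (u < m * s \<and> u div s = i div s) then x (1, i, u) else if i = u then 1 else 0)
    \<in> poly_on (dim_index n1 n2 m s)"
    using lij n
    by (cases "i < m * s \<and> \<not> (u < m * s \<and> u div s = i div s)"; cases "i = u")
      (auto intro!: poly_on.const poly_on.coord simp: dim_index_def)
  show "(\<lambda>x. scaled_rows m s 0 (\<lambda>c. x (1, c * s, c * s)) (\<lambda>l u j. x (l, u, j)) l u j)
    \<in> poly_on (dim_index n1 n2 m s)"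
  proof (cases "u < m * s")
    case True
    have "u div s * s < m * s" using True by (meson div_times_less_eq_dividend le_less_trans)
    then have "u div s * s < n1" using n(1) by (rule less_le_trans)
    moreover from this have "u div s * s < n2" using n(2) by (rule less_le_trans)
    moreover have "root_form 0 l c = (if l = 0 then 1 else - c)" for c by (simp add: root_form_def)
    ultimately show ?thesis using True lij n s unfolding scaled_rows_def
      by (cases "l = 0") (auto intro!: poly_on_intros poly_on.coord simp: dim_index_def)
  next
    case False
    then show ?thesis using lij
      by (auto intro!: poly_on.coord simp: scaled_rows_def dim_index_def)
  qed
qed

text \<open>Up to a block matrix preserving the form of \<open>scaled_rows\<close>, the left factor can be
  normalized to have identity diagonal blocks and last rows.\<close>

lemma row_family_subset_zcl_range_dim_param:
  assumes n: "m * s \<le> n1" and s: "s > 0"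
  shows "row_family n1 n2 m s 0 \<subseteq> zcl (range (dim_param n1 n2 m s))"
proof
  fix T assume "T \<in> row_family n1 n2 m s 0"
  then obtain G \<rho> M where T: "T = tens n1 n2 (\<lambda>l i j. \<Sum>u<n1. G i u * scaled_rows m s 0 \<rho> M l u j)"
    unfolding row_family_def by blast
  let ?K = "{..<n1} \<times> {..<n1}"
  let ?I = "\<lambda>i u :: nat. if i = u then 1 else 0 :: complex"
  \<comment> \<open>\<open>E\<close> marks the entries of the left factor that stay free. Matrices
    \<open>b\<close> vanishing on \<open>E\<close> mix divisible rows only within a block and put
    arbitrary combinations into the last rows, so they respect \<open>scaled_rows\<close>.\<close>
  define E where "E i u \<longleftrightarrow> i < m * s \<and> \<not> (u < m * s \<and> u div s = i div s)" for i u
  let ?S = "{restrict_to ?K (\<lambda>(i, u). \<Sum>c<n1. (if E i c then Y i c else ?I i c) * b c u) | Y b.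
    \<forall>c u. E c u \<longrightarrow> b c u = 0}"
  have "affine_space ?K \<subseteq> zcl ?S"
  proof (rule affine_space_subset_zcl_if_tangent)
    fix z :: "nat \<times> nat \<Rightarrow> complex"
    define Y where "Y i u = (if E i u then z (i, u) else 0)" for i u
    define b where "b i u = (if E i u then 0 else z (i, u))" for i u
    have EI: "\<not> E i i" for i by (auto simp: E_def)
    let ?\<gamma> = "\<lambda>t. restrict_to ?K (\<lambda>(i, u). \<Sum>c<n1. (?I i c + t * Y i c) * (?I c u + t * b c u))"
    show "\<exists>\<gamma>. (\<forall>t. \<gamma> t \<in> ?S) \<and> \<gamma> 0 = restrict_to ?K (\<lambda>(i, u). \<Sum>c<n1. ?I i c * ?I c u) \<and>
      (\<forall>q\<in>?K. ((\<lambda>t. \<gamma> t q) has_field_derivative z q) (at 0))"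
    proof (intro exI[of _ ?\<gamma>] conjI ballI allI)
      fix t
      have "?\<gamma> t = restrict_to ?K (\<lambda>(i, u). \<Sum>c<n1. (if E i c then t * Y i c else ?I i c) * (?I c u + t * b c u))"
        by (rule arg_cong[of _ _ "restrict_to ?K"]) (auto simp: fun_eq_iff Y_def EI intro!: sum.cong)
      moreover have "\<forall>c u. E c u \<longrightarrow> ?I c u + t * b c u = 0"
        by (auto simp: b_def EI)
      ultimately show "?\<gamma> t \<in> ?S"
        unfolding mem_Collect_eq
        by (intro exI[of _ "\<lambda>i c. t * Y i c"] exI[of _ "\<lambda>c u. ?I c u + t * b c u"] conjI)
    next
      fix q assume "q \<in> ?K"
      then obtain i u where q: "q = (i, u)" "i < n1" "u < n1" by auto
      have "((\<lambda>t. \<Sum>c<n1. (?I i c + t * Y i c) * (?I c u + t * b c u)) has_field_derivative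
        (\<Sum>c<n1. Y i c * ?I c u + ?I i c * b c u)) (at 0)"
        by (intro DERIV_sum) (auto intro!: derivative_eq_intros)
      moreover have "(\<Sum>c<n1. Y i c * ?I c u + ?I i c * b c u) = z q"
        using q by (simp add: sum.distrib sum_delta_lessThan Y_def b_def)
      ultimately show "((\<lambda>t. ?\<gamma> t q) has_field_derivative z q) (at 0)"
        using q by (simp add: restrict_to_def)
    qed simp
  qed auto
  then have "restrict_to ?K (\<lambda>(i, u). G i u) \<in> zcl ?S" using restrict_to_mem by blast
  let ?F = "\<lambda>g. tens n1 n2 (\<lambda>l i j. \<Sum>u<n1. g (i, u) * scaled_rows m s 0 \<rho> M l u j)"
  from \<open>restrict_to ?K (\<lambda>(i, u). G i u) \<in> zcl ?S\<close>
  have "?F (restrict_to ?K (\<lambda>(i, u). G i u)) \<in> zcl (range (dim_param n1 n2 m s))"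
  proof (rule zcl_image_subset[of _ _ ?F])
    show "(\<lambda>g. ?F g i) \<in> poly_functions" for i
      unfolding poly_functions_eq by (intro poly_on_tens poly_on_intros poly_on.coord) auto
  next
    fix g assume "g \<in> ?S"
    then obtain Y b where g: "g = restrict_to ?K (\<lambda>(i, u). \<Sum>c<n1. (if E i c then Y i c else ?I i c) * b c u)"
      and b: "\<And>c u. E c u \<Longrightarrow> b c u = 0" by blast
    define M' where "M' l c j = (if c < m * s then \<Sum>u<n1. b c u * M 0 u j
      else \<Sum>u<n1. b c u * scaled_rows m s 0 \<rho> M l u j)" for l c j
    define x where "x = (\<lambda>(l, u, j). if l = (1 :: nat) \<and> u < m * s then if E u j then Y u j else \<rho> (u div s)
      else M' l u j)"
    have rows: "(\<Sum>u<n1. b c u * scaled_rows m s 0 \<rho> M l u j)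
      = scaled_rows m s 0 (\<lambda>c. x (1, c * s, c * s)) (\<lambda>l u j. x (l, u, j)) l c j" for l c j
    proof (cases "c < m * s")
      case True
      have "c div s * s < m * s" using True by (meson div_times_less_eq_dividend le_less_trans)
      then have "x (1, c div s * s, c div s * s) = \<rho> (c div s)"
        using s by (simp add: x_def E_def)
      moreover have "(\<Sum>u<n1. b c u * scaled_rows m s 0 \<rho> M l u j)
        = (\<Sum>u<n1. root_form 0 l (\<rho> (c div s)) * (b c u * M 0 u j))"
      proof (intro sum.cong refl)
        fix u
        show "b c u * scaled_rows m s 0 \<rho> M l u j = root_form 0 l (\<rho> (c div s)) * (b c u * M 0 u j)"
          using b[of c u] True by (cases "E c u") (auto simp: E_def scaled_rows_def)
      qed
      ultimately show ?thesis using True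
        by (simp add: scaled_rows_def x_def M'_def sum_distrib_left)
    next
      case False
      then show ?thesis by (simp add: scaled_rows_def x_def M'_def)
    qed
    have "?F g = dim_param n1 n2 m s x"
      unfolding dim_param_def
    proof (rule tens_cong)
      fix l i j :: nat assume i: "i < n1"
      have "(\<Sum>u<n1. g (i, u) * scaled_rows m s 0 \<rho> M l u j)
        = (\<Sum>u<n1. \<Sum>c<n1. (if E i c then Y i c else ?I i c) * (b c u * scaled_rows m s 0 \<rho> M l u j))"
        using i by (intro sum.cong refl) (simp add: g restrict_to_def sum_distrib_right mult.assoc)
      also have "\<dots> = (\<Sum>c<n1. (if E i c then Y i c else ?I i c) * (\<Sum>u<n1. b c u * scaled_rows m s 0 \<rho> M l u j))"
        by (subst sum.swap) (simp add: sum_distrib_left)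
      also have "\<dots> = (\<Sum>u<n1. (if i < m * s \<and> \<not> (u < m * s \<and> u div s = i div s) then x (1, i, u) else ?I i u)
        * scaled_rows m s 0 (\<lambda>c. x (1, c * s, c * s)) (\<lambda>l u j. x (l, u, j)) l u j)"
        unfolding rows by (intro sum.cong refl) (auto simp: E_def x_def)
      finally show "(\<Sum>u<n1. g (i, u) * scaled_rows m s 0 \<rho> M l u j) = (\<Sum>u<n1. (if i < m * s \<and> \<not> (u < m * s \<and> u div s = i div s) then x (1, i, u) else ?I i u)
        * scaled_rows m s 0 (\<lambda>c. x (1, c * s, c * s)) (\<lambda>l u j. x (l, u, j)) l u j)" .
    qed
    then have "?F g \<in> range (dim_param n1 n2 m s)" by (rule range_eqI[where f = "dim_param n1 n2 m s" and x = x])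
    then show "?F g \<in> zcl (range (dim_param n1 n2 m s))" by (rule subsetD[OF zcl_superset])
  qed
  moreover have "?F (restrict_to ?K (\<lambda>(i, u). G i u)) = T"
    unfolding T by (intro tens_cong sum.cong refl) (simp add: restrict_to_def)
  ultimately show "T \<in> zcl (range (dim_param n1 n2 m s))" by simp
qed

lemma variety_dim_TNS_triangle:
  assumes m: "m \<ge> 1" and s: "s > 0" and k: "k2 \<le> k1"
    and n1: "n1 = m * s + (m - 1) * k1" and n2: "n2 = m * s + ((m - 1) * k1 + (k1 - k2))"
  shows "variety_dim (TNS_triangle m (s + k1) m 2 n1 n2)
    = n1 * n2 + (n1 - m * s) * n2 + m * (s * (n1 - s) + 1)"
proof -
  let ?X = "TNS_triangle m (s + k1) m 2 n1 n2" and ?K = "dim_index n1 n2 m s"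
  have n: "m * s \<le> n1" "n1 \<le> n2" using n1 n2 by auto
  have q: "(m - 1) * k1 + (k1 - k2) \<le> m * k1"
    using m by (cases m) auto
  have "variety_dim ?X = card ?K"
  proof (rule variety_dim_eq_card[of ?K ?X ?K "dim_param n1 n2 m s"])
    fix Q x assume Q: "Q \<in> poly_on ?K" "\<And>x. x \<in> ?X \<Longrightarrow> Q x = 0"
    have normal: "normal_family n1 n2 m s \<subseteq> ?X"
      using normal_family_subset_zcl_tri_image[OF m s q n1 n2]
      by (auto simp: TNS_triangle_eq normal_family_def pencil_mult_def)
    have "Q (restrict_to ?K x) = 0"
    proof (rule zclD[OF _ poly_on_poly_functions[OF Q(1)]])
      show "restrict_to ?K x \<in> zcl (restrict_to ?K ` normal_family n1 n2 m s)"
        using normal_family_projection_dense[OF n s] restrict_to_mem by blast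
      fix y assume "y \<in> restrict_to ?K ` normal_family n1 n2 m s"
      then obtain w where w: "w \<in> normal_family n1 n2 m s" "y = restrict_to ?K w" by blast
      have "Q y = Q w" by (rule poly_on_cong[OF Q(1)]) (simp add: w restrict_to_def)
      then show "Q y = 0" using Q(2) w normal by auto
    qed
    moreover have "Q (restrict_to ?K x) = Q x"
      by (rule poly_on_cong[OF Q(1)]) (simp add: restrict_to_def)
    ultimately show "Q x = 0" by simp
  next
    have "tri_image m (s + k1) m n1 n2 \<subseteq> zcl (range (dim_param n1 n2 m s))"
      using tri_image_subset_zcl_row_family[OF m s n1, of n2 0]
        zcl_least[OF row_family_subset_zcl_range_dim_param[OF n(1) s, of n2]] by blast
    then show "?X \<subseteq> zcl (range (dim_param n1 n2 m s))"
      using zcl_least by (auto simp: TNS_triangle_eq)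
  qed (simp_all add: finite_dim_index poly_on_dim_param[OF n s])
  then show ?thesis by (simp only: card_dim_index[OF n s])
qed

lemma variety_dim_tensor_space: "variety_dim (tensor_space 2 n1 n2) = 2 * n1 * n2"
proof -
  let ?K = "tensor_index 2 n1 n2"
  have "variety_dim (tensor_space 2 n1 n2) = card ?K"
  proof (rule variety_dim_eq_card[of ?K _ ?K "restrict_to ?K"])
    fix Q :: "(nat \<times> nat \<times> nat \<Rightarrow> complex) \<Rightarrow> complex" and x
    assume Q: "Q \<in> poly_on ?K" "\<And>x. x \<in> affine_space ?K \<Longrightarrow> Q x = 0"
    have "Q (restrict_to ?K x) = Q x"
      by (rule poly_on_cong[OF Q(1)]) (simp add: restrict_to_def)
    then show "Q x = 0" using Q(2)[of "restrict_to ?K x"] by simp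
  next
    have "affine_space ?K \<subseteq> range (restrict_to ?K)"
    proof
      fix x assume "x \<in> affine_space ?K"
      then have "restrict_to ?K x = x" by simp
      then show "x \<in> range (restrict_to ?K)" by (metis rangeI)
    qed
    then show "affine_space ?K \<subseteq> zcl (range (restrict_to ?K))" using zcl_superset by blast
  next
    show "(\<lambda>x. restrict_to ?K x i) \<in> poly_on ?K" for i
      by (cases "i \<in> ?K") (auto simp: restrict_to_def intro: poly_on.intros)
  qed auto
  then show ?thesis by simp
qed

section \<open>Matrices of linear forms\<close>

lemma lin_form_eq: "lin_form a b = [:[:0, a:], [:b:]:]"
  by (simp add: lin_form_def scalar_def Let_def)

lemma lin_form_add: "lin_form a b + lin_form c d = lin_form (a + c) (b + d)"
  by (simp add: lin_form_eq)

lemma lin_form_0 [simp]: "lin_form 0 0 = 0"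
  by (simp add: lin_form_eq)

lemma lin_form_sum: "(\<Sum>x\<in>A. lin_form (f x) (g x)) = lin_form (\<Sum>x\<in>A. f x) (\<Sum>x\<in>A. g x)"
  by (induction A rule: infinite_finite_induct) (simp_all add: lin_form_add)

lemma scalar_mult_lin_form: "scalar c * lin_form a b = lin_form (c * a) (c * b)"
  "lin_form a b * scalar c = lin_form (a * c) (b * c)"
  by (simp_all add: lin_form_eq scalar_def)

lemma pencil_act_pencil_mat:
  assumes X: "X1 \<in> carrier_mat a n1" "X2 \<in> carrier_mat b n2"
  shows "pencil_act X1 X2 (pencil_mat n1 n2 T) =
    pencil_mat a b (pencil_mult a b n1 n2 (\<lambda>i u. X1 $$ (i, u)) (\<lambda>j v. X2 $$ (j, v)) T)"
proof (rule eq_matI)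
  let ?R = "pencil_mat a b (pencil_mult a b n1 n2 (\<lambda>i u. X1 $$ (i, u)) (\<lambda>j v. X2 $$ (j, v)) T)"
  fix i j assume "i < dim_row ?R" "j < dim_col ?R"
  then have ij: "i < a" "j < b" by (auto simp: pencil_mat_def)
  have "pencil_act X1 X2 (pencil_mat n1 n2 T) $$ (i, j) =
    (\<Sum>v<n2. (\<Sum>u<n1. scalar (X1 $$ (i, u)) * lin_form (T (0, u, v)) (T (1, u, v))) * scalar (X2 $$ (j, v)))"
    using ij X by (simp add: pencil_act_def pencil_mat_def scalar_prod_def atLeast0LessThan)
  also have "\<dots> = lin_form (\<Sum>v<n2. \<Sum>u<n1. X1 $$ (i, u) * T (0, u, v) * X2 $$ (j, v))
    (\<Sum>v<n2. \<Sum>u<n1. X1 $$ (i, u) * T (1, u, v) * X2 $$ (j, v))"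
    by (simp add: scalar_mult_lin_form lin_form_sum sum_distrib_right)
  also have "\<dots> = ?R $$ (i, j)"
    using ij by (simp add: pencil_mat_def pencil_mult_def tens_apply sum.swap[of _ "{..<n1}"])
  finally show "pencil_act X1 X2 (pencil_mat n1 n2 T) $$ (i, j) = ?R $$ (i, j)" .
qed (use X in \<open>simp_all add: pencil_act_def pencil_mat_def\<close>)

text \<open>The interval starts at an arbitrary \<open>a\<close> because the induction removes the
  first block.\<close>

lemma diag_block_mat_scalar_blocks:
  assumes s: "s > 0"
  shows "diag_block_mat (map (\<lambda>i. c i \<cdot>\<^sub>m 1\<^sub>m s) [a..<a + m]) =
    mat (m * s) (m * s) (\<lambda>(u, v). if v = u then c (a + u div s) else (0 :: 'a :: comm_ring_1))"
proof (induction m arbitrary: a)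
  case 0
  show ?case by (rule eq_matI) simp_all
next
  case (Suc m)
  let ?M = "mat (m * s) (m * s) (\<lambda>(u, v). if v = u then c (Suc a + u div s) else 0)"
  have "[a..<a + Suc m] = a # [Suc a..<Suc a + m]"
    by (simp add: upt_conv_Cons)
  then have "diag_block_mat (map (\<lambda>i. c i \<cdot>\<^sub>m 1\<^sub>m s) [a..<a + Suc m]) =
    four_block_mat (c a \<cdot>\<^sub>m 1\<^sub>m s) (0\<^sub>m s (m * s)) (0\<^sub>m (m * s) s) ?M"
    using Suc.IH[of "Suc a"] by (simp add: Let_def)
  also have "\<dots> = mat (Suc m * s) (Suc m * s) (\<lambda>(u, v). if v = u then c (a + u div s) else 0)"
  proof (rule eq_matI)
    fix u v assume "u < dim_row (mat (Suc m * s) (Suc m * s) (\<lambda>(u, v). if v = u then c (a + u div s) else 0))"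
      "v < dim_col (mat (Suc m * s) (Suc m * s) (\<lambda>(u, v). if v = u then c (a + u div s) else 0))"
    then have uv: "u < s + m * s" "v < s + m * s" by simp_all
    have "Suc ((u - s) div s) = u div s" if "s \<le> u"
      using le_div_geq[OF s that] by simp
    then show "four_block_mat (c a \<cdot>\<^sub>m 1\<^sub>m s) (0\<^sub>m s (m * s)) (0\<^sub>m (m * s) s) ?M $$ (u, v) =
      mat (Suc m * s) (Suc m * s) (\<lambda>(u, v). if v = u then c (a + u div s) else 0) $$ (u, v)"
      using uv by (auto simp flip: add_Suc_right)
  qed simp_all
  finally show ?case .
qed

lemma normal_form_eq:
  assumes s: "s > 0"
  shows "normal_form m s p q \<xi> T2 = pencil_mat (m * s + p) (m * s + q) (tens (m * s + p) (m * s + q) (nf m s \<xi> T2))"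
proof -
  have D: "diag_block_mat (map (\<lambda>i. lin_form 1 (\<xi> i) \<cdot>\<^sub>m 1\<^sub>m s) [0..<m]) =
    mat (m * s) (m * s) (\<lambda>(u, v). if v = u then lin_form 1 (\<xi> (u div s)) else 0)"
    using diag_block_mat_scalar_blocks[OF s, of "\<lambda>i. lin_form 1 (\<xi> i)" 0 m] by (simp only: add_0)
  show ?thesis
    unfolding normal_form_def D
    by (rule eq_matI) (auto simp: pencil_mat_def tens_apply nf_def)
qed

lemma invertible_mat_if_det_nonzero:
  fixes A :: "'a :: field mat"
  assumes A: "A \<in> carrier_mat n n" and d: "det A \<noteq> 0"
  shows "invertible_mat A"
proof -
  let ?B = "inverse (det A) \<cdot>\<^sub>m adj_mat A"
  have "A * ?B = 1\<^sub>m n" "?B * A = 1\<^sub>m n"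
    using adj_mat[OF A] A d
    by (auto simp: mult_smult_distrib[of A n n _ n] mult_smult_assoc_mat[of _ n n A n] intro!: eq_matI)
  moreover have "dim_row ?B = n" using adj_mat(1)[OF A] by simp
  ultimately have "inverts_mat A ?B \<and> inverts_mat ?B A"
    using A by (simp add: inverts_mat_def)
  then show ?thesis using A by (auto simp: invertible_mat_def)
qed

section \<open>Generic normal form\<close>

type_synonym normal_params = "(nat \<times> nat) + (nat \<times> nat) + (nat + nat \<times> nat \<times> nat)"

definition normal_param_index :: "nat \<Rightarrow> nat \<Rightarrow> nat \<Rightarrow> nat \<Rightarrow> nat \<Rightarrow> normal_params set" where
  "normal_param_index n1 n2 m p q =
     ({..<n1} \<times> {..<n1}) <+> (({..<n2} \<times> {..<n2}) <+> param_index m p q)"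

definition normal_map :: "nat \<Rightarrow> nat \<Rightarrow> nat \<Rightarrow> nat \<Rightarrow> (normal_params \<Rightarrow> complex) \<Rightarrow> nat \<times> nat \<times> nat \<Rightarrow> complex" where
  "normal_map n1 n2 m s x =
     pencil_mult n1 n2 n1 n2 (\<lambda>i u. x (Inl (i, u))) (\<lambda>j v. x (Inr (Inl (j, v))))
       (tens n1 n2 (nf m s (\<lambda>i. x (Inr (Inr (Inl i)))) (\<lambda>t. x (Inr (Inr (Inr t))))))"

lemma range_normal_map: "range (normal_map n1 n2 m s) = normal_family n1 n2 m s"
proof (intro Set.set_eqI iffI)
  fix T assume "T \<in> normal_family n1 n2 m s"
  then obtain g1 g2 \<xi> T2 where T: "T = pencil_mult n1 n2 n1 n2 g1 g2 (tens n1 n2 (nf m s \<xi> T2))"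
    unfolding normal_family_def by blast
  have "T = normal_map n1 n2 m s (case_sum (\<lambda>(i, u). g1 i u) (case_sum (\<lambda>(j, v). g2 j v) (case_sum \<xi> T2)))"
    by (simp add: T normal_map_def)
  then show "T \<in> range (normal_map n1 n2 m s)" by blast
qed (auto simp: normal_map_def normal_family_def)

lemma poly_on_normal_map:
  assumes s: "s > 0" and n: "n1 = m * s + p" "n2 = m * s + q"
  shows "(\<lambda>x. normal_map n1 n2 m s x t) \<in> poly_on (normal_param_index n1 n2 m p q)"
  unfolding normal_map_def pencil_mult_def
proof (rule poly_on_tens, rule poly_on_sum, rule poly_on_sum, rule poly_on.mult, rule poly_on.mult)
  fix l i j u v :: nat
  assume *: "l < 2" "i < n1" "j < n2" "u \<in> {..<n1}" "v \<in> {..<n2}"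
  show "(\<lambda>x. x (Inl (i, u))) \<in> poly_on (normal_param_index n1 n2 m p q)"
    "(\<lambda>x. x (Inr (Inl (j, v)))) \<in> poly_on (normal_param_index n1 n2 m p q)"
    using * by (auto intro!: poly_on.coord simp: normal_param_index_def)
  show "(\<lambda>x. tens n1 n2 (nf m s (\<lambda>i. x (Inr (Inr (Inl i)))) (\<lambda>t. x (Inr (Inr (Inr t))))) (l, u, v))
    \<in> poly_on (normal_param_index n1 n2 m p q)"
    using s by (intro poly_on_tens poly_on_nf[where p = p and q = q] poly_on.coord)
      (auto simp: n normal_param_index_def param_index_def)
qed

lemma generic_normal_form:
  assumes s: "s > 0" and n: "n1 = m * s + p" "n2 = m * s + q"
    and X: "X \<subseteq> tensor_space 2 n1 n2" "X \<subseteq> zcl (normal_family n1 n2 m s)" "normal_family n1 n2 m s \<subseteq> X"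
    and U: "nonempty_open_in (param_index m p q) (affine_space (param_index m p q)) U"
  shows "\<exists>Z. nonempty_open_in (tensor_index 2 n1 n2) X Z \<and>
    (\<forall>T\<in>Z. \<exists>g1\<in>general_linear n1. \<exists>g2\<in>general_linear n2. \<exists>\<xi> T2. case_sum \<xi> T2 \<in> U \<and>
      pencil_mat n1 n2 T = pencil_act g1 g2 (normal_form m s p q \<xi> T2))"
proof -
  let ?I = "param_index m p q" and ?A = "normal_param_index n1 n2 m p q"
  obtain R where R: "R \<subseteq> poly_functions" "U = affine_space ?I - zero_locus ?I R" "U \<noteq> {}"
    using U by (auto simp: nonempty_open_in_def openin_subtopology openin_zariski zariski_open_def)
  then obtain u P where u: "u \<in> affine_space ?I" "P \<in> R" "P u \<noteq> 0"
    by (auto simp: zero_locus_def)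
  have PU: "y \<in> U" if "y \<in> affine_space ?I" "P y \<noteq> 0" for y
    using that u(2) R(2) by (auto simp: zero_locus_def)
  have P: "P \<in> poly_functions" using u(2) R(1) by blast
  define g1 where "g1 x = mat n1 n1 (\<lambda>(i, u). x (Inl (i, u)))" for x :: "normal_params \<Rightarrow> complex"
  define g2 where "g2 x = mat n2 n2 (\<lambda>(i, u). x (Inr (Inl (i, u))))" for x :: "normal_params \<Rightarrow> complex"
  define f where "f x = P (restrict_to ?I (\<lambda>t. x (Inr (Inr t)))) * (det (g1 x) * det (g2 x))"
    for x :: "normal_params \<Rightarrow> complex"
  have f: "f \<in> poly_on ?A"
    unfolding f_def g1_def g2_def
  proof (intro poly_on.mult poly_on_det)
    show "(\<lambda>x. P (restrict_to ?I (\<lambda>t. x (Inr (Inr t))))) \<in> poly_on ?A"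
      by (rule poly_on_subst[OF poly_on_restrict[OF P], of _ "\<lambda>x t. x (Inr (Inr t))"])
        (auto intro: poly_on.coord simp: normal_param_index_def)
  qed (auto intro!: poly_on.coord simp: normal_param_index_def)
  define x0 :: "normal_params \<Rightarrow> complex"
    where "x0 = case_sum (\<lambda>(i, j). if i = j then 1 else 0) (case_sum (\<lambda>(i, j). if i = j then 1 else 0) u)"
  have "g1 x0 = 1\<^sub>m n1" "g2 x0 = 1\<^sub>m n2"
    unfolding g1_def g2_def by (rule eq_matI; simp add: x0_def)+
  then have "f x0 \<noteq> 0"
    using u(1,3) by (simp add: f_def x0_def)
  moreover have "finite ?A"
    by (auto simp: normal_param_index_def param_index_def)
  moreover have "normal_map n1 n2 m s x \<in> tensor_space 2 n1 n2" for x
    by (simp add: normal_map_def pencil_mult_def)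
  ultimately obtain h x1 where h: "h \<in> poly_functions" "h (normal_map n1 n2 m s x1) \<noteq> 0"
    and lift: "\<And>y. y \<in> zcl (range (normal_map n1 n2 m s)) \<Longrightarrow> y \<in> tensor_space 2 n1 n2 \<Longrightarrow> h y \<noteq> 0 \<Longrightarrow>
      \<exists>x\<in>affine_space ?A. f x \<noteq> 0 \<and> normal_map n1 n2 m s x = y"
    using image_contains_open[of ?A "normal_map n1 n2 m s" "tensor_index 2 n1 n2" f x0]
      poly_on_normal_map[OF s n] f by blast
  define Z where "Z = {T \<in> X. h T \<noteq> 0}"
  have "nonempty_open_in (tensor_index 2 n1 n2) X Z"
    unfolding nonempty_open_in_def
  proof
    have "normal_map n1 n2 m s x1 \<in> X" using X(3) range_normal_map by blast
    then show "Z \<noteq> {}" using h(2) by (auto simp: Z_def)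
    have "openin (zariski (tensor_index 2 n1 n2)) (tensor_space 2 n1 n2 - zero_locus (tensor_index 2 n1 n2) {h})"
      unfolding openin_zariski zariski_open_def using h(1) by blast
    moreover have "Z = (tensor_space 2 n1 n2 - zero_locus (tensor_index 2 n1 n2) {h}) \<inter> X"
      using X(1) by (auto simp: Z_def zero_locus_def)
    ultimately show "openin (subtopology (zariski (tensor_index 2 n1 n2)) X) Z"
      unfolding openin_subtopology by blast
  qed
  moreover have "\<exists>g1\<in>general_linear n1. \<exists>g2\<in>general_linear n2. \<exists>\<xi> T2. case_sum \<xi> T2 \<in> U \<and>
      pencil_mat n1 n2 T = pencil_act g1 g2 (normal_form m s p q \<xi> T2)" if T: "T \<in> Z" for T
  proof -
    have "T \<in> zcl (range (normal_map n1 n2 m s))" "T \<in> tensor_space 2 n1 n2" "h T \<noteq> 0"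
      using T X(1,2) by (auto simp: Z_def range_normal_map)
    from lift[OF this] obtain x where x: "x \<in> affine_space ?A" "f x \<noteq> 0" "normal_map n1 n2 m s x = T"
      by blast
    let ?xi = "\<lambda>i. x (Inr (Inr (Inl i)))" and ?T2 = "\<lambda>t. x (Inr (Inr (Inr t)))"
    have eta: "case_sum ?xi ?T2 = (\<lambda>t. x (Inr (Inr t)))"
      by (rule ext) (simp split: sum.split)
    have xI: "(\<lambda>t. x (Inr (Inr t))) \<in> affine_space ?I"
      using x(1) by (auto simp: affine_space_def normal_param_index_def)
    then have "case_sum ?xi ?T2 \<in> U"
      unfolding eta using x(2) by (intro PU) (auto simp: f_def)
    moreover have gl: "g1 x \<in> general_linear n1" "g2 x \<in> general_linear n2"
      using x(2) by (auto simp: general_linear_def f_def g1_def g2_def intro!: invertible_mat_if_det_nonzero)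
    moreover have "pencil_mat n1 n2 T = pencil_act (g1 x) (g2 x) (normal_form m s p q ?xi ?T2)"
    proof -
      have c: "g1 x \<in> carrier_mat n1 n1" "g2 x \<in> carrier_mat n2 n2" by (auto simp: g1_def g2_def)
      have "pencil_mult n1 n2 n1 n2 (\<lambda>i u. g1 x $$ (i, u)) (\<lambda>j v. g2 x $$ (j, v)) (tens n1 n2 (nf m s ?xi ?T2)) = T"
        unfolding x(3)[symmetric] normal_map_def pencil_mult_def
        by (intro tens_cong sum.cong refl) (simp add: g1_def g2_def)
      then show ?thesis
        unfolding normal_form_eq[OF s] n[symmetric] pencil_act_pencil_mat[OF c] by simp
    qed
    ultimately show ?thesis by blast
  qed
  ultimately show ?thesis by blast
qed

section \<open>Determinants of pencils\<close>

definition form_eval :: "complex \<Rightarrow> complex \<Rightarrow> complex poly poly \<Rightarrow> complex" where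
  "form_eval w0 w1 f = poly (poly f [:w1:]) w0"

lemma comm_ring_hom_form_eval: "comm_ring_hom (form_eval w0 w1)"
  by unfold_locales (simp_all add: form_eval_def)

lemma form_eval_lin_form: "form_eval w0 w1 (lin_form a b) = a * w0 + b * w1"
  by (simp add: form_eval_def lin_form_eq algebra_simps)

lemma form_eval_power: "form_eval w0 w1 (f ^ n) = form_eval w0 w1 f ^ n"
  by (simp add: form_eval_def)

lemma form_eval_prod: "form_eval w0 w1 (\<Prod>x\<in>A. f x) = (\<Prod>x\<in>A. form_eval w0 w1 (f x))"
  by (simp add: form_eval_def poly_prod)

lemma form_eqI:
  assumes "\<And>w0 w1. form_eval w0 w1 f = form_eval w0 w1 g"
  shows "f = g"
proof (rule ccontr)
  assume "f \<noteq> g"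
  then have fin: "finite {a. poly (f - g) a = 0}" by (intro poly_roots_finite) simp
  have "poly (f - g) [:w1:] = 0" for w1
  proof (rule poly_ext)
    fix w0 show "poly (poly (f - g) [:w1:]) w0 = poly 0 w0"
      using assms[of w0 w1] by (simp add: form_eval_def)
  qed
  then have "range (\<lambda>w1. [:w1:]) \<subseteq> {a. poly (f - g) a = 0}" by auto
  with fin have "finite (range (\<lambda>w1 :: complex. [:w1:]))" by (rule finite_subset[rotated])
  then have "finite (UNIV :: complex set)" by (rule finite_imageD) (simp add: inj_on_def)
  then show False using infinite_UNIV_char_0 by blast
qed

definition pencil_det :: "nat \<Rightarrow> (nat \<times> nat \<times> nat \<Rightarrow> complex) \<Rightarrow> complex \<Rightarrow> complex \<Rightarrow> complex" where
  "pencil_det n T w0 w1 = det (mat n n (\<lambda>(i, j). T (0, i, j) * w0 + T (1, i, j) * w1))"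

lemma form_eval_det_pencil_mat: "form_eval w0 w1 (det (pencil_mat n n T)) = pencil_det n T w0 w1"
proof -
  interpret comm_ring_hom "form_eval w0 w1" by (rule comm_ring_hom_form_eval)
  have "map_mat (form_eval w0 w1) (pencil_mat n n T) = mat n n (\<lambda>(i, j). T (0, i, j) * w0 + T (1, i, j) * w1)"
    by (rule eq_matI) (auto simp: pencil_mat_def form_eval_lin_form)
  then show ?thesis
    unfolding pencil_det_def using hom_det[of "pencil_mat n n T"] by (simp only:)
qed

lemma pencil_det_scale: "pencil_det n T (c * w0) (c * w1) = c ^ n * pencil_det n T w0 w1"
proof -
  have "mat n n (\<lambda>(i, j). T (0, i, j) * (c * w0) + T (1, i, j) * (c * w1)) =
    c \<cdot>\<^sub>m mat n n (\<lambda>(i, j). T (0, i, j) * w0 + T (1, i, j) * w1)"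
    by (rule eq_matI) (auto simp: algebra_simps)
  then show ?thesis by (simp add: pencil_det_def)
qed

text \<open>Restriction of the determinant to the line \<open>(z, z \<tau> + 1)\<close>.\<close>

definition line_det :: "nat \<Rightarrow> complex \<Rightarrow> (nat \<times> nat \<times> nat \<Rightarrow> complex) \<Rightarrow> complex poly" where
  "line_det n \<tau> T = det (mat n n (\<lambda>(i, j). [:T (1, i, j), T (0, i, j) + \<tau> * T (1, i, j):]))"

lemma poly_line_det: "poly (line_det n \<tau> T) z = pencil_det n T z (z * \<tau> + 1)"
proof -
  interpret comm_ring_hom "\<lambda>p. poly p z" by unfold_locales simp_all
  have "map_mat (\<lambda>p. poly p z) (mat n n (\<lambda>(i, j). [:T (1, i, j), T (0, i, j) + \<tau> * T (1, i, j):]))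
    = mat n n (\<lambda>(i, j). T (0, i, j) * z + T (1, i, j) * (z * \<tau> + 1))"
    by (rule eq_matI) (auto simp: algebra_simps)
  then show ?thesis
    unfolding line_det_def pencil_det_def
    using hom_det[of "mat n n (\<lambda>(i, j). [:T (1, i, j), T (0, i, j) + \<tau> * T (1, i, j):])"] by (simp only:)
qed

lemma degree_coeff_prod_linear:
  "finite A \<Longrightarrow> degree (\<Prod>i\<in>A. [:a i, b i:]) \<le> card A \<and>
    coeff (\<Prod>i\<in>A. [:a i, b i :: complex:]) (card A) = (\<Prod>i\<in>A. b i)"
proof (induction A rule: finite_induct)
  case (insert i A)
  have "degree ([:a i, b i:] * (\<Prod>i\<in>A. [:a i, b i:])) \<le> 1 + card A"
    using insert.IH by (intro degree_mult_le[THEN order_trans] add_mono) auto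
  moreover have "coeff ([:a i, b i:] * (\<Prod>i\<in>A. [:a i, b i:])) (Suc (card A)) = b i * (\<Prod>i\<in>A. b i)"
    using insert.IH by (simp add: coeff_eq_0)
  ultimately show ?case using insert.hyps by simp
qed simp

lemma line_det_expansion:
  "line_det n \<tau> T = (\<Sum>p | p permutes {0..<n}. signof p *
     (\<Prod>i=0..<n. [:T (1, i, p i), T (0, i, p i) + \<tau> * T (1, i, p i):]))"
  unfolding line_det_def det_def
  by (auto intro!: sum.cong arg_cong2[of _ _ _ _ "(*)"] prod.cong simp: permutes_in_image)

lemma signof_poly: "(signof p :: complex poly) = [:signof p:]"
  by (simp add: sign_def one_pCons)

lemma degree_line_det: "degree (line_det n \<tau> T) \<le> n"
  unfolding line_det_expansion
proof (rule degree_sum_le)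
  fix p assume "p \<in> {p. p permutes {0..<n}}"
  show "degree (signof p * (\<Prod>i=0..<n. [:T (1, i, p i), T (0, i, p i) + \<tau> * T (1, i, p i):])) \<le> n"
    using degree_coeff_prod_linear[of "{0..<n}" "\<lambda>i. T (1, i, p i)" "\<lambda>i. T (0, i, p i) + \<tau> * T (1, i, p i)"]
    unfolding signof_poly by (intro degree_mult_le[THEN order_trans]) simp
qed (simp add: finite_permutations)

text \<open>(1, \<tau>) is the point at infinity of the line, so nonvanishing there means that the
  restriction has full degree.\<close>

lemma coeff_line_det: "coeff (line_det n \<tau> T) n = pencil_det n T 1 \<tau>"
proof -
  have "pencil_det n T 1 \<tau> = (\<Sum>p | p permutes {0..<n}. signof p *
     (\<Prod>i=0..<n. T (0, i, p i) + \<tau> * T (1, i, p i)))"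
    unfolding pencil_det_def det_def
    by (auto intro!: sum.cong arg_cong2[of _ _ _ _ "(*)"] prod.cong simp: permutes_in_image mult.commute)
  moreover have "coeff (signof p * (\<Prod>i=0..<n. [:T (1, i, p i), T (0, i, p i) + \<tau> * T (1, i, p i):])) n
    = signof p * (\<Prod>i=0..<n. T (0, i, p i) + \<tau> * T (1, i, p i))" for p
    using degree_coeff_prod_linear[of "{0..<n}" "\<lambda>i. T (1, i, p i)" "\<lambda>i. T (0, i, p i) + \<tau> * T (1, i, p i)"]
    unfolding signof_poly by simp
  ultimately show ?thesis unfolding line_det_expansion coeff_sum by simp
qed

definition poly_family :: "'i set \<Rightarrow> (('i \<Rightarrow> complex) \<Rightarrow> complex poly) \<Rightarrow> bool" where
  "poly_family J p \<longleftrightarrow> (\<forall>e. (\<lambda>x. coeff (p x) e) \<in> poly_on J)"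

lemma poly_family_line_det:
  assumes "\<And>l i j. l < 2 \<Longrightarrow> i < n \<Longrightarrow> j < n \<Longrightarrow> (\<lambda>x. T x (l, i, j)) \<in> poly_on J"
  shows "poly_family J (\<lambda>x. line_det n \<tau> (T x))"
proof -
  have mult: "poly_family J (\<lambda>x. p x * q x)" if "poly_family J p" "poly_family J q" for p q
    using that unfolding poly_family_def coeff_mult by (intro allI poly_on_sum poly_on.mult) blast+
  have const: "poly_family J (\<lambda>x. c)" for c
    unfolding poly_family_def by (intro allI poly_on.const)
  have prod: "poly_family J (\<lambda>x. \<Prod>i\<in>A. f i x)" if "finite A" "\<And>i. i \<in> A \<Longrightarrow> poly_family J (f i)"
    for A :: "nat set" and f
    using that by (induction A rule: finite_induct) (auto intro: mult const)
  have lin: "poly_family J (\<lambda>x. [:f x, g x:])" if "f \<in> poly_on J" "g \<in> poly_on J" for f g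
    unfolding poly_family_def
  proof
    fix e :: nat
    consider "e = 0" | "e = 1" | e' where "e = Suc (Suc e')" by (metis One_nat_def not0_implies_Suc)
    then show "(\<lambda>x. coeff [:f x, g x:] e) \<in> poly_on J"
      using that by cases (simp_all add: poly_on.const)
  qed
  have sum: "poly_family J (\<lambda>x. \<Sum>i\<in>A. f i x)" if "\<And>i. i \<in> A \<Longrightarrow> poly_family J (f i)"
    for A :: "(nat \<Rightarrow> nat) set" and f
    using that unfolding poly_family_def coeff_sum by (intro allI poly_on_sum) blast
  show ?thesis
    unfolding line_det_expansion
    by (intro sum mult const prod lin assms poly_on.add poly_on.mult poly_on.const)
      (auto simp: permutes_in_image)
qed

lemma poly_eq_sum_atMost: "degree (p :: complex poly) \<le> n \<Longrightarrow> poly p z = (\<Sum>k\<le>n. coeff p k * z ^ k)"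
  unfolding poly_altdef by (intro sum.mono_neutral_left) (auto simp: coeff_eq_0)

lemma poly_on_poly_family:
  assumes "poly_family J p" "\<And>x. degree (p x) \<le> n" "j \<in> J"
  shows "(\<lambda>x. poly (p x) (x j)) \<in> poly_on J"
proof -
  have "poly (p x) (x j) = (\<Sum>k\<le>n. coeff (p x) k * x j ^ k)" for x
    by (rule poly_eq_sum_atMost[OF assms(2)])
  then show ?thesis
    using assms by (auto simp: poly_family_def intro!: poly_on_intros poly_on.coord)
qed

text \<open>Division by a monic linear factor: Horner's recursion gives the quotient from the top
  coefficient downwards, and no denominators arise.\<close>

lemma poly_family_synthetic_div:
  assumes p: "poly_family J p" "\<And>x. degree (p x) \<le> n" and j: "j \<in> J"
  shows "poly_family J (\<lambda>x. synthetic_div (p x) (x j))"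
proof -
  let ?q = "\<lambda>x. synthetic_div (p x) (x j)"
  have rec: "coeff (?q x) e = coeff (p x) (Suc e) + x j * coeff (?q x) (Suc e)" for x e
    using arg_cong[OF synthetic_div_correct[of "p x" "x j"], of "\<lambda>r. coeff r (Suc e)"] by simp
  have "n \<le> e + d \<Longrightarrow> (\<lambda>x. coeff (?q x) e) \<in> poly_on J" for e d
  proof (induction d arbitrary: e)
    case 0
    have "degree (?q x) < Suc e" "degree (p x) < Suc e" for x
      using 0 p(2)[of x] by (simp_all add: degree_synthetic_div)
    then have "coeff (?q x) e = 0" for x
      by (subst rec) (simp add: coeff_eq_0)
    then show ?case by (simp add: poly_on.const)
  next
    case (Suc d)
    then have "(\<lambda>x. coeff (?q x) (Suc e)) \<in> poly_on J" by simp
    then have "(\<lambda>x. coeff (p x) (Suc e) + x j * coeff (?q x) (Suc e)) \<in> poly_on J"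
      using p(1) j by (auto simp: poly_family_def intro!: poly_on.intros)
    then show ?case by (simp only: rec[symmetric])
  qed
  from this[of _ n] show ?thesis by (simp add: poly_family_def)
qed

text \<open>The pencil is the product of \<open>G\<close>, the diagonal matrix of the forms, and the
  remaining rows.\<close>

lemma pencil_det_row_family:
  assumes s: "s > 0" and ms: "m * s \<le> n"
    and T: "T = tens n n (\<lambda>l i j. \<Sum>u<n. G i u * scaled_rows m s \<tau> \<rho> M l u j)"
  shows "pencil_det n T w0 w1 = (\<Prod>k<m * s. root_form \<tau> 0 (\<rho> (k div s)) * w0 + root_form \<tau> 1 (\<rho> (k div s)) * w1)
    * (det (mat n n (\<lambda>(i, u). G i u)) *
       det (mat n n (\<lambda>(u, j). if u < m * s then M 0 u j else M 0 u j * w0 + M 1 u j * w1)))"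
proof -
  define \<delta> where "\<delta> u = (if u < m * s then root_form \<tau> 0 (\<rho> (u div s)) * w0 + root_form \<tau> 1 (\<rho> (u div s)) * w1 else 1)" for u
  let ?G = "mat n n (\<lambda>(i, u). G i u)" and ?D = "mat n n (\<lambda>(i, j). if i = j then \<delta> i else 0)"
  let ?R = "mat n n (\<lambda>(u, j). if u < m * s then M 0 u j else M 0 u j * w0 + M 1 u j * w1)"
  have DR: "(?D * ?R) $$ (u, j) = \<delta> u * ?R $$ (u, j)" if "u < n" "j < n" for u j
    using that by (simp add: scalar_prod_def atLeast0LessThan sum_delta_lessThan)
  have "mat n n (\<lambda>(i, j). T (0, i, j) * w0 + T (1, i, j) * w1) = ?G * (?D * ?R)"
  proof (rule eq_matI)
    fix i j assume "i < dim_row (?G * (?D * ?R))" "j < dim_col (?G * (?D * ?R))"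
    then have ij: "i < n" "j < n" by auto
    have "(?G * (?D * ?R)) $$ (i, j) = (\<Sum>u<n. G i u * ((?D * ?R) $$ (u, j)))"
      using ij by (simp add: scalar_prod_def atLeast0LessThan)
    also have "\<dots> = (\<Sum>u<n. G i u * (\<delta> u * ?R $$ (u, j)))"
      using ij by (intro sum.cong) (simp_all only: DR lessThan_iff)
    also have "\<dots> = (\<Sum>u<n. G i u * scaled_rows m s \<tau> \<rho> M 0 u j * w0 + G i u * scaled_rows m s \<tau> \<rho> M 1 u j * w1)"
      using ij by (intro sum.cong refl) (auto simp: \<delta>_def scaled_rows_def algebra_simps)
    also have "\<dots> = T (0, i, j) * w0 + T (1, i, j) * w1"
      using ij by (simp add: T tens_apply sum.distrib sum_distrib_right)
    finally show "mat n n (\<lambda>(i, j). T (0, i, j) * w0 + T (1, i, j) * w1) $$ (i, j) = (?G * (?D * ?R)) $$ (i, j)"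
      using ij by simp
  qed simp_all
  moreover have carrier: "?G \<in> carrier_mat n n" "?D \<in> carrier_mat n n" "?R \<in> carrier_mat n n" by simp_all
  ultimately have "pencil_det n T w0 w1 = det ?G * (det ?D * det ?R)"
    unfolding pencil_det_def
    using det_mult[OF carrier(1) mult_carrier_mat[OF carrier(2,3)]] det_mult[OF carrier(2,3)] by metis
  moreover have "det ?D = (\<Prod>k<n. \<delta> k)"
  proof -
    have "upper_triangular ?D" by (auto simp: upper_triangular_def)
    then have "det ?D = prod_list (diag_mat ?D)" using carrier(2) by (rule det_upper_triangular)
    also have "\<dots> = (\<Prod>k=0..<n. ?D $$ (k, k))" by (simp add: prod_list_diag_prod)
    finally show ?thesis by (simp add: atLeast0LessThan)
  qed
  moreover have "(\<Prod>k<n. \<delta> k) = (\<Prod>k<m * s. \<delta> k)"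
    using ms by (intro prod.mono_neutral_right) (auto simp: \<delta>_def)
  moreover have "\<dots> = (\<Prod>k<m * s. root_form \<tau> 0 (\<rho> (k div s)) * w0 + root_form \<tau> 1 (\<rho> (k div s)) * w1)"
    by (intro prod.cong) (auto simp: \<delta>_def)
  ultimately show ?thesis by simp
qed

lemma line_det_row_family:
  assumes s: "s > 0" and ms: "m * s \<le> n"
    and T: "T = tens n n (\<lambda>l i j. \<Sum>u<n. G i u * scaled_rows m s \<tau> \<rho> M l u j)"
  shows "\<exists>R. line_det n \<tau> T = (\<Prod>k<m * s. [:- \<rho> (k div s), 1:]) * R"
proof -
  let ?R = "smult (det (mat n n (\<lambda>(i, u). G i u)))
    (det (mat n n (\<lambda>(u, j). if u < m * s then [:M 0 u j:] else [:M 1 u j, M 0 u j + \<tau> * M 1 u j:])))"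
  have "line_det n \<tau> T = (\<Prod>k<m * s. [:- \<rho> (k div s), 1:]) * ?R"
  proof (rule poly_ext)
    fix z
    interpret comm_ring_hom "\<lambda>p :: complex poly. poly p z" by unfold_locales simp_all
    have "map_mat (\<lambda>p. poly p z) (mat n n (\<lambda>(u, j). if u < m * s then [:M 0 u j:] else [:M 1 u j, M 0 u j + \<tau> * M 1 u j:]))
      = mat n n (\<lambda>(u, j). if u < m * s then M 0 u j else M 0 u j * z + M 1 u j * (z * \<tau> + 1))"
      by (rule eq_matI) (auto simp: algebra_simps)
    then have "poly (det (mat n n (\<lambda>(u, j). if u < m * s then [:M 0 u j:] else [:M 1 u j, M 0 u j + \<tau> * M 1 u j:]))) z
      = det (mat n n (\<lambda>(u, j). if u < m * s then M 0 u j else M 0 u j * z + M 1 u j * (z * \<tau> + 1)))"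
      using hom_det[of "mat n n (\<lambda>(u, j). if u < m * s then [:M 0 u j:] else [:M 1 u j, M 0 u j + \<tau> * M 1 u j:])"]
      by (simp only:)
    moreover have "root_form \<tau> 0 c * z + root_form \<tau> 1 c * (z * \<tau> + 1) = - c + z" for c
      by (simp add: root_form_def algebra_simps)
    ultimately show "poly (line_det n \<tau> T) z = poly ((\<Prod>k<m * s. [:- \<rho> (k div s), 1:]) * ?R) z"
      by (simp add: poly_line_det pencil_det_row_family[OF s ms T] poly_prod)
  qed
  then show ?thesis by blast
qed

section \<open>Coincident root loci\<close>

lemma complex_root_exists: "n > 0 \<Longrightarrow> \<exists>r :: complex. r ^ n = c"
proof (cases "c = 0")
  case True
  assume "n > 0"
  then show ?thesis using True by (intro exI[of _ 0]) simp
next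
  case False
  assume "n > 0"
  then have "card {z. z ^ n = c} \<noteq> 0" using card_nth_roots[OF False] by simp
  then have "{z. z ^ n = c} \<noteq> {}" by (metis card.empty)
  then show ?thesis by blast
qed

lemma zero_mem_coincident_root_locus:
  assumes "j < length parts" "parts ! j > 0"
  shows "0 \<in> coincident_root_locus parts"
proof -
  have "(\<Prod>j<length parts. lin_form 0 0 ^ (parts ! j)) = 0"
    using assms by (intro prod_zero) (auto intro!: bexI[of _ j] simp: zero_power)
  then show ?thesis unfolding coincident_root_locus_def mem_Collect_eq
    by (intro exI[of _ "\<lambda>_. 0"]) simp
qed

lemma prod_lessThan_add:
  fixes f :: "nat \<Rightarrow> 'a :: comm_monoid_mult"
  shows "(\<Prod>u<a + b. f u) = (\<Prod>u<a. f u) * (\<Prod>y<b. f (a + y))"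
proof -
  have "(\<Prod>u<a + b. f u) = (\<Prod>u\<in>{0..<a}. f u) * (\<Prod>u\<in>{a..<a + b}. f u)"
    by (simp add: lessThan_atLeast0 prod.atLeastLessThan_concat)
  then show ?thesis
    using prod.shift_bounds_nat_ivl[of f 0 a b] by (simp add: atLeast0LessThan add.commute)
qed

lemma prod_replicate_append:
  fixes f :: "nat \<Rightarrow> 'a :: comm_monoid_mult"
  shows "(\<Prod>j<length (replicate m s @ replicate d 1). f j ^ ((replicate m s @ replicate d 1) ! j))
    = (\<Prod>j<m. f j ^ s) * (\<Prod>j<d. f (m + j))"
  unfolding length_append length_replicate prod_lessThan_add
  by (intro arg_cong2[of _ _ _ _ "(*)"] prod.cong refl) (simp_all add: nth_append)

lemma prod_div_lessThan:
  fixes f :: "nat \<Rightarrow> 'a :: comm_monoid_mult"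
  assumes s: "s > 0"
  shows "(\<Prod>k<m * s. f (k div s)) = (\<Prod>i<m. f i ^ s)"
proof (induction m)
  case (Suc m)
  have "(\<Prod>k<Suc m * s. f (k div s)) = (\<Prod>k<m * s + s. f (k div s))"
    by (simp add: add.commute)
  also have "\<dots> = (\<Prod>i<m. f i ^ s) * (\<Prod>y<s. f ((m * s + y) div s))"
    by (simp only: prod_lessThan_add Suc)
  also have "(\<Prod>y<s. f ((m * s + y) div s)) = (\<Prod>y<s. f m)"
    using s by (intro prod.cong) auto
  finally show ?case by simp
qed simp

text \<open>A determinant that does not vanish at \<open>(1, \<tau>)\<close> is recovered from its restriction to the line.\<close>

lemma det_pencil_mem_coincident_root_locus:
  assumes s: "s > 0" and m: "m \<ge> 1" and n: "n = m * s + d"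
    and c: "pencil_det n T 1 \<tau> \<noteq> 0"
    and Q: "line_det n \<tau> T = (\<Prod>k<m * s. [:- \<rho> (k div s), 1:]) * Q"
  shows "det (pencil_mat n n T) \<in> coincident_root_locus (replicate m s @ replicate d 1)"
proof -
  let ?c = "pencil_det n T 1 \<tau>" and ?A = "\<Prod>k<m * s. [:- \<rho> (k div s), 1:]"
  have cn: "coeff (line_det n \<tau> T) n = ?c" by (rule coeff_line_det)
  then have deg: "degree (line_det n \<tau> T) = n"
    using degree_line_det[of n \<tau> T] c le_degree[of "line_det n \<tau> T" n] by simp
  have A: "degree ?A = m * s" "lead_coeff ?A = 1" "?A \<noteq> 0"
    by (simp add: degree_prod_eq_sum_degree, simp only: lead_coeff_prod, simp, simp add: prod_zero_iff)
  have "Q \<noteq> 0" using deg c cn Q by auto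
  then have degQ: "degree Q = d"
    using deg A n degree_mult_eq[of ?A Q] unfolding Q by simp
  have "lead_coeff (line_det n \<tau> T) = ?c" using deg cn by simp
  then have lcQ: "lead_coeff Q = ?c" unfolding Q lead_coeff_mult A(2) by simp
  obtain \<sigma> where \<sigma>: "smult (lead_coeff Q) (\<Prod>j<degree Q. [:- \<sigma> j, 1:]) = Q"
    by (rule complex_poly_decompose')
  have "coeff Q d = ?c" using lcQ by (simp add: degQ)
  note \<sigma> = \<sigma>[unfolded degQ this]
  have val: "pencil_det n T z (z * \<tau> + 1) = ?c * (\<Prod>i<m. (z - \<rho> i) ^ s) * (\<Prod>j<d. (z - \<sigma> j))" for z
  proof -
    have "pencil_det n T z (z * \<tau> + 1) = poly ?A z * poly Q z"
      by (simp only: poly_line_det[symmetric] Q poly_mult)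
    also have "poly ?A z = (\<Prod>i<m. (z - \<rho> i) ^ s)"
      using prod_div_lessThan[OF s, of "\<lambda>i. z - \<rho> i" m] by (simp add: poly_prod)
    also have "poly Q z = ?c * (\<Prod>j<d. (z - \<sigma> j))"
      by (subst \<sigma>[symmetric]) (simp add: poly_prod)
    finally show ?thesis by simp
  qed
  have pow: "w ^ n = (w ^ s) ^ m * w ^ d" for w :: complex
    by (simp add: n power_add mult.commute[of m s] power_mult)
  have form: "pencil_det n T w0 w1 = ?c * (\<Prod>i<m. ((1 + \<tau> * \<rho> i) * w0 + - \<rho> i * w1) ^ s)
    * (\<Prod>j<d. (1 + \<tau> * \<sigma> j) * w0 + - \<sigma> j * w1)" for w0 w1
  proof (cases "w1 = \<tau> * w0")
    case True
    have "pencil_det n T w0 w1 = w0 ^ n * ?c"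
      using pencil_det_scale[of n T w0 1 \<tau>] True by (simp add: mult.commute)
    then show ?thesis using True by (simp add: algebra_simps pow)
  next
    case False
    \<comment> \<open>By homogeneity every point off the direction (1, \<tau>) is \<open>b\<close>
      times a point of the line.\<close>
    define b where "b = w1 - \<tau> * w0"
    have b: "b \<noteq> 0" using False by (simp add: b_def)
    have "pencil_det n T w0 w1 = pencil_det n T (b * (w0 / b)) (b * (w0 / b * \<tau> + 1))"
      using b by (simp add: distrib_left) (simp add: b_def mult.commute)
    also have "\<dots> = b ^ n * (?c * (\<Prod>i<m. (w0 / b - \<rho> i) ^ s) * (\<Prod>j<d. (w0 / b - \<sigma> j)))"
      by (simp only: pencil_det_scale val)
    also have "\<dots> = ?c * (\<Prod>i<m. (b * (w0 / b - \<rho> i)) ^ s) * (\<Prod>j<d. b * (w0 / b - \<sigma> j))"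
      by (simp add: pow power_mult_distrib prod.distrib mult_ac)
    also have "\<dots> = ?c * (\<Prod>i<m. ((1 + \<tau> * \<rho> i) * w0 + - \<rho> i * w1) ^ s)
      * (\<Prod>j<d. (1 + \<tau> * \<sigma> j) * w0 + - \<sigma> j * w1)"
    proof -
      have "b * (w0 / b - x) = (1 + \<tau> * x) * w0 + - x * w1" for x
        using b by (simp add: right_diff_distrib) (simp add: b_def algebra_simps)
      then show ?thesis by simp
    qed
    finally show ?thesis .
  qed
  \<comment> \<open>The factor \<open>?c\<close> is absorbed into the first linear form, which
    occurs with exponent \<open>s\<close>.\<close>
  obtain r where r: "r ^ s = ?c" using complex_root_exists[OF s] by blast
  define \<nu> where "\<nu> j = (if j < m then \<rho> j else \<sigma> (j - m))" for j
  define h where "h j = (if j = 0 then r else 1)" for j :: nat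
  have "det (pencil_mat n n T) = (\<Prod>j<length (replicate m s @ replicate d 1).
    lin_form (h j * (1 + \<tau> * \<nu> j)) (h j * - \<nu> j) ^ ((replicate m s @ replicate d 1) ! j))"
  proof (rule form_eqI)
    fix w0 w1
    let ?l = "\<lambda>x. (1 + \<tau> * x) * w0 + - x * w1"
    have "form_eval w0 w1 (\<Prod>j<length (replicate m s @ replicate d 1).
      lin_form (h j * (1 + \<tau> * \<nu> j)) (h j * - \<nu> j) ^ ((replicate m s @ replicate d 1) ! j))
      = (\<Prod>j<length (replicate m s @ replicate d 1). (h j * ?l (\<nu> j)) ^ ((replicate m s @ replicate d 1) ! j))"
    proof -
      have "h j * (1 + \<tau> * \<nu> j) * w0 + h j * - \<nu> j * w1 = h j * ?l (\<nu> j)" for j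
        by (simp add: algebra_simps)
      then show ?thesis unfolding form_eval_prod form_eval_power form_eval_lin_form by (simp only:)
    qed
    also have "\<dots> = (\<Prod>j<m. (h j * ?l (\<nu> j)) ^ s) * (\<Prod>j<d. h (m + j) * ?l (\<nu> (m + j)))"
      by (rule prod_replicate_append)
    also have "(\<Prod>j<d. h (m + j) * ?l (\<nu> (m + j))) = (\<Prod>j<d. ?l (\<sigma> j))"
      using m by (intro prod.cong) (auto simp: h_def \<nu>_def)
    also have "(\<Prod>j<m. (h j * ?l (\<nu> j)) ^ s) = (\<Prod>j<m. h j ^ s) * (\<Prod>j<m. ?l (\<rho> j) ^ s)"
      by (simp add: power_mult_distrib prod.distrib \<nu>_def)
    also have "(\<Prod>j<m. h j ^ s) = ?c"
    proof -
      have "(\<Prod>j<m. h j ^ s) = (\<Prod>j\<in>{0}. h j ^ s)"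
        using m by (intro prod.mono_neutral_right) (auto simp: h_def)
      then show ?thesis by (simp add: h_def r)
    qed
    finally have prod: "form_eval w0 w1 (\<Prod>j<length (replicate m s @ replicate d 1).
      lin_form (h j * (1 + \<tau> * \<nu> j)) (h j * - \<nu> j) ^ ((replicate m s @ replicate d 1) ! j))
      = ?c * (\<Prod>i<m. ?l (\<rho> i) ^ s) * (\<Prod>j<d. ?l (\<sigma> j))" .
    show "form_eval w0 w1 (det (pencil_mat n n T)) = form_eval w0 w1 (\<Prod>j<length (replicate m s @ replicate d 1).
      lin_form (h j * (1 + \<tau> * \<nu> j)) (h j * - \<nu> j) ^ ((replicate m s @ replicate d 1) ! j))"
      unfolding prod form_eval_det_pencil_mat by (rule form)
  qed
  then show ?thesis
    unfolding coincident_root_locus_def mem_Collect_eq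
    by (intro exI[of _ "\<lambda>j. h j * (1 + \<tau> * \<nu> j)"] exI[of _ "\<lambda>j. h j * - \<nu> j"])
qed

lemma synthetic_div_mult_linear: "synthetic_div ([:- c, 1:] * q) c = (q :: complex poly)"
proof -
  have "[:- c, 1:] * synthetic_div ([:- c, 1:] * q) c + [:poly ([:- c, 1:] * q) c:] = [:- c, 1:] * q"
    by (rule synthetic_div_correct')
  then have "[:- c, 1:] * synthetic_div ([:- c, 1:] * q) c = [:- c, 1:] * q" by simp
  then show ?thesis by (subst (asm) mult_cancel_left) simp
qed

text \<open>Divides by each root \<open>s\<close> times in turn. It is defined also when a division
  is not exact, so that divisibility becomes the vanishing of remainders that are polynomial in the
  coefficients and the roots.\<close>

primrec div_chain :: "nat \<Rightarrow> complex poly \<Rightarrow> (nat \<Rightarrow> complex) \<Rightarrow> nat \<Rightarrow> complex poly" where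
  "div_chain s p r 0 = p"
| "div_chain s p r (Suc k) = synthetic_div (div_chain s p r k) (r (k div s))"

lemma div_chain_factor:
  assumes "p = (\<Prod>k<N. [:- r (k div s), 1:]) * R"
  shows "k \<le> N \<Longrightarrow> div_chain s p r k = (\<Prod>k\<in>{k..<N}. [:- r (k div s), 1:]) * R"
proof (induction k)
  case 0
  then show ?case using assms by (simp add: lessThan_atLeast0)
next
  case (Suc k)
  then have "div_chain s p r k = [:- r (k div s), 1:] * ((\<Prod>k\<in>{Suc k..<N}. [:- r (k div s), 1:]) * R)"
    by (simp only: prod.atLeast_Suc_lessThan[of k N] Suc_le_eq less_imp_le mult.assoc)
  then show ?case by (simp only: div_chain.simps synthetic_div_mult_linear)
qed

lemma div_chain_exact:
  "(\<And>k. k < N \<Longrightarrow> poly (div_chain s p r k) (r (k div s)) = 0) \<Longrightarrow>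
    p = (\<Prod>k<N. [:- r (k div s), 1:]) * div_chain s p r N"
proof (induction N)
  case (Suc N)
  have "[:- r (N div s), 1:] * synthetic_div (div_chain s p r N) (r (N div s)) = div_chain s p r N"
    using synthetic_div_correct'[of "r (N div s)" "div_chain s p r N"] Suc.prems[of N] by simp
  then have "div_chain s p r N = [:- r (N div s), 1:] * div_chain s p r (Suc N)" by simp
  moreover have "p = (\<Prod>k<N. [:- r (k div s), 1:]) * div_chain s p r N"
    using Suc.prems by (intro Suc.IH) simp
  ultimately have "p = (\<Prod>k<N. [:- r (k div s), 1:]) * ([:- r (N div s), 1:] * div_chain s p r (Suc N))"
    by (simp only:)
  then show ?case by (simp only: prod.lessThan_Suc mult.assoc)
qed simp

lemma degree_div_chain: "degree (div_chain s p r k) \<le> degree p"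
  by (induction k) (simp_all add: degree_synthetic_div)

lemma poly_family_div_chain:
  assumes F: "poly_family J F" "\<And>x. degree (F x) \<le> n" and r: "\<And>k. k < N \<Longrightarrow> r (k div s) \<in> J"
  shows "k \<le> N \<Longrightarrow> poly_family J (\<lambda>x. div_chain s (F x) (\<lambda>i. x (r i)) k)"
proof (induction k)
  case (Suc k)
  have deg: "degree (div_chain s (F x) (\<lambda>i. x (r i)) k) \<le> n" for x
    using degree_div_chain F(2) by (rule order_trans)
  have "poly_family J (\<lambda>x. div_chain s (F x) (\<lambda>i. x (r i)) k)" "r (k div s) \<in> J"
    using Suc r by simp_all
  then show ?case
    unfolding div_chain.simps
    by (intro poly_family_synthetic_div[where p = "\<lambda>x. div_chain s (F x) (\<lambda>i. x (r i)) k", OF _ deg])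
qed (simp add: F)

text \<open>The roots \<open>\<rho>\<^sub>i\<close> are integral over the coefficients of the determinant, whose leading coefficient
  does not vanish at \<open>T\<close>. So they extend to every point of the closure, and divisibility by
  \<open>\<Prod>\<^sub>i (z - \<rho>\<^sub>i)\<^sup>s\<close> is a closed condition on the pair of \<open>T\<close> and \<open>\<rho>\<close>.\<close>

lemma det_closure_mem_coincident_root_locus:
  assumes m: "m \<ge> 1" and s: "s > 0" and n: "n = m * s + (m - 1) * \<kappa>"
    and T: "T \<in> zcl (tri_image m (s + \<kappa>) m n n)"
  shows "det (pencil_mat n n T) \<in> coincident_root_locus (replicate m s @ replicate ((m - 1) * \<kappa>) 1)"
proof (cases "\<exists>\<tau>. pencil_det n T 1 \<tau> \<noteq> 0")
  case False
  have "det (pencil_mat n n T) = 0"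
  proof (rule form_eqI)
    fix w0 w1
    let ?p = "poly (det (pencil_mat n n T)) [:w1:]"
    have "poly ?p w = 0" if "w \<noteq> 0" for w
    proof -
      have "poly ?p w = pencil_det n T (w * 1) (w * (w1 / w))"
        using form_eval_det_pencil_mat[of w w1 n T] that by (simp add: form_eval_def)
      also have "\<dots> = 0" using False by (simp only: pencil_det_scale) simp
      finally show ?thesis .
    qed
    then have "UNIV - {0} \<subseteq> {w. poly ?p w = 0}" by auto
    moreover have "infinite (UNIV - {0 :: complex})"
      using infinite_UNIV_char_0 by (simp add: infinite_remove)
    ultimately have "?p = 0" using poly_roots_finite[of ?p] finite_subset by blast
    then show "form_eval w0 w1 (det (pencil_mat n n T)) = form_eval w0 w1 0"
      by (simp add: form_eval_def)
  qed
  moreover have "(replicate m s @ replicate ((m - 1) * \<kappa>) 1) ! 0 > 0"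
    using m s by (simp add: nth_append)
  ultimately show ?thesis
    using m zero_mem_coincident_root_locus[of 0 "replicate m s @ replicate ((m - 1) * \<kappa>) 1"] by simp
next
  case True
  then obtain \<tau> where \<tau>: "pencil_det n T 1 \<tau> \<noteq> 0" by blast
  have ms: "m * s \<le> n" using n by simp
  have T': "T \<in> zcl (row_family n n m s \<tau>)"
    using T zcl_least[OF tri_image_subset_zcl_row_family[OF m s n, of n \<tau>]] by blast
  define E where "E G \<rho> M = tens n n (\<lambda>l i j. \<Sum>u<n. G i u * scaled_rows m s \<tau> \<rho> M l u j)" for G \<rho> M
  define \<Gamma> where "\<Gamma> = {case_sum (E G \<rho> M) \<rho> | G \<rho> M. True}"
  let ?J = "\<lambda>i. Inl ` tensor_index 2 n n \<union> Inr ` {..<i} :: ((nat \<times> nat \<times> nat) + nat) set"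
  define F where "F x = line_det n \<tau> (\<lambda>q. x (Inl q))" for x :: "(nat \<times> nat \<times> nat) + nat \<Rightarrow> complex"
  have F: "poly_family (?J i) F" for i
    unfolding F_def by (rule poly_family_line_det) (auto intro: poly_on.coord)
  have degF: "degree (F x) \<le> n" for x
    unfolding F_def by (rule degree_line_det)
  have \<Gamma>: "\<exists>R. F x = (\<Prod>k<m * s. [:- x (Inr (k div s)), 1:]) * R" if x: "x \<in> \<Gamma>" for x
  proof -
    obtain G \<rho> M where "x = case_sum (E G \<rho> M) \<rho>" using x unfolding \<Gamma>_def by blast
    then have "(\<lambda>q. x (Inl q)) = E G \<rho> M" "\<And>i. x (Inr i) = \<rho> i" by simp_all
    then show ?thesis
      using line_det_row_family[OF s ms E_def[of G \<rho> M]] by (simp add: F_def)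
  qed
  have "i \<le> m \<Longrightarrow> \<exists>y. (\<forall>q. y (Inl q) = T q) \<and> closure_point \<Gamma> (?J i) y" for i
  proof (induction i)
    case 0
    have "closure_point \<Gamma> (?J 0) (case_sum T (\<lambda>_. 0))"
      unfolding closure_point_def
    proof (intro ballI impI)
      fix P assume P: "P \<in> poly_on (?J 0)" "vanishes_on \<Gamma> P"
      have "(\<lambda>y. P (case_sum y (\<lambda>_. 0))) \<in> poly_functions"
        unfolding poly_functions_eq
        by (rule poly_on_subst[OF P(1), of "\<lambda>y. case_sum y (\<lambda>_. 0)"]) (auto intro!: poly_on.coord)
      moreover have "P (case_sum y (\<lambda>_. 0)) = 0" if y: "y \<in> row_family n n m s \<tau>" for y
      proof -
        obtain G \<rho> M where y: "y = E G \<rho> M" using y unfolding row_family_def E_def by blast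
        have "P (case_sum y (\<lambda>_. 0)) = P (case_sum y \<rho>)"
          by (rule poly_on_cong[OF P(1)]) auto
        moreover have "case_sum y \<rho> \<in> \<Gamma>" unfolding \<Gamma>_def y by blast
        ultimately show ?thesis using P(2) by (simp add: vanishes_on_def)
      qed
      ultimately show "P (case_sum T (\<lambda>_. 0)) = 0"
        using zclD[OF T', of "\<lambda>y. P (case_sum y (\<lambda>_. 0))"] by blast
    qed
    then show ?case by (intro exI[of _ "case_sum T (\<lambda>_. 0)"]) simp
  next
    case (Suc i)
    then obtain y where y: "\<forall>q. y (Inl q) = T q" "closure_point \<Gamma> (?J i) y" by auto
    have Ty: "(\<lambda>q. y (Inl q)) = T" using y(1) by auto
    have ins: "insert (Inr i) (?J i) = ?J (Suc i)" by auto
    \<comment> \<open>The determinant itself is the relation for the next root. Its leading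
      coefficient depends on \<open>T\<close> alone and is nonzero by the choice of \<tau>, whatever
      roots were adjoined before.\<close>
    have "\<exists>t. closure_point \<Gamma> (insert (Inr i) (?J i)) (y(Inr i := t))"
    proof (rule closure_point_extend_integral[where b = "\<lambda>k x. coeff (F x) k" and e = n])
      show "(\<lambda>x. coeff (F x) k) \<in> poly_on (?J i)" for k
        using F[of i] by (simp add: poly_family_def)
      show "vanishes_on \<Gamma> (\<lambda>x. \<Sum>k\<le>n. coeff (F x) k * x (Inr i) ^ k)"
        unfolding vanishes_on_def
      proof
        fix x assume x: "x \<in> \<Gamma>"
        obtain R where R: "F x = (\<Prod>k<m * s. [:- x (Inr (k div s)), 1:]) * R" using \<Gamma>[OF x] by blast
        have "i * s < m * s" using Suc.prems s by simp
        moreover have "poly [:- x (Inr (i * s div s)), 1:] (x (Inr i)) = 0" using s by simp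
        ultimately have "poly (F x) (x (Inr i)) = 0"
          unfolding R poly_mult poly_prod
          by (intro mult_eq_0_iff[THEN iffD2] disjI1 prod_zero) blast+
        then show "(\<Sum>k\<le>n. coeff (F x) k * x (Inr i) ^ k) = 0"
          by (simp only: poly_eq_sum_atMost[OF degF])
      qed
      show "coeff (F y) n \<noteq> 0" using \<tau> by (simp add: F_def Ty coeff_line_det)
    qed (use y(2) in auto)
    then obtain t where "closure_point \<Gamma> (?J (Suc i)) (y(Inr i := t))" unfolding ins by blast
    moreover have "\<forall>q. (y(Inr i := t)) (Inl q) = T q" using y(1) by simp
    ultimately show ?case by (intro exI[of _ "y(Inr i := t)"] conjI)
  qed
  from this[of m] obtain y where y: "\<And>q. y (Inl q) = T q" "closure_point \<Gamma> (?J m) y" by auto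
  have Fy: "F y = line_det n \<tau> T" using y(1) by (simp add: F_def)
  have idx: "Inr (k div s) \<in> ?J m" if "k < m * s" for k
    using that s by (simp add: less_mult_imp_div_less)
  let ?C = "\<lambda>k x. div_chain s (F x) (\<lambda>i. x (Inr i)) k"
  have "poly (?C k y) (y (Inr (k div s))) = 0" if k: "k < m * s" for k
  proof -
    have "poly_family (?J m) (?C k)"
      using poly_family_div_chain[where F = F and n = n and r = Inr and N = "m * s", OF F degF idx less_imp_le[OF k]] .
    moreover have "degree (?C k x) \<le> n" for x
      using degree_div_chain degF by (rule order_trans)
    ultimately have "(\<lambda>x. poly (?C k x) (x (Inr (k div s)))) \<in> poly_on (?J m)"
      using idx[OF k] by (rule poly_on_poly_family)
    moreover have "vanishes_on \<Gamma> (\<lambda>x. poly (?C k x) (x (Inr (k div s))))"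
      unfolding vanishes_on_def
    proof
      fix x assume x: "x \<in> \<Gamma>"
      obtain R where R: "F x = (\<Prod>k<m * s. [:- x (Inr (k div s)), 1:]) * R" using \<Gamma>[OF x] by blast
      have "?C k x = (\<Prod>k\<in>{k..<m * s}. [:- x (Inr (k div s)), 1:]) * R"
        using div_chain_factor[of "F x" "\<lambda>i. x (Inr i)" s "m * s" R k, OF R] k by simp
      then have "poly (?C k x) (x (Inr (k div s)))
        = (\<Prod>k'\<in>{k..<m * s}. poly [:- x (Inr (k' div s)), 1:] (x (Inr (k div s)))) * poly R (x (Inr (k div s)))"
        by (simp only: poly_mult poly_prod)
      also have "(\<Prod>k'\<in>{k..<m * s}. poly [:- x (Inr (k' div s)), 1:] (x (Inr (k div s)))) = 0"
        using k by (intro prod_zero) (auto intro!: bexI[of _ k])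
      finally show "poly (?C k x) (x (Inr (k div s))) = 0" by simp
    qed
    ultimately show ?thesis using y(2) unfolding closure_point_def by blast
  qed
  then have "F y = (\<Prod>k<m * s. [:- y (Inr (k div s)), 1:]) * ?C (m * s) y"
    by (rule div_chain_exact)
  then show ?thesis
    unfolding Fy by (rule det_pencil_mem_coincident_root_locus[OF s m n \<tau>])
qed

text \<open>Products of \<open>n\<close> linear forms are dense: at \<open>\<Prod>\<^bsub>u < n\<^esub> (v\<^sub>1 - u v\<^sub>0)\<close> the values at
  \<open>(1, 0), \<dots>, (1, n - 1)\<close> can be moved independently through the \<open>u\<close>-th factor, and the value at
  \<open>(1, n)\<close> by scaling.\<close>

lemma products_of_linear_forms_dense:
  "affine_space {..<Suc n} \<subseteq>
    zcl {restrict_to {..<Suc n} (\<lambda>i. e * (\<Prod>u<n. (a u + b u * of_nat i))) | e a b. True}"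
    (is "_ \<subseteq> zcl ?S")
proof (rule affine_space_subset_zcl_if_tangent)
  show "?S \<subseteq> affine_space {..<Suc n}" by auto
  fix z :: "nat \<Rightarrow> complex"
  define d where "d u = z u / (\<Prod>u'\<in>{..<n} - {u}. (of_nat u - of_nat u'))" for u
  define D where "D i = (\<Sum>u<n. d u * (\<Prod>u'\<in>{..<n} - {u}. (of_nat i - of_nat u')))" for i
  define e where "e = (z n - D n) / (\<Prod>u<n. (of_nat n - of_nat u))"
  let ?\<gamma> = "\<lambda>t. restrict_to {..<Suc n} (\<lambda>i. (1 + t * e) * (\<Prod>u<n. (- of_nat u + t * d u + 1 * of_nat i)))"
  show "\<exists>\<gamma>. (\<forall>t. \<gamma> t \<in> ?S) \<and> \<gamma> 0 = restrict_to {..<Suc n} (\<lambda>i. \<Prod>u<n. (- of_nat u + of_nat i)) \<and>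
    (\<forall>q\<in>{..<Suc n}. ((\<lambda>t. \<gamma> t q) has_field_derivative z q) (at 0))"
  proof (intro exI[of _ ?\<gamma>] conjI ballI allI)
    fix t show "?\<gamma> t \<in> ?S"
      unfolding mem_Collect_eq
      by (rule exI[of _ "1 + t * e"], rule exI[of _ "\<lambda>u. - of_nat u + t * d u"], rule exI[of _ "\<lambda>u. 1"]) simp
  next
    fix i assume i: "i \<in> {..<Suc n}"
    have "((\<lambda>t. \<Prod>u<n. (- of_nat u + t * d u + 1 * of_nat i)) has_field_derivative
      (\<Sum>u<n. d u * (\<Prod>u'\<in>{..<n} - {u}. (- of_nat u' + 0 * d u' + 1 * of_nat i)))) (at 0)"
      by (rule has_field_derivative_prod) (auto intro!: derivative_eq_intros)
    then have "((\<lambda>t. \<Prod>u<n. (- of_nat u + t * d u + 1 * of_nat i)) has_field_derivative D i) (at 0)"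
      by (simp add: D_def)
    then have "((\<lambda>t. (1 + t * e) * (\<Prod>u<n. (- of_nat u + t * d u + 1 * of_nat i))) has_field_derivative
      e * (\<Prod>u<n. (of_nat i - of_nat u)) + D i) (at 0)"
      by (auto intro!: derivative_eq_intros)
    moreover have "e * (\<Prod>u<n. (of_nat i - of_nat u)) + D i = z i"
    proof (cases "i = n")
      case True
      have "(\<Prod>u<n. (of_nat n - of_nat u :: complex)) \<noteq> 0" by auto
      then show ?thesis using True by (simp add: e_def)
    next
      case False
      then have i: "i < n" using i by simp
      have 0: "(\<Prod>u<n. (of_nat i - of_nat u :: complex)) = 0"
        using i by (intro prod_zero) auto
      have "D i = (\<Sum>u\<in>{i}. d u * (\<Prod>u'\<in>{..<n} - {u}. (of_nat i - of_nat u')))"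
        unfolding D_def
      proof (rule sum.mono_neutral_right)
        show "\<forall>u\<in>{..<n} - {i}. d u * (\<Prod>u'\<in>{..<n} - {u}. (of_nat i - of_nat u')) = 0"
        proof
          fix u assume u: "u \<in> {..<n} - {i}"
          have "(\<Prod>u'\<in>{..<n} - {u}. (of_nat i - of_nat u' :: complex)) = 0"
            using u i by (intro prod_zero) auto
          then show "d u * (\<Prod>u'\<in>{..<n} - {u}. (of_nat i - of_nat u')) = 0" by simp
        qed
      qed (use i in auto)
      moreover have "(\<Prod>u'\<in>{..<n} - {i}. (of_nat i - of_nat u' :: complex)) \<noteq> 0" by auto
      ultimately show ?thesis using 0 by (simp add: d_def)
    qed
    ultimately show "((\<lambda>t. ?\<gamma> t i) has_field_derivative z i) (at 0)"
      using i by (simp add: restrict_to_def)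
  qed simp
qed

lemma surjective_mat_right_inverse:
  assumes X: "X \<in> carrier_mat n n'" and surj: "surjective_mat X"
  obtains R where "\<And>i i'. i < n \<Longrightarrow> i' < n \<Longrightarrow> (\<Sum>u<n'. X $$ (i, u) * R u i') = (if i = i' then 1 else 0)"
proof -
  have "\<exists>v\<in>carrier_vec n'. X *\<^sub>v v = unit_vec n i" for i
  proof -
    have "unit_vec n i \<in> (\<lambda>v. X *\<^sub>v v) ` carrier_vec n'"
      using surj X unfolding surjective_mat_def by auto
    then show ?thesis by auto
  qed
  then have "\<forall>i. \<exists>v. v \<in> carrier_vec n' \<and> X *\<^sub>v v = unit_vec n i" by blast
  from choice[OF this] obtain v where v: "\<And>i. v i \<in> carrier_vec n'" "\<And>i. X *\<^sub>v v i = unit_vec n i"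
    by blast
  have "(\<Sum>u<n'. X $$ (i, u) * v i' $ u) = (if i = i' then 1 else 0)" if "i < n" "i' < n" for i i'
  proof -
    have "(X *\<^sub>v v i') $ i = (\<Sum>u<n'. X $$ (i, u) * v i' $ u)"
      using X v(1)[of i'] that by (simp add: scalar_prod_def atLeast0LessThan)
    then show ?thesis using v(2)[of i'] that by simp
  qed
  then show ?thesis using that[of "\<lambda>u i. v i $ u"] by blast
qed

text \<open>The locus is parametrized by one scalar and the ratios of its linear forms, which are fewer
  than the \<open>n + 1\<close> values determining a form of degree \<open>n\<close>.\<close>

lemma coincident_root_locus_relation:
  assumes "length parts < n"
  obtains Q y where "Q \<in> poly_functions" "y \<in> affine_space {..<Suc n}" "Q y \<noteq> 0"
    "\<And>f. f \<in> coincident_root_locus parts \<Longrightarrow> Q (restrict_to {..<Suc n} (\<lambda>i. form_eval 1 (of_nat i) f)) = 0"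
proof -
  let ?N = "length parts"
  define g where "g i x = x ?N * (\<Prod>j<?N. (1 + x j * of_nat i) ^ (parts ! j))" for i and x :: "nat \<Rightarrow> complex"
  have "g i \<in> poly_on {..<Suc ?N}" for i
    unfolding g_def by (intro poly_on_intros poly_on.coord) auto
  moreover have "card {..<Suc ?N} < Suc n" using assms by simp
  ultimately obtain Q y where Q: "Q \<in> poly_functions" "y \<in> affine_space {..<Suc n}" "Q y \<noteq> 0"
    "\<And>x. Q (\<lambda>i. if i < Suc n then g i x else 0) = 0"
    using algebraic_dependence[of "{..<Suc ?N}" "Suc n" g] by blast
  have "Q (restrict_to {..<Suc n} (\<lambda>i. form_eval 1 (of_nat i) f)) = 0" if f: "f \<in> coincident_root_locus parts" for f
  proof -
    obtain c0 c1 where f: "f = (\<Prod>j<?N. lin_form (c0 j) (c1 j) ^ (parts ! j))"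
      using f unfolding coincident_root_locus_def by blast
    define V where "V x = restrict_to {..<Suc n} (\<lambda>i. \<Prod>j<?N. (x (Inl j) + x (Inr j) * of_nat i) ^ (parts ! j))"
      for x :: "nat + nat \<Rightarrow> complex"
    \<comment> \<open>Forms without a \<open>v0\<close> term have no ratio of coefficients; they are
      reached by density from those with nonzero \<open>c0 j\<close>.\<close>
    have "Q (V (case_sum c0 c1)) = 0"
    proof (rule poly_functions_zero_if_generic[of "\<lambda>x. Q (V x)" "\<lambda>x. \<Prod>j<?N. x (Inl j)" "\<lambda>_. 1"])
      show "(\<lambda>x. Q (V x)) \<in> poly_functions"
        unfolding poly_functions_eq
      proof (rule poly_functions_subst[of Q V, OF Q(1)])
        show "(\<lambda>x. V x i) \<in> poly_on UNIV" for i
          unfolding V_def restrict_to_def by (intro poly_on_intros poly_on.coord) auto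
      qed
      show "(\<lambda>x. \<Prod>j<?N. x (Inl j)) \<in> poly_functions"
        unfolding poly_functions_eq by (intro poly_on_intros poly_on.coord) auto
    next
      fix x :: "nat + nat \<Rightarrow> complex" assume nz: "(\<Prod>j<?N. x (Inl j)) \<noteq> 0"
      define w where "w j = (if j = ?N then \<Prod>j<?N. x (Inl j) ^ (parts ! j) else x (Inr j) / x (Inl j))" for j
      have "(\<Prod>j<?N. (x (Inl j) + x (Inr j) * of_nat i) ^ (parts ! j)) = g i w" for i
      proof -
        have "(\<Prod>j<?N. (x (Inl j) + x (Inr j) * of_nat i) ^ (parts ! j))
          = (\<Prod>j<?N. x (Inl j) ^ (parts ! j) * (1 + w j * of_nat i) ^ (parts ! j))"
        proof (intro prod.cong refl)
          fix j assume j: "j \<in> {..<?N}"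
          then have "x (Inl j) \<noteq> 0" using nz by auto
          then have "x (Inl j) + x (Inr j) * of_nat i = x (Inl j) * (1 + w j * of_nat i)"
            using j by (simp add: w_def distrib_left)
          then show "(x (Inl j) + x (Inr j) * of_nat i) ^ (parts ! j) = x (Inl j) ^ (parts ! j) * (1 + w j * of_nat i) ^ (parts ! j)"
            by (simp only: power_mult_distrib)
        qed
        then show ?thesis by (simp add: g_def prod.distrib w_def)
      qed
      then have "V x = (\<lambda>i. if i < Suc n then g i w else 0)"
        by (auto simp: V_def restrict_to_def fun_eq_iff)
      then show "Q (V x) = 0" using Q(4) by simp
    qed simp
    moreover have "form_eval 1 (of_nat i) f = (\<Prod>j<?N. (c0 j + c1 j * of_nat i) ^ (parts ! j))" for i
      by (simp add: f form_eval_prod form_eval_power form_eval_lin_form)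
    ultimately show ?thesis by (simp add: V_def)
  qed
  with Q(1,2,3) show ?thesis using that by blast
qed

text \<open>Right inverses of \<open>X1\<close> and \<open>X2\<close> make every pencil of size
  \<open>n\<close> occur. Determinants of diagonal ones are the products of linear forms, and since
  these are dense the relation \<open>Q\<close> is nonzero at one of them.\<close>

lemma generic_det_not_mem_coincident_root_locus:
  assumes X: "X1 \<in> carrier_mat n n1" "X2 \<in> carrier_mat n n2" "surjective_mat X1" "surjective_mat X2"
    and parts: "length parts < n"
  shows "\<exists>Z. nonempty_open_in (tensor_index 2 n1 n2) (tensor_space 2 n1 n2) Z \<and>
    (\<forall>T\<in>Z. det (pencil_act X1 X2 (pencil_mat n1 n2 T)) \<notin> coincident_root_locus parts)"
proof -
  obtain Q y where Q: "Q \<in> poly_functions" "y \<in> affine_space {..<Suc n}" "Q y \<noteq> 0"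
    "\<And>f. f \<in> coincident_root_locus parts \<Longrightarrow> Q (restrict_to {..<Suc n} (\<lambda>i. form_eval 1 (of_nat i) f)) = 0"
    using coincident_root_locus_relation[OF parts] by blast
  let ?P = "pencil_mult n n n1 n2 (\<lambda>i u. X1 $$ (i, u)) (\<lambda>j v. X2 $$ (j, v))"
  define V where "V T = restrict_to {..<Suc n} (\<lambda>i. pencil_det n (?P T) 1 (of_nat i))" for T
  have V: "restrict_to {..<Suc n} (\<lambda>i. form_eval 1 (of_nat i) (det (pencil_act X1 X2 (pencil_mat n1 n2 T)))) = V T" for T
    unfolding V_def pencil_act_pencil_mat[OF X(1,2)] form_eval_det_pencil_mat ..
  define h where "h T = Q (V T)" for T
  have h: "h \<in> poly_functions"
    unfolding h_def poly_functions_eq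
  proof (rule poly_functions_subst[of Q V, OF Q(1)])
    fix i
    have "(\<lambda>T. ?P T q) \<in> poly_on UNIV" for q
      using poly_pencil_mult by (simp add: poly_functions_eq)
    then show "(\<lambda>T. V T i) \<in> poly_on UNIV"
      unfolding V_def restrict_to_def pencil_det_def by (intro poly_on_if poly_on_det poly_on_intros)
  qed
  have "\<exists>e a b. Q (restrict_to {..<Suc n} (\<lambda>i. e * (\<Prod>u<n. (a u + b u * of_nat i)))) \<noteq> 0"
  proof (rule ccontr)
    assume "\<not> ?thesis"
    then have "Q x = 0" if "x \<in> {restrict_to {..<Suc n} (\<lambda>i. e * (\<Prod>u<n. (a u + b u * of_nat i))) | e a b. True}" for x
      using that by blast
    from zclD[OF subsetD[OF products_of_linear_forms_dense Q(2)] Q(1) this] Q(3) show False by blast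
  qed
  then obtain e a b where eab: "Q (restrict_to {..<Suc n} (\<lambda>i. e * (\<Prod>u<n. (a u + b u * of_nat i)))) \<noteq> 0" by blast
  obtain R1 where R1: "\<And>i i'. i < n \<Longrightarrow> i' < n \<Longrightarrow> (\<Sum>u<n1. X1 $$ (i, u) * R1 u i') = (if i = i' then 1 else 0)"
    using surjective_mat_right_inverse[OF X(1,3)] by blast
  obtain R2 where R2: "\<And>i i'. i < n \<Longrightarrow> i' < n \<Longrightarrow> (\<Sum>u<n2. X2 $$ (i, u) * R2 u i') = (if i = i' then 1 else 0)"
    using surjective_mat_right_inverse[OF X(2,4)] by blast
  \<comment> \<open>The scalar \<open>e\<close> goes into the first diagonal entry; there is one
    because \<open>parts\<close> is shorter than \<open>n\<close>.\<close>
  define c where "c u = (if u = 0 then e else 1)" for u :: nat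
  define D where "D = tens n n (\<lambda>l i j. if i = j then c i * (if l = 0 then a i else b i) else 0)"
  define T where "T = pencil_mult n1 n2 n n R1 R2 D"
  have PT: "?P T = D"
  proof -
    have "?P T = tens n n (\<lambda>l i j. \<Sum>w<n. \<Sum>x<n. (if i = w then 1 else 0) * D (l, w, x) * (if j = x then 1 else 0))"
      unfolding T_def pencil_mult_pencil_mult
      by (simp only: pencil_mult_def) (intro tens_cong sum.cong refl, simp add: R1 R2)
    also have "\<dots> = tens n n (\<lambda>l i j. D (l, i, j))"
      by (intro tens_cong) (simp add: sum_delta_lessThan sum_distrib_left[symmetric] mult.assoc)
    also have "\<dots> = D" by (rule tens_of_tensor) (simp add: D_def)
    finally show ?thesis .
  qed
  have "pencil_det n D 1 (of_nat i) = e * (\<Prod>u<n. (a u + b u * of_nat i))" for i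
  proof -
    let ?D = "mat n n (\<lambda>(u, v). D (0, u, v) * 1 + D (1, u, v) * of_nat i)"
    have D: "?D $$ (u, v) = (if u = v then c u * (a u + b u * of_nat i) else 0)" if "u < n" "v < n" for u v
      using that by (simp add: D_def tens_apply algebra_simps)
    have "upper_triangular ?D" by (rule upper_triangularI) (use D in auto)
    then have "det ?D = prod_list (diag_mat ?D)" by (rule det_upper_triangular[OF _ mat_carrier])
    also have "\<dots> = (\<Prod>u=0..<n. ?D $$ (u, u))" by (simp add: prod_list_diag_prod)
    also have "\<dots> = (\<Prod>u<n. c u * (a u + b u * of_nat i))"
      unfolding atLeast0LessThan by (intro prod.cong refl) (use D in simp)
    also have "\<dots> = (\<Prod>u<n. c u) * (\<Prod>u<n. (a u + b u * of_nat i))" by (rule prod.distrib)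
    also have "(\<Prod>u<n. c u) = (\<Prod>u\<in>{0}. c u)"
      using parts by (intro prod.mono_neutral_right) (auto simp: c_def)
    finally have det_D: "det ?D = (\<Prod>u\<in>{0}. c u) * (\<Prod>u<n. (a u + b u * of_nat i))" .
    show ?thesis unfolding pencil_det_def det_D by (simp add: c_def)
  qed
  then have hT: "h T \<noteq> 0" using eab by (simp add: h_def V_def PT)
  let ?Z = "tensor_space 2 n1 n2 - zero_locus (tensor_index 2 n1 n2) {h}"
  have "nonempty_open_in (tensor_index 2 n1 n2) (tensor_space 2 n1 n2) ?Z"
    unfolding nonempty_open_in_def
  proof
    have "T \<in> tensor_space 2 n1 n2" by (simp add: T_def pencil_mult_def)
    then have "T \<in> ?Z" using hT by (simp add: zero_locus_def)
    then show "?Z \<noteq> {}" by blast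
    have "openin (zariski (tensor_index 2 n1 n2)) ?Z"
      unfolding openin_zariski zariski_open_def using h by blast
    moreover have "?Z = ?Z \<inter> tensor_space 2 n1 n2" by blast
    ultimately show "openin (subtopology (zariski (tensor_index 2 n1 n2)) (tensor_space 2 n1 n2)) ?Z"
      unfolding openin_subtopology by blast
  qed
  moreover have "det (pencil_act X1 X2 (pencil_mat n1 n2 T)) \<notin> coincident_root_locus parts" if "T \<in> ?Z" for T
  proof
    assume "det (pencil_act X1 X2 (pencil_mat n1 n2 T)) \<in> coincident_root_locus parts"
    from Q(4)[OF this] have "h T = 0" by (simp only: V h_def)
    with that show False by (simp add: zero_locus_def)
  qed
  ultimately show ?thesis by blast
qed

section \<open>Filling cases and numerical formulas\<close>

lemma TNS_triangle_fills:
  assumes "tensor_space 2 n1 n2 \<subseteq> zcl (tri_image a k b n1 n2)"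
  shows "TNS_triangle a k b 2 n1 n2 = tensor_space 2 n1 n2"
  using assms by (auto simp: TNS_triangle_eq)

lemma tensor_space_subset_zcl_tri_image:
  assumes "tangent_full a b B" "n1 \<le> a * k" "n2 \<le> b * k"
  shows "tensor_space 2 n1 n2 \<subseteq> zcl (tri_image a k b n1 n2)"
proof -
  have "{tri a k b n1 n2 B X1 X2 | X1 X2. True} \<subseteq> tri_image a k b n1 n2"
    unfolding tri_image_def by blast
  then show ?thesis using tri_orbit_dense[OF assms] zcl_mono by blast
qed

lemma TNS_triangle_fills_unequal:
  assumes "a \<noteq> b" "n1 \<le> a * k" "n2 \<le> b * k"
  shows "TNS_triangle a k b 2 n1 n2 = tensor_space 2 n1 n2"
proof -
  consider "a < b" | "b < a" using assms(1) by linarith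
  then have "\<exists>B. tangent_full a b B"
    by cases (blast intro: tangent_full_shift tangent_full_transpose)+
  then show ?thesis
    using tensor_space_subset_zcl_tri_image[OF _ assms(2,3)] TNS_triangle_fills by blast
qed

lemma TNS_triangle_fills_equal:
  assumes m: "m \<ge> 1" and n: "n1 \<le> (m - 1) * k" "n2 \<le> m * k"
  shows "TNS_triangle m k m 2 n1 n2 = tensor_space 2 n1 n2"
proof -
  have "inj_on (of_nat :: nat \<Rightarrow> complex) {..m - 1}" by (auto simp: inj_on_def)
  from tangent_full_diag_column[OF this]
  obtain B where "tangent_full (m - 1) m B" using m by auto
  then have "tensor_space 2 n1 n2 \<subseteq> zcl (tri_image (m - 1) k m n1 n2)"
    by (rule tensor_space_subset_zcl_tri_image[OF _ n])
  moreover have "tri_image (m - 1) k m n1 n2 \<subseteq> tri_image m k m n1 n2"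
  proof
    fix T assume "T \<in> tri_image (m - 1) k m n1 n2"
    then obtain B X1 X2 where T: "T = tri (m - 1) k m n1 n2 B X1 X2" by (auto simp: tri_image_def)
    \<comment> \<open>An (m - 1) by m bond pencil is padded with a zero row.\<close>
    let ?B = "\<lambda>l x z. if x < m - 1 then B l x z else 0"
    have "T = tri m k m n1 n2 ?B X1 X2"
      unfolding T tri_def
      by (intro tens_cong sum.mono_neutral_cong_left) auto
    then show "T \<in> tri_image m k m n1 n2" unfolding tri_image_def by blast
  qed
  ultimately have "tensor_space 2 n1 n2 \<subseteq> zcl (tri_image m k m n1 n2)"
    by (rule order_trans[OF _ zcl_mono])
  then show ?thesis by (rule TNS_triangle_fills)
qed

lemma dimension_formula:
  fixes m k k1 k2 n1 n2 :: nat
  assumes m: "m \<ge> 1" and k: "k2 \<le> k1" "k1 < k" and n: "n1 = m * k - k1" "n2 = m * k - k2"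
  shows "int (n1 * n2 + (n1 - m * (k - k1)) * n2 + m * ((k - k1) * (n1 - (k - k1)) + 1)) =
    2 * (int m)^2 * (int k)^2 - int m * (int k)^2 - int m * int k * int k1
      - int m * int k * int k2 - int m * int k1 * int k2 + 2 * int k1 * int k2 + int m"
proof -
  \<comment> \<open>With these substitutions no truncated subtraction of \<open>k\<close> or
    \<open>m\<close> remains and the claim is a polynomial identity.\<close>
  obtain s m' where s: "k = s + k1" and m': "m = Suc m'"
    using k m by (metis add.commute less_imp_add_positive not0_implies_Suc not_one_le_zero)
  have n1: "n1 = m * s + m' * k1" and n2: "n2 = m * s + m' * k1 + (k1 - k2)"
    using n k by (simp_all add: s m' algebra_simps)
  have i2: "int n2 = int m * int s + int m' * int k1 + (int k1 - int k2)"
    using k by (simp add: n2 of_nat_diff)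
  have i1: "int n1 = int m * int s + int m' * int k1" by (simp add: n1)
  have "k - k1 = s" "n1 - m * s = m' * k1" "n1 - s = m' * (s + k1)"
    by (simp_all add: s n1 m' algebra_simps)
  then show ?thesis
    by (simp add: i1 i2 s m' power2_eq_square algebra_simps)
qed

lemma defect_formula:
  fixes m k k1 k2 n1 n2 :: nat
  assumes n: "n1 = m * k - k1" "n2 = m * k - k2" "k1 \<le> m * k" "k2 \<le> m * k"
    and dim: "int (variety_dim (TNS_triangle m k m 2 n1 n2)) =
      2 * (int m)^2 * (int k)^2 - int m * (int k)^2 - int m * int k * int k1
        - int m * int k * int k2 - int m * int k1 * int k2 + 2 * int k1 * int k2 + int m"
  shows "TNS_defect m k m 2 n1 n2 =
    (if expected_dim m k m 2 n1 n2 = 2 * int n1 * int n2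
     then int m * ((int k)^2 - int k * (int k1 + int k2) + int k1 * int k2 - 1)
     else (int m - 2) * int k1 * int k2 + (int m - 1) * ((int k)^2 - 1))"
proof -
  have i: "int n1 = int m * int k - int k1" "int n2 = int m * int k - int k2"
    using n by (simp_all add: of_nat_diff)
  show ?thesis
  proof (cases "expected_dim m k m 2 n1 n2 = 2 * int n1 * int n2")
    case True
    then show ?thesis
      unfolding TNS_defect_def dim by (simp add: i power2_eq_square algebra_simps)
  next
    case False
    then have e: "expected_dim m k m 2 n1 n2 = (int 2 * int m * int m - 1) + (int n1 * int m * int k - 1)
            + (int n2 * int m * int k - 1)
            - ((int m)^2 - 1) - ((int k)^2 - 1) - ((int m)^2 - 1) + 1"
      unfolding expected_dim_def by (auto simp: min_def split: if_splits)
    show ?thesis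
      unfolding if_not_P[OF False] TNS_defect_def dim e by (simp add: i power2_eq_square algebra_simps)
  qed
qed

theorem theorem1p1:
  fixes m01 m12 m02 n1 n2 k1 k2 :: nat
  assumes "m01 \<ge> 1" and "m12 \<ge> 1" and "m02 \<ge> 1" and "n1 \<ge> 1" and "n2 \<ge> 1"
    and "2 \<le> m01 * m02" and "n1 \<le> m01 * m12" and "n2 \<le> m02 * m12"
    and "k1 = m01 * m12 - n1" and "k2 = m02 * m12 - n2"
    and "k2 \<le> k1"
  shows "let TNS = TNS_triangle m01 m12 m02 2 n1 n2;
             star = (m01 = m02 \<and> k2 \<le> k1 \<and> k1 < m12)
         in
      (\<forall>m. star \<and> m = m01 \<and> m = m02 \<longrightarrow>
        \<comment> \<open>(1) dimension and defect\<close>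
        int (variety_dim TNS) =
          2 * (int m)^2 * (int m12)^2 - int m * (int m12)^2 - int m * int m12 * int k1
            - int m * int m12 * int k2 - int m * int k1 * int k2 + 2 * int k1 * int k2 + int m
        \<and> TNS_defect m01 m12 m02 2 n1 n2 =
            (if expected_dim m01 m12 m02 2 n1 n2 = 2 * int n1 * int n2
             then int m * ((int m12)^2 - int m12 * (int k1 + int k2) + int k1 * int k2 - 1)
             else (int m - 2) * int k1 * int k2 + (int m - 1) * ((int m12)^2 - 1))
        \<comment> \<open>(2) normal form\<close>
        \<and> (let p = (m - 1) * k1; q = (m - 1) * k1 + (k1 - k2) in
            \<forall>U. nonempty_open_in (param_index m p q) (affine_space (param_index m p q)) U \<longrightarrow>
              (\<exists>Z. nonempty_open_in (tensor_index 2 n1 n2) TNS Z \<and>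
                (\<forall>T\<in>Z. \<exists>g1\<in>general_linear n1. \<exists>g2\<in>general_linear n2. \<exists>\<xi> T2.
                   case_sum \<xi> T2 \<in> U \<and>
                   pencil_mat n1 n2 T = pencil_act g1 g2 (normal_form m (m12 - k1) p q \<xi> T2))))
        \<comment> \<open>(3) equations\<close>
        \<and> (\<forall>\<kappa>. k1 \<le> \<kappa> \<and> \<kappa> + 2 \<le> m12 \<longrightarrow>
            (let n' = m * m12 - \<kappa>;
                 parts = replicate m (m12 - \<kappa>) @ replicate ((m - 1) * \<kappa>) 1
             in sum_list parts = n'
              \<and> (\<forall>T\<in>TNS. \<forall>X1\<in>carrier_mat n' n1. \<forall>X2\<in>carrier_mat n' n2.
                   det (pencil_act X1 X2 (pencil_mat n1 n2 T)) \<in> coincident_root_locus parts)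
              \<and> (\<forall>X1\<in>carrier_mat n' n1. \<forall>X2\<in>carrier_mat n' n2.
                   surjective_mat X1 \<and> surjective_mat X2 \<longrightarrow>
                   (\<exists>Z. nonempty_open_in (tensor_index 2 n1 n2) (tensor_space 2 n1 n2) Z \<and>
                     (\<forall>T\<in>Z. det (pencil_act X1 X2 (pencil_mat n1 n2 T))
                              \<notin> coincident_root_locus parts))))))
      \<and> (\<not> star \<longrightarrow>
          TNS = tensor_space 2 n1 n2 \<and> variety_dim TNS = 2 * n1 * n2)"
proof -
  let ?TNS = "TNS_triangle m01 m12 m02 2 n1 n2"
  have fill: "?TNS = tensor_space 2 n1 n2" if "\<not> (m01 = m02 \<and> k2 \<le> k1 \<and> k1 < m12)"
  proof (cases "m01 = m02")
    case True
    \<comment> \<open>With equal bonds the condition can fail only through \<open>k1\<close>, and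
      \<open>m12 \<le> k1\<close> says that the rows fit into \<open>m - 1\<close> blocks.\<close>
    then have "m12 \<le> k1" using that assms by simp
    then have "n1 \<le> (m01 - 1) * m12" using assms by (simp add: diff_mult_distrib)
    then show ?thesis using TNS_triangle_fills_equal[of m01 n1 m12 n2] assms True by simp
  next
    case False
    then show ?thesis using TNS_triangle_fills_unequal assms by simp
  qed
  have star: "int (variety_dim ?TNS) =
        2 * (int m)^2 * (int m12)^2 - int m * (int m12)^2 - int m * int m12 * int k1
          - int m * int m12 * int k2 - int m * int k1 * int k2 + 2 * int k1 * int k2 + int m"
      (is ?dim)
    "TNS_defect m01 m12 m02 2 n1 n2 =
        (if expected_dim m01 m12 m02 2 n1 n2 = 2 * int n1 * int n2
         then int m * ((int m12)^2 - int m12 * (int k1 + int k2) + int k1 * int k2 - 1)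
         else (int m - 2) * int k1 * int k2 + (int m - 1) * ((int m12)^2 - 1))"
      (is ?defect)
    "\<forall>U. nonempty_open_in (param_index m ((m - 1) * k1) ((m - 1) * k1 + (k1 - k2)))
          (affine_space (param_index m ((m - 1) * k1) ((m - 1) * k1 + (k1 - k2)))) U \<longrightarrow>
        (\<exists>Z. nonempty_open_in (tensor_index 2 n1 n2) ?TNS Z \<and>
          (\<forall>T\<in>Z. \<exists>g1\<in>general_linear n1. \<exists>g2\<in>general_linear n2. \<exists>\<xi> T2.
             case_sum \<xi> T2 \<in> U \<and>
             pencil_mat n1 n2 T = pencil_act g1 g2
               (normal_form m (m12 - k1) ((m - 1) * k1) ((m - 1) * k1 + (k1 - k2)) \<xi> T2)))"
      (is ?normal)
    "\<forall>\<kappa>. k1 \<le> \<kappa> \<and> \<kappa> + 2 \<le> m12 \<longrightarrow>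
        (let n' = m * m12 - \<kappa>;
             parts = replicate m (m12 - \<kappa>) @ replicate ((m - 1) * \<kappa>) 1
         in sum_list parts = n'
          \<and> (\<forall>T\<in>?TNS. \<forall>X1\<in>carrier_mat n' n1. \<forall>X2\<in>carrier_mat n' n2.
               det (pencil_act X1 X2 (pencil_mat n1 n2 T)) \<in> coincident_root_locus parts)
          \<and> (\<forall>X1\<in>carrier_mat n' n1. \<forall>X2\<in>carrier_mat n' n2.
               surjective_mat X1 \<and> surjective_mat X2 \<longrightarrow>
               (\<exists>Z. nonempty_open_in (tensor_index 2 n1 n2) (tensor_space 2 n1 n2) Z \<and>
                 (\<forall>T\<in>Z. det (pencil_act X1 X2 (pencil_mat n1 n2 T))
                          \<notin> coincident_root_locus parts))))"
      (is ?equations)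
    if *: "(m01 = m02 \<and> k2 \<le> k1 \<and> k1 < m12) \<and> m = m01 \<and> m = m02" for m
  proof -
    have eqs: "m01 = m" "m02 = m" and k: "k2 \<le> k1" "k1 < m12" using * by auto
    define s where "s = m12 - k1"
    have s: "s > 0" "m12 = s + k1" using k by (auto simp: s_def)
    have m: "m \<ge> 1" using assms(1) eqs by simp
    have n: "n1 = m * m12 - k1" "n2 = m * m12 - k2" "k1 \<le> m * m12" "k2 \<le> m * m12"
      using assms eqs by auto
    obtain m' where m': "m = Suc m'" using m by (cases m) auto
    have n': "n1 = m * s + (m - 1) * k1" "n2 = m * s + ((m - 1) * k1 + (k1 - k2))"
      using n k by (simp_all add: s m' algebra_simps)
    have q: "(m - 1) * k1 + (k1 - k2) \<le> m * k1" by (simp add: m')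
    have TNS: "?TNS = tensor_space 2 n1 n2 \<inter> zcl (tri_image m (s + k1) m n1 n2)"
      by (simp add: TNS_triangle_eq eqs s(2))
    have "variety_dim ?TNS = n1 * n2 + (n1 - m * s) * n2 + m * (s * (n1 - s) + 1)"
      using variety_dim_TNS_triangle[OF m s(1) k(1) n'] by (simp add: eqs s(2))
    then show dim: ?dim
      using dimension_formula[OF m k n(1,2)] by (simp only: s_def)
    then show ?defect
      using defect_formula[OF n] by (simp only: eqs)
    have normal: "normal_family n1 n2 m s \<subseteq> ?TNS"
      using normal_family_subset_zcl_tri_image[OF m s(1) q n']
      unfolding TNS by (auto simp: normal_family_def pencil_mult_def)
    have "zcl (tri_image m (s + k1) m n1 n2) \<subseteq> zcl (normal_family n1 n2 m s)"
      using tri_image_subset_zcl_row_family[OF m s(1) n'(1), of n2 0] n'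
        zcl_least[OF row_family_subset_zcl_normal_family[of m s n1 n2]] s(1)
      by (intro zcl_least) auto
    then show ?normal
      using generic_normal_form[OF s(1) n' _ _ normal] TNS unfolding s_def[symmetric] by blast
    show ?equations
    proof (intro allI impI)
      fix \<kappa> assume \<kappa>: "k1 \<le> \<kappa> \<and> \<kappa> + 2 \<le> m12"
      \<comment> \<open>\<kappa> takes over the role of \<open>k1\<close> and \<open>t\<close> that
        of \<open>s\<close>; \<open>m12 = t + \<kappa>\<close> keeps the networks the same. That
        \<open>t\<close> exceeds 1 makes the partition have fewer than n' parts, so the locus is a
        proper condition.\<close>
      define t where "t = m12 - \<kappa>"
      have t: "t > 1" "m12 = t + \<kappa>" using \<kappa> by (auto simp: t_def)
      have nk: "m * m12 - \<kappa> = m * t + (m - 1) * \<kappa>" by (simp add: t m' algebra_simps)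
      let ?n = "m * m12 - \<kappa>" and ?parts = "replicate m t @ replicate ((m - 1) * \<kappa>) 1"
      have "sum_list ?parts = ?n" unfolding nk by (simp add: sum_list_replicate)
      moreover have "det (pencil_act X1 X2 (pencil_mat n1 n2 T)) \<in> coincident_root_locus ?parts"
        if "T \<in> ?TNS" "X1 \<in> carrier_mat ?n n1" "X2 \<in> carrier_mat ?n n2" for T X1 X2
      proof -
        let ?P = "pencil_mult ?n ?n n1 n2 (\<lambda>i u. X1 $$ (i, u)) (\<lambda>j v. X2 $$ (j, v)) T"
        have "T \<in> zcl (tri_image m (t + \<kappa>) m n1 n2)"
          using that(1) TNS s(2) t(2) by auto
        then have "?P \<in> zcl (tri_image m (t + \<kappa>) m ?n ?n)"
          by (rule pencil_mult_zcl_tri_image)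
        then show ?thesis
          using det_closure_mem_coincident_root_locus[OF m _ nk] t(1)
          unfolding pencil_act_pencil_mat[OF that(2,3)] by simp
      qed
      moreover have "length ?parts < ?n"
        using t(1) m unfolding nk by simp
      then have "\<exists>Z. nonempty_open_in (tensor_index 2 n1 n2) (tensor_space 2 n1 n2) Z \<and>
          (\<forall>T\<in>Z. det (pencil_act X1 X2 (pencil_mat n1 n2 T)) \<notin> coincident_root_locus ?parts)"
        if "X1 \<in> carrier_mat ?n n1" "X2 \<in> carrier_mat ?n n2" "surjective_mat X1 \<and> surjective_mat X2" for X1 X2
        using generic_det_not_mem_coincident_root_locus[OF that(1,2)] that(3) by blast
      ultimately show "let n' = m * m12 - \<kappa>; parts = replicate m (m12 - \<kappa>) @ replicate ((m - 1) * \<kappa>) 1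
         in sum_list parts = n'
          \<and> (\<forall>T\<in>?TNS. \<forall>X1\<in>carrier_mat n' n1. \<forall>X2\<in>carrier_mat n' n2.
               det (pencil_act X1 X2 (pencil_mat n1 n2 T)) \<in> coincident_root_locus parts)
          \<and> (\<forall>X1\<in>carrier_mat n' n1. \<forall>X2\<in>carrier_mat n' n2.
               surjective_mat X1 \<and> surjective_mat X2 \<longrightarrow>
               (\<exists>Z. nonempty_open_in (tensor_index 2 n1 n2) (tensor_space 2 n1 n2) Z \<and>
                 (\<forall>T\<in>Z. det (pencil_act X1 X2 (pencil_mat n1 n2 T))
                          \<notin> coincident_root_locus parts)))"
        unfolding Let_def t_def[symmetric] by blast
    qed
  qed
  show ?thesis
    unfolding Let_def
    using star[unfolded Let_def] fill variety_dim_tensor_space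
    by (intro conjI allI impI) (rule star[unfolded Let_def] | simp)+
qed

end
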